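(* Let $\mathcal{C}_F$ be a plane branch with value semigroup $\Gamma_F=\langle v_0,\ldots,v_g\rangle$, characteristic exponents $\beta_0,\ldots,\beta_g$, Puiseux parameterization $\varphi(t)=\left(t^{\beta_0},\sum_{k\ge\beta_1}c_kt^k\right)$ and canonical system of semiroots $\{F_0=x,F_1,\ldots,F_g,F_{g+1}=F\}$. Let $0\le i<g$ and let $\mathcal{F}_\omega$ be the singular holomorphic foliation in $(\mathbb{C}^2,0)$ defined by $\omega=H_1\omega_{ig}+dH_2$, where $\omega_{ig}=v_iF_idF_g-v_gF_gdF_i$, $H_1,H_2\in\mathbb{C}\{x\}[y]$, $\deg_yH_1<\deg_yF=v_0$, $\deg_yH_2<\deg_yF=v_0$, $H_1\neq0$ and $H_2\in\langle x,y\rangle$. Then $\mathcal{F}_\omega$ is dicritical in the last triple point $T_g$ of the dual graph $G(\mathcal{C}_F)$ if and only if $$I(F,H_1)+v_i+v_g<I(F,H_2).$$ Moreover, in this case there exist $s_j(u)\in\mathbb{C}(u)$, $j>\beta_g$, defined at every $u\in\mathbb{C}^*$, such that for every $u\in\mathbb{C}^*$ the plane branch parameterized by $$\psi_u(t)=\left(t^{\beta_0},\ \sum_{\beta_1\le j<\beta_g}c_jt^j+ut^{\beta_g}+\sum_{j>\beta_g}s_j(u)t^j\right)$$ is a separatrix of $\mathcal{F}_\omega$ whose strict transform intersects transversally the component of the exceptional divisor corresponding to the triple point $T_g$ of $G(\mathcal{C}_F)$.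
   Context: Branch data. $F\in\mathbb{C}\{x\}[y]$ is an irreducible Weierstrass polynomial with $\deg_yF=\mathrm{mult}(F)=n>1$, $\mathcal{C}_F=\{F=0\}$, with coordinates normalized so that $\mathcal{C}_F$ has a primitive Puiseux parameterization $\varphi(t)=\left(t^{n},\sum_{k\ge\beta_1}c_kt^k\right)$ with $\beta_1>n$, $n\nmid\beta_1$, $c_{\beta_1}\ne0$. Put $\beta_0=e_0=n$, $\beta_j=\min\{k:\ e_{j-1}\nmid k,\ c_k\neq0\}$, $e_j=\gcd(e_{j-1},\beta_j)$, until $e_g=1$; the $\beta_j$ are the characteristic exponents. Put $n_0=1$, $n_i=e_{i-1}/e_i$, and $v_0=n$, $v_1=\beta_1$, $v_i=n_{i-1}v_{i-1}+\beta_i-\beta_{i-1}$ for $2\le i\le g$. The intersection multiplicity is $I(F,G)=\dim_{\mathbb{C}}\mathbb{C}\{x,y\}/\langle F,G\rangle=\mathrm{ord}_tG(\varphi(t))$ ($=\infty$ if $F\mid G$, in particular if $G=0$). The value semigroup $\Gamma_F=\{I(F,G):G\in\mathbb{C}\{x,y\}\}$ is minimally generated by $v_0,\ldots,v_g$. Canonical system of semiroots: $F_0=x$, $F_{g+1}=F$ and, for $1\le i\le g$, $F_i\in\mathbb{C}\{x\}[y]$ is the minimal polynomial over $\mathbb{C}((x))$ of $\sum_{\beta_1\le k<\beta_i}c_kx^{k/n}$ (so $F_1=y$). One has $\deg_yF_i=v_0/e_{i-1}$ for $i\geq 1$ and $I(F,F_i)=v_i$ for $0\le i\le g$. Foliations.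 A 1-form $\omega=A\,dx+B\,dy$ with $A,B\in\mathbb{C}\{x,y\}$ defines a singular foliation $\mathcal{F}_\omega$ when $A(0,0)=B(0,0)=0$ and $\gcd(A,B)=1$. A branch $\mathcal{C}_G$ with parameterization $\psi(t)=(x(t),y(t))$ is a separatrix (invariant curve) of $\mathcal{F}_\omega$ if $\psi^*(\omega):=A(\psi(t))x'(t)+B(\psi(t))y'(t)=0$. Dual graph. $G(\mathcal{C}_F)$ is the dual graph of the canonical (minimal) embedded resolution of $\mathcal{C}_F$, including an arrow for the strict transform of $\mathcal{C}_F$. It has $g$ triple points (vertices with three incident edges, counting the arrow) $T_1,\ldots,T_g$, listed in the order in which they appear in the resolution process. $\mathcal{F}_\omega$ is dicritical in a vertex of $G(\mathcal{C}_F)$ if the corresponding irreducible component of the exceptional divisor is generically transversal to the strict transform of $\mathcal{F}_\omega$. *)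

theory Defs
  imports
    "HOL-Analysis.FPS_Convergence"
    "HOL-Computational_Algebra.Computational_Algebra"
    "HOL-Library.Extended_Nat"
begin

unbundle no vec_syntax
unbundle fps_syntax

section \<open>The rings of convergent series\<close>

text \<open>
  A bivariate power series is an element of \<^typ>\<open>complex fps fps\<close> whose outer variable is \<open>y\<close> and
  whose inner variable is \<open>x\<close>: the coefficient of \<open>x\<^sup>i y\<^sup>j\<close> in \<open>f\<close> is \<open>f $ j $ i\<close>. A polynomial in \<open>y\<close>
  over the power series in \<open>x\<close> is an element of \<^typ>\<open>complex fps poly\<close>; it is regarded as a
  bivariate series by means of \<^const>\<open>fps_of_poly\<close>.
\<close>

definition convergent_series :: "complex fps set" where
  "convergent_series = {f. fps_conv_radius f > 0}"

definition convergent_polys :: "complex fps poly set" where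
  "convergent_polys = {G. \<forall>j. coeff G j \<in> convergent_series}"

definition convergent_series2 :: "complex fps fps set" where
  "convergent_series2 = {f. \<exists>C r :: real. \<forall>i j. norm (f $ j $ i) \<le> C * r ^ (i + j)}"

definition var_x :: "complex fps fps" where
  "var_x = fps_const fps_X"

definition var_y :: "complex fps fps" where
  "var_y = fps_X"

definition unit_in :: "'a::comm_ring_1 set \<Rightarrow> 'a \<Rightarrow> bool" where
  "unit_in R a \<longleftrightarrow> a \<in> R \<and> (\<exists>b\<in>R. a * b = 1)"

definition irreducible_in :: "'a::comm_ring_1 set \<Rightarrow> 'a \<Rightarrow> bool" where
  "irreducible_in R p \<longleftrightarrow> p \<in> R \<and> p \<noteq> 0 \<and> \<not> unit_in R p \<and>
     (\<forall>a\<in>R. \<forall>b\<in>R. p = a * b \<longrightarrow> unit_in R a \<or> unit_in R b)"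

definition coprime_in :: "'a::comm_ring_1 set \<Rightarrow> 'a \<Rightarrow> 'a \<Rightarrow> bool" where
  "coprime_in R a b \<longleftrightarrow>
     (\<forall>d\<in>R. (\<exists>p\<in>R. a = d * p) \<longrightarrow> (\<exists>q\<in>R. b = d * q) \<longrightarrow> unit_in R d)"

definition multiplicity_at_0 :: "complex fps fps \<Rightarrow> nat" where
  "multiplicity_at_0 f = (LEAST m. \<exists>i j. i + j = m \<and> f $ j $ i \<noteq> 0)"

definition weierstrass_poly :: "complex fps poly \<Rightarrow> bool" where
  "weierstrass_poly F \<longleftrightarrow> F \<in> convergent_polys \<and> lead_coeff F = 1 \<and>
     (\<forall>j < degree F. coeff F j $ 0 = 0)"

definition max_ideal2 :: "complex fps fps set" where
  "max_ideal2 =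
     {f. \<exists>P\<in>convergent_series2. \<exists>Q\<in>convergent_series2. f = var_x * P + var_y * Q}"


section \<open>Branch data\<close>

text \<open>A parameterization \<open>t \<mapsto> (a(t), b(t))\<close> is the pair \<open>(a, b)\<close>.\<close>

type_synonym param = "complex fps \<times> complex fps"

definition eval_param :: "complex fps poly \<Rightarrow> param \<Rightarrow> complex fps" where
  "eval_param G \<phi> = poly (map_poly (\<lambda>a. fps_compose a (fst \<phi>)) G) (snd \<phi>)"

definition puiseux_param :: "nat \<Rightarrow> complex fps \<Rightarrow> param" where
  "puiseux_param n s = (fps_X ^ n, s)"

text \<open>
  The series \<open>s\<close> is the second coordinate of the Puiseux parameterization \<open>(t\<^sup>n, s(t))\<close>.
  Its order is the first characteristic exponent, since \<open>n\<close> does not divide it.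
\<close>

definition normalized_branch :: "complex fps poly \<Rightarrow> nat \<Rightarrow> complex fps \<Rightarrow> bool" where
  "normalized_branch F n s \<longleftrightarrow>
     weierstrass_poly F \<and> irreducible_in convergent_series2 (fps_of_poly F) \<and>
     degree F = n \<and> multiplicity_at_0 (fps_of_poly F) = n \<and> n > 1 \<and>
     s \<in> convergent_series \<and> s \<noteq> 0 \<and> n < subdegree s \<and> \<not> n dvd subdegree s \<and>
     Gcd (insert n {k. s $ k \<noteq> 0}) = 1 \<and>
     eval_param F (puiseux_param n s) = 0"

text \<open>The pair of the \<open>j\<close>-th characteristic exponent \<open>\<beta>\<^sub>j\<close> and of the gcd \<open>e\<^sub>j\<close> (meaningful for \<open>j \<le> g\<close>).\<close>

primrec char_data :: "nat \<Rightarrow> complex fps \<Rightarrow> nat \<Rightarrow> nat \<times> nat" where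
  "char_data n s 0 = (n, n)"
| "char_data n s (Suc j) =
     (let e = snd (char_data n s j);
          b = (LEAST k. \<not> e dvd k \<and> s $ k \<noteq> 0)
      in (b, gcd e b))"

definition char_exp :: "nat \<Rightarrow> complex fps \<Rightarrow> nat \<Rightarrow> nat" where
  "char_exp n s j = fst (char_data n s j)"

definition char_gcd :: "nat \<Rightarrow> complex fps \<Rightarrow> nat \<Rightarrow> nat" where
  "char_gcd n s j = snd (char_data n s j)"

definition genus :: "nat \<Rightarrow> complex fps \<Rightarrow> nat" where
  "genus n s = (LEAST j. char_gcd n s j = 1)"

definition char_quot :: "nat \<Rightarrow> complex fps \<Rightarrow> nat \<Rightarrow> nat" where
  "char_quot n s i = (if i = 0 then 1 else char_gcd n s (i - 1) div char_gcd n s i)"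

text \<open>The generators \<open>v\<^sub>0, \<dots>, v\<^sub>g\<close> of the value semigroup; the formula for \<open>v\<^sub>1\<close> gives \<open>\<beta>\<^sub>1\<close>.\<close>

primrec semigroup_gen :: "nat \<Rightarrow> complex fps \<Rightarrow> nat \<Rightarrow> nat" where
  "semigroup_gen n s 0 = n"
| "semigroup_gen n s (Suc i) =
     char_quot n s i * semigroup_gen n s i + char_exp n s (Suc i) - char_exp n s i"

text \<open>The intersection multiplicity of the branch parameterized by \<open>\<phi>\<close> with the curve \<open>G = 0\<close>.\<close>

definition intersection_mult :: "param \<Rightarrow> complex fps poly \<Rightarrow> enat" where
  "intersection_mult \<phi> G =
     (if eval_param G \<phi> = 0 then \<infinity> else enat (subdegree (eval_param G \<phi>)))"

text \<open>
  The field of Laurent series in \<open>x\<close> acts on the Laurent series in \<open>t = x\<^bsup>1/n\<^esup>\<close> through \<open>x \<mapsto> t\<^sup>n\<close>.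
  The minimal polynomial of a series in \<open>x\<^bsup>1/n\<^esup>\<close> is taken with respect to this embedding.
\<close>

definition annihilates :: "nat \<Rightarrow> complex fls poly \<Rightarrow> complex fls \<Rightarrow> bool" where
  "annihilates n P z \<longleftrightarrow> poly (map_poly (\<lambda>a. fls_compose_power a n) P) z = 0"

definition is_min_poly :: "nat \<Rightarrow> complex fls poly \<Rightarrow> complex fls \<Rightarrow> bool" where
  "is_min_poly n P z \<longleftrightarrow> lead_coeff P = 1 \<and> annihilates n P z \<and>
     (\<forall>Q. Q \<noteq> 0 \<and> annihilates n Q z \<longrightarrow> degree P \<le> degree Q)"

definition canonical_semiroots ::
    "complex fps poly \<Rightarrow> nat \<Rightarrow> complex fps \<Rightarrow> (nat \<Rightarrow> complex fps poly) \<Rightarrow> bool" where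
  "canonical_semiroots F n s Fs \<longleftrightarrow>
     Fs 0 = [:fps_X:] \<and> Fs (genus n s + 1) = F \<and>
     (\<forall>i\<in>{1..genus n s}. Fs i \<in> convergent_polys \<and>
        is_min_poly n (map_poly fps_to_fls (Fs i))
          (fps_to_fls (fps_cutoff (char_exp n s i) s)))"


section \<open>Foliations\<close>

definition dx_poly :: "complex fps poly \<Rightarrow> complex fps poly" where
  "dx_poly G = map_poly fps_deriv G"

text \<open>
  The form \<open>\<omega> = H\<^sub>1 (p K dL - q L dK) + dH\<^sub>2\<close> is the pair \<open>(A, B)\<close> with \<open>\<omega> = A dx + B dy\<close>;
  both coefficients arise from one expression in a derivation \<open>D\<close>.
\<close>

definition omega_coeff :: "(complex fps poly \<Rightarrow> complex fps poly) \<Rightarrow> nat \<Rightarrow> nat \<Rightarrow>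
    complex fps poly \<Rightarrow> complex fps poly \<Rightarrow> complex fps poly \<Rightarrow> complex fps poly \<Rightarrow>
    complex fps poly" where
  "omega_coeff D p q K L H1 H2 = H1 * (of_nat p * K * D L - of_nat q * L * D K) + D H2"

definition omega_form :: "nat \<Rightarrow> complex fps \<Rightarrow> (nat \<Rightarrow> complex fps poly) \<Rightarrow> nat \<Rightarrow>
    complex fps poly \<Rightarrow> complex fps poly \<Rightarrow> complex fps poly \<times> complex fps poly" where
  "omega_form n s Fs i H1 H2 =
     (let g = genus n s; vi = semigroup_gen n s i; vg = semigroup_gen n s g
      in (omega_coeff dx_poly vi vg (Fs i) (Fs g) H1 H2,
          omega_coeff pderiv vi vg (Fs i) (Fs g) H1 H2))"

definition singular_foliation :: "complex fps poly \<times> complex fps poly \<Rightarrow> bool" where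
  "singular_foliation \<omega> \<longleftrightarrow>
     fps_of_poly (fst \<omega>) \<in> convergent_series2 \<and> fps_of_poly (snd \<omega>) \<in> convergent_series2 \<and>
     fps_of_poly (fst \<omega>) $ 0 $ 0 = 0 \<and> fps_of_poly (snd \<omega>) $ 0 $ 0 = 0 \<and>
     coprime_in convergent_series2 (fps_of_poly (fst \<omega>)) (fps_of_poly (snd \<omega>))"

definition branch_param :: "param \<Rightarrow> bool" where
  "branch_param \<psi> \<longleftrightarrow> fst \<psi> \<in> convergent_series \<and> snd \<psi> \<in> convergent_series \<and>
     fst \<psi> $ 0 = 0 \<and> snd \<psi> $ 0 = 0 \<and> \<psi> \<noteq> (0, 0)"

definition separatrix :: "complex fps poly \<times> complex fps poly \<Rightarrow> param \<Rightarrow> bool" where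
  "separatrix \<omega> \<psi> \<longleftrightarrow> branch_param \<psi> \<and>
     eval_param (fst \<omega>) \<psi> * fps_deriv (fst \<psi>) + eval_param (snd \<omega>) \<psi> * fps_deriv (snd \<psi>) = 0"


section \<open>Blowing up along a branch\<close>

text \<open>
  \<open>Some c\<close> is the tangent direction \<open>y = c x\<close> and \<open>None\<close> is the direction \<open>x = 0\<close>. Blowing up the
  origin, the point of the exceptional line with direction \<open>Some c\<close> has coordinates with
  \<open>(x, y) = (x', x' (y' + c))\<close>, where the exceptional line is \<open>x' = 0\<close>; the point with direction
  \<open>None\<close> has coordinates with \<open>(x, y) = (x' y', y')\<close>, where the exceptional line is \<open>y' = 0\<close>.
\<close>

type_synonym direction = "complex option"

text \<open>Divisibility of power series compares orders and also covers a vanishing coordinate.\<close>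

definition tangent :: "param \<Rightarrow> direction" where
  "tangent \<psi> = (if fst \<psi> dvd snd \<psi> then Some ((snd \<psi> div fst \<psi>) $ 0) else None)"

definition transform_step :: "param \<Rightarrow> param" where
  "transform_step \<psi> = (case tangent \<psi> of
       Some c \<Rightarrow> (fst \<psi>, snd \<psi> div fst \<psi> - fps_const c)
     | None \<Rightarrow> (fst \<psi> div snd \<psi>, snd \<psi>))"

text \<open>
  Let \<open>p\<^sub>0\<close> be the origin and \<open>p\<^bsub>k+1\<^esub>\<close> the point in which the strict transform of \<open>\<psi>\<close> meets the
  exceptional line \<open>E\<^bsub>k+1\<^esub>\<close> of the blow-up of \<open>p\<^sub>k\<close>. Then \<open>strict_transform \<psi> k\<close> parameterizes the
  strict transform at \<open>p\<^sub>k\<close> in the coordinates above, and \<open>direction_at \<psi> k\<close> is its direction.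
\<close>

definition strict_transform :: "param \<Rightarrow> nat \<Rightarrow> param" where
  "strict_transform \<psi> k = (transform_step ^^ k) \<psi>"

definition direction_at :: "param \<Rightarrow> nat \<Rightarrow> direction" where
  "direction_at \<psi> k = tangent (strict_transform \<psi> k)"

text \<open>
  In the coordinates at \<open>p\<^sub>k\<close> every exceptional component through \<open>p\<^sub>k\<close> is a coordinate axis. The
  first entry of \<open>axes \<psi> k\<close> is the index of the component \<open>x = 0\<close> and the second one that of \<open>y = 0\<close>
  (\<open>None\<close> if the axis is not exceptional). An old axis passes through the new point exactly
  when its direction is the one that is followed.
\<close>

primrec axes :: "param \<Rightarrow> nat \<Rightarrow> nat option \<times> nat option" where
  "axes \<psi> 0 = (None, None)"
| "axes \<psi> (Suc k) = (case direction_at \<psi> k of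
       Some c \<Rightarrow> (Some (Suc k), if c = 0 then snd (axes \<psi> k) else None)
     | None \<Rightarrow> (fst (axes \<psi> k), Some (Suc k)))"

definition components_at :: "param \<Rightarrow> nat \<Rightarrow> nat set" where
  "components_at \<psi> k = set_option (fst (axes \<psi> k)) \<union> set_option (snd (axes \<psi> k))"

text \<open>
  The strict transform at \<open>p\<^sub>k\<close> is transversal to the component \<open>E\<^sub>v\<close>: its velocity vector does not
  lie in the tangent line of \<open>E\<^sub>v\<close>.
\<close>

definition transversal_at :: "param \<Rightarrow> nat \<Rightarrow> nat \<Rightarrow> bool" where
  "transversal_at \<psi> k v \<longleftrightarrow>
     fst (axes \<psi> k) = Some v \<and> fst (strict_transform \<psi> k) $ 1 \<noteq> 0 \<or>
     snd (axes \<psi> k) = Some v \<and> snd (strict_transform \<psi> k) $ 1 \<noteq> 0"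


section \<open>The minimal embedded resolution and its dual graph\<close>

text \<open>
  Away from the strict transform the exceptional divisor always has normal crossings, so that
  the total transform after \<open>k\<close> blow-ups has normal crossings iff it has at \<open>p\<^sub>k\<close>.
\<close>

definition normal_crossings_at :: "param \<Rightarrow> nat \<Rightarrow> bool" where
  "normal_crossings_at \<phi> k \<longleftrightarrow>
     (fst (strict_transform \<phi> k) $ 1 \<noteq> 0 \<or> snd (strict_transform \<phi> k) $ 1 \<noteq> 0) \<and>
     card (components_at \<phi> k) \<le> 1 \<and>
     (\<forall>v \<in> components_at \<phi> k. transversal_at \<phi> k v)"

text \<open>
  The number \<open>N\<close> of blow-ups: the minimal embedded resolution blows up \<open>p\<^sub>0, \<dots>, p\<^bsub>N-1\<^esub>\<close> and has the
  exceptional components \<open>E\<^sub>1, \<dots>, E\<^sub>N\<close>, which are the vertices of the dual graph.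
\<close>

definition resolution_length :: "param \<Rightarrow> nat" where
  "resolution_length \<phi> = (LEAST k. normal_crossings_at \<phi> k)"

text \<open>
  For \<open>j < k\<close>, the component \<open>E\<^sub>k\<close> meets \<open>E\<^sub>j\<close> when it is created iff \<open>E\<^sub>j\<close> contains its centre
  \<open>p\<^bsub>k-1\<^esub>\<close>, and then in one point; they are separated iff this point is blown up later.
\<close>

definition components_meet :: "param \<Rightarrow> nat \<Rightarrow> nat \<Rightarrow> bool" where
  "components_meet \<phi> j k \<longleftrightarrow> j < k \<and> j \<in> components_at \<phi> (k - 1) \<and>
     \<not> (\<exists>l. k \<le> l \<and> l < resolution_length \<phi> \<and> {j, k} \<subseteq> components_at \<phi> l)"

definition dual_vertices :: "param \<Rightarrow> nat set" where
  "dual_vertices \<phi> = {1..resolution_length \<phi>}"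

definition dual_adjacent :: "param \<Rightarrow> nat \<Rightarrow> nat \<Rightarrow> bool" where
  "dual_adjacent \<phi> j k \<longleftrightarrow> j \<in> dual_vertices \<phi> \<and> k \<in> dual_vertices \<phi> \<and>
     (components_meet \<phi> j k \<or> components_meet \<phi> k j)"

text \<open>The arrow is attached to the vertices whose component meets the strict transform.\<close>

definition dual_valence :: "param \<Rightarrow> nat \<Rightarrow> nat" where
  "dual_valence \<phi> v = card {w. dual_adjacent \<phi> v w} +
     (if v \<in> components_at \<phi> (resolution_length \<phi>) then 1 else 0)"

definition last_triple_point :: "param \<Rightarrow> nat" where
  "last_triple_point \<phi> = Max {v \<in> dual_vertices \<phi>. dual_valence \<phi> v = 3}"


section \<open>Strict transforms of foliations and of other branches\<close>

text \<open>Substitution of series without constant term; only finitely many terms contribute.\<close>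

definition subst2 ::
    "complex fps fps \<Rightarrow> complex fps fps \<times> complex fps fps \<Rightarrow> complex fps fps" where
  "subst2 f \<pi> = Abs_fps (\<lambda>j. Abs_fps (\<lambda>i.
     \<Sum>p\<le>i + j. \<Sum>q\<le>i + j. f $ q $ p * (fst \<pi> ^ p * snd \<pi> ^ q) $ j $ i))"

definition dx2 :: "complex fps fps \<Rightarrow> complex fps fps" where
  "dx2 f = Abs_fps (\<lambda>j. fps_deriv (f $ j))"

definition dy2 :: "complex fps fps \<Rightarrow> complex fps fps" where
  "dy2 f = fps_deriv f"

definition pullback_form :: "complex fps fps \<times> complex fps fps \<Rightarrow>
    complex fps fps \<times> complex fps fps \<Rightarrow> complex fps fps \<times> complex fps fps" where
  "pullback_form \<pi> \<omega> =
     (subst2 (fst \<omega>) \<pi> * dx2 (fst \<pi>) + subst2 (snd \<omega>) \<pi> * dx2 (snd \<pi>),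
      subst2 (fst \<omega>) \<pi> * dy2 (fst \<pi>) + subst2 (snd \<omega>) \<pi> * dy2 (snd \<pi>))"

definition blowup_chart :: "direction \<Rightarrow> complex fps fps \<times> complex fps fps" where
  "blowup_chart d = (case d of
       Some c \<Rightarrow> (var_x, var_x * (var_y + fps_const (fps_const c)))
     | None \<Rightarrow> (var_x * var_y, var_y))"

text \<open>The pull-back of a form to the coordinates at \<open>p\<^sub>k\<close>.\<close>

primrec total_transform :: "param \<Rightarrow> complex fps fps \<times> complex fps fps \<Rightarrow> nat \<Rightarrow>
    complex fps fps \<times> complex fps fps" where
  "total_transform \<phi> \<omega> 0 = \<omega>"
| "total_transform \<phi> \<omega> (Suc k) =
     pullback_form (blowup_chart (direction_at \<phi> k)) (total_transform \<phi> \<omega> k)"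

text \<open>
  The strict transform of the foliation along \<open>x = 0\<close> is obtained by dividing the pull-back by the
  highest power of \<open>x\<close>. With \<open>A\<^sub>1 dx + B\<^sub>1 dy\<close> the resulting form, its leaves are transversal to
  \<open>x = 0\<close> at the points with \<open>B\<^sub>1(0, y) \<noteq> 0\<close>; if there are any, then \<open>x\<close> does not divide
  \<open>B\<^sub>1\<close>, so the power is the highest one. As \<open>E\<^sub>v\<close> is connected, its generic points can be inspected
  near \<open>p\<^sub>v\<close>.
\<close>

definition transversal_to_x_axis_0 :: "complex fps fps \<times> complex fps fps \<Rightarrow> bool" where
  "transversal_to_x_axis_0 \<eta> \<longleftrightarrow> (\<exists>m A1 B1.
     fst \<eta> = var_x ^ m * A1 \<and> snd \<eta> = var_x ^ m * B1 \<and> (\<exists>j. B1 $ j $ 0 \<noteq> 0))"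

definition transversal_to_y_axis_0 :: "complex fps fps \<times> complex fps fps \<Rightarrow> bool" where
  "transversal_to_y_axis_0 \<eta> \<longleftrightarrow> (\<exists>m A1 B1.
     fst \<eta> = var_y ^ m * A1 \<and> snd \<eta> = var_y ^ m * B1 \<and> (\<exists>i. A1 $ 0 $ i \<noteq> 0))"

definition dicritical_in ::
    "param \<Rightarrow> complex fps poly \<times> complex fps poly \<Rightarrow> nat \<Rightarrow> bool" where
  "dicritical_in \<phi> \<omega> v \<longleftrightarrow>
     (let \<eta> = total_transform \<phi> (fps_of_poly (fst \<omega>), fps_of_poly (snd \<omega>)) v in
      fst (axes \<phi> v) = Some v \<and> transversal_to_x_axis_0 \<eta> \<or>
      snd (axes \<phi> v) = Some v \<and> transversal_to_y_axis_0 \<eta>)"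

text \<open>
  The number of those blow-ups in the resolution of \<open>\<phi>\<close> that are centred on the strict transform of
  \<open>\<psi>\<close>: either all of them, or \<open>\<psi>\<close> and \<open>\<phi>\<close> leave \<open>p\<^sub>k\<close> in different directions and the strict
  transform of \<open>\<psi>\<close> is unaffected by the blow-ups after that of \<open>p\<^sub>k\<close>.
\<close>

definition common_blowups :: "param \<Rightarrow> param \<Rightarrow> nat" where
  "common_blowups \<phi> \<psi> = (LEAST m. m = resolution_length \<phi> \<or>
     (\<exists>k. m = Suc k \<and> direction_at \<psi> k \<noteq> direction_at \<phi> k))"

definition meets_transversally :: "param \<Rightarrow> param \<Rightarrow> nat \<Rightarrow> bool" where
  "meets_transversally \<phi> \<psi> v \<longleftrightarrow> transversal_at \<psi> (common_blowups \<phi> \<psi>) v"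


section \<open>Rational functions and the family of separatrices\<close>

definition rational_defined_on :: "complex set \<Rightarrow> (complex \<Rightarrow> complex) \<Rightarrow> bool" where
  "rational_defined_on U f \<longleftrightarrow>
     (\<exists>p q :: complex poly. \<forall>u\<in>U. poly q u \<noteq> 0 \<and> f u = poly p u / poly q u)"

definition separatrix_family ::
    "nat \<Rightarrow> complex fps \<Rightarrow> (nat \<Rightarrow> complex \<Rightarrow> complex) \<Rightarrow> complex \<Rightarrow> param" where
  "separatrix_family n s r u =
     (let b1 = char_exp n s 1; bg = char_exp n s (genus n s) in
      (fps_X ^ n, Abs_fps (\<lambda>j.
         if b1 \<le> j \<and> j < bg then s $ j
         else if j = bg then u
         else if j > bg then r j u
         else 0)))"

end

theory Submission
  imports Defs
begin

text \<open>
  The last characteristic coefficient is replaced by a parameter: let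
  \<open>\<Phi>(t,u) = (t\<^sup>n, S(t) + u t\<^sup>b)\<close>, where \<open>b = \<beta>\<^sub>g\<close> and \<open>S\<close> consists of the terms of \<open>s\<close> of order less
  than \<open>b\<close>. The semiroots split into linear factors over the conjugates of truncated series, so that
  \<open>F\<^sub>i \<circ> \<Phi>\<close> has leading term \<open>a t\<^bsup>v\<^sub>i\<^esup>\<close> for \<open>i < g\<close> and \<open>a u t\<^bsup>v\<^sub>g\<^esup>\<close> for \<open>i = g\<close>. Iterated division by the
  semiroots then shows that the leading term of \<open>H \<circ> \<Phi>\<close> is \<open>\<kappa> u\<^sup>k t\<^bsup>I(F,H)\<^esup>\<close> if \<open>deg\<^sub>y H < n\<close>. Hence the
  pull-back of \<open>\<omega>\<close> is \<open>t\<^sup>m (A dt + B du)\<close>, and it can be written such that \<open>B(0,u)\<close> is not zero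
  exactly under the stated inequality; in this case \<open>B(0,u)\<close> is a monomial.

  For \<open>u \<noteq> 0\<close> the map \<open>\<Phi>\<close> lifts through the blow-ups to a local isomorphism onto a neighbourhood of a
  point of the component of \<open>T\<^sub>g\<close>, which is \<open>t = 0\<close>. To see this, the family is followed through the
  resolution. Each blow-up divides the Jacobian determinant by the coordinate that defines the new
  component, and its order detects the moment when the leading coefficients begin to depend on \<open>u\<close>;
  from then on the Euclidean algorithm for the orders of the coordinates determines the blow-ups.
  So \<open>\<F>\<close> is dicritical in \<open>T\<^sub>g\<close> iff \<open>B(0,u) \<noteq> 0\<close>, and the separatrices are the solutions of
  \<open>A + B u' = 0\<close>, whose coefficients have denominators that are powers of \<open>u(0)\<close>.
\<close>

section \<open>Substitution and pull-back of two-variable series\<close>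

text \<open>The weights in \<open>v_i F_i dF_g - v_g F_g dF_i\<close> are those for which the
  leading terms of the dt-part cancel, while the du-part keeps one because only \<open>F_g\<close>
  shows \<open>u\<close> to leading order. So \<open>H_1\<close> times this form has order at least
  \<open>I(F,H_1) + v_i + v_g\<close> in both parts, and \<open>dH_2\<close> competes with it: its
  dt-part loses one order, its du-part none. No continued fractions of the characteristic exponents
  are needed. It suffices that the orders \<open>a\<close> and \<open>b\<close> of the two
  coordinates are coprime once \<open>u\<close> appears, and this is read off from the semigroup:
  \<open>x\<close> and \<open>y\<close> are polynomials in the current coordinates, so
  \<open>gcd a b\<close> divides every \<open>v_i\<close>. Two coefficient rings occur because
  divisions require units as leading coefficients. Until \<open>u\<close> appears these are
  constants, units of \<open>\<complex>[u]\<close>; afterwards one of them is a multiple of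
  \<open>u\<close>, which is invertible only in series around a value \<open>u \<noteq> 0\<close>.
  The number of blow-ups and all directions but the last are fixed before this value is
  chosen.\<close>

definition order_ideal :: "nat \<Rightarrow> complex fps fps set" where
  "order_ideal K = {f. \<forall>i j. i + j < K \<longrightarrow> f $ j $ i = 0}"

lemma order_idealI: "(\<And>i j. i + j < K \<Longrightarrow> f $ j $ i = 0) \<Longrightarrow> f \<in> order_ideal K"
  by (simp add: order_ideal_def)

lemma order_idealD: "f \<in> order_ideal K \<Longrightarrow> i + j < K \<Longrightarrow> f $ j $ i = 0"
  by (simp add: order_ideal_def)

lemma order_ideal_0 [simp]: "order_ideal 0 = UNIV"
  by (simp add: order_ideal_def)

lemma order_ideal_add: "f \<in> order_ideal K \<Longrightarrow> g \<in> order_ideal K \<Longrightarrow> f + g \<in> order_ideal K"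
  by (simp add: order_ideal_def)

lemma order_ideal_diff: "f \<in> order_ideal K \<Longrightarrow> g \<in> order_ideal K \<Longrightarrow> f - g \<in> order_ideal K"
  by (simp add: order_ideal_def)

lemma order_ideal_mono: "f \<in> order_ideal K \<Longrightarrow> L \<le> K \<Longrightarrow> f \<in> order_ideal L"
  by (simp add: order_ideal_def)

lemma fps_fps_mult_nth:
  "(f * g) $ j $ i = (\<Sum>b\<le>j. \<Sum>a\<le>i. f $ b $ a * g $ (j - b) $ (i - a))"
  for f g :: "complex fps fps"
  by (simp add: fps_mult_nth fps_sum_nth atLeast0AtMost)

lemma order_ideal_mult:
  assumes "f \<in> order_ideal K" "g \<in> order_ideal L"
  shows "f * g \<in> order_ideal (K + L)"
proof (rule order_idealI)
  fix i j :: nat assume ij: "i + j < K + L"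
  have "f $ b $ a * g $ (j - b) $ (i - a) = 0" if "b \<le> j" "a \<le> i" for a b
  proof (cases "a + b < K")
    case True thus ?thesis using order_idealD[OF assms(1)] by simp
  next
    case False
    hence "(i - a) + (j - b) < L" using ij that by linarith
    thus ?thesis using order_idealD[OF assms(2)] by simp
  qed
  thus "(f * g) $ j $ i = 0"
    unfolding fps_fps_mult_nth by (intro sum.neutral ballI) simp
qed

lemma order_ideal_mult_left: "g \<in> order_ideal K \<Longrightarrow> f * g \<in> order_ideal K"
  using order_ideal_mult[of f 0 g K] by simp

lemma order_ideal_mult_right: "f \<in> order_ideal K \<Longrightarrow> f * g \<in> order_ideal K"
  using order_ideal_mult[of f K g 0] by simp

lemma order_ideal_power: "f \<in> order_ideal 1 \<Longrightarrow> f ^ n \<in> order_ideal n"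
proof (induction n)
  case (Suc n)
  thus ?case using order_ideal_mult[of f 1 "f ^ n" n] by simp
qed auto

lemma order_ideal_1_iff: "f \<in> order_ideal 1 \<longleftrightarrow> f $ 0 $ 0 = 0"
  by (simp add: order_ideal_def)

lemma order_ideal_Inter: "(\<And>K. f \<in> order_ideal K) \<Longrightarrow> f = 0"
proof (intro fps_ext)
  fix i j assume "\<And>K. f \<in> order_ideal K"
  from order_idealD[OF this[of "Suc (i + j)"], of i j] show "f $ j $ i = 0 $ j $ i" by simp
qed

definition mono2 :: "complex \<Rightarrow> nat \<Rightarrow> nat \<Rightarrow> complex fps fps" where
  "mono2 c p q = fps_const (fps_const c) * (var_x ^ p * var_y ^ q)"

lemma mono2_nth: "mono2 c p q $ j $ i = (if i = p \<and> j = q then c else 0)"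
proof -
  have "mono2 c p q = fps_const (fps_const c * fps_X ^ p) * fps_X ^ q"
    by (simp add: mono2_def var_x_def var_y_def fps_const_power mult.assoc)
  thus ?thesis by (auto simp: fps_X_power_mult_right_nth fps_X_power_iff)
qed

definition truncate2 :: "nat \<Rightarrow> complex fps fps \<Rightarrow> complex fps fps" where
  "truncate2 K f = (\<Sum>q<K. \<Sum>p<K. mono2 (f $ q $ p) p q)"

lemma truncate2_diff: "f - truncate2 K f \<in> order_ideal K"
proof (rule order_idealI)
  fix i j :: nat assume "i + j < K"
  hence *: "i < K" "j < K" by auto
  have "truncate2 K f $ j $ i = (\<Sum>q<K. \<Sum>p<K. if i = p \<and> j = q then f $ q $ p else 0)"
    by (simp add: truncate2_def fps_sum_nth mono2_nth)
  also have "\<dots> = (\<Sum>q<K. if j = q then (\<Sum>p<K. if i = p then f $ q $ p else 0) else 0)"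
    by (intro sum.cong refl) auto
  also have "\<dots> = f $ j $ i"
    using * by simp
  finally show "(f - truncate2 K f) $ j $ i = 0" by simp
qed

text \<open>
  The continuity hypothesis allows a loss of one order, so that derivations are covered.
\<close>

lemma eq_if_agree_on_monomials:
  assumes add1: "\<And>f g. D1 (f + g) = D1 f + D1 g" and add2: "\<And>f g. D2 (f + g) = D2 f + D2 g"
    and cont1: "\<And>f K. f \<in> order_ideal (Suc K) \<Longrightarrow> D1 f \<in> order_ideal K"
    and cont2: "\<And>f K. f \<in> order_ideal (Suc K) \<Longrightarrow> D2 f \<in> order_ideal K"
    and mono: "\<And>c p q. D1 (mono2 c p q) = D2 (mono2 c p q)"
  shows "D1 f = (D2 f :: complex fps fps)"
proof -
  have z: "D1 0 = 0" "D2 0 = 0" using add1[of 0 0] add2[of 0 0] by simp_all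
  have sum1: "D1 (sum h A) = (\<Sum>x\<in>A. D1 (h x))" for h :: "nat \<Rightarrow> _" and A
    by (induction A rule: infinite_finite_induct) (simp_all add: z add1)
  have sum2: "D2 (sum h A) = (\<Sum>x\<in>A. D2 (h x))" for h :: "nat \<Rightarrow> _" and A
    by (induction A rule: infinite_finite_induct) (simp_all add: z add2)
  have "D1 f - D2 f \<in> order_ideal K" for K
  proof -
    let ?t = "truncate2 (Suc K) f"
    have r: "f - ?t \<in> order_ideal (Suc K)" by (rule truncate2_diff)
    have "D1 ?t = D2 ?t" unfolding truncate2_def sum1 sum2 mono ..
    moreover have "D1 f = D1 ?t + D1 (f - ?t)" "D2 f = D2 ?t + D2 (f - ?t)"
      by (simp_all flip: add1 add2)
    ultimately have "D1 f - D2 f = D1 (f - ?t) - D2 (f - ?t)" by simp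
    thus ?thesis using cont1[OF r] cont2[OF r] by (simp add: order_ideal_diff)
  qed
  from order_ideal_Inter[OF this] show ?thesis by simp
qed

section \<open>Substitution as a continuous ring homomorphism\<close>

definition admissible :: "complex fps fps \<times> complex fps fps \<Rightarrow> bool" where
  "admissible \<pi> \<longleftrightarrow> fst \<pi> $ 0 $ 0 = 0 \<and> snd \<pi> $ 0 $ 0 = 0"

lemma admissible_power:
  assumes "admissible \<pi>"
  shows "fst \<pi> ^ p * snd \<pi> ^ q \<in> order_ideal (p + q)"
  using assms unfolding admissible_def order_ideal_1_iff[symmetric]
  by (intro order_ideal_mult order_ideal_power) auto

lemma subst2_nth: "subst2 f \<pi> $ j $ i =
    (\<Sum>p\<le>i + j. \<Sum>q\<le>i + j. f $ q $ p * (fst \<pi> ^ p * snd \<pi> ^ q) $ j $ i)"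
  by (simp add: subst2_def)

lemma subst2_add: "subst2 (f + g) \<pi> = subst2 f \<pi> + subst2 g \<pi>"
  by (intro fps_ext) (simp add: subst2_nth distrib_right sum.distrib)

lemma subst2_0 [simp]: "subst2 0 \<pi> = 0"
  by (intro fps_ext) (simp add: subst2_nth)

lemma subst2_cont:
  assumes "admissible \<pi>" "f \<in> order_ideal K"
  shows "subst2 f \<pi> \<in> order_ideal K"
proof (rule order_idealI)
  fix i j :: nat assume ij: "i + j < K"
  have "f $ q $ p * (fst \<pi> ^ p * snd \<pi> ^ q) $ j $ i = 0" for p q
  proof (cases "p + q < K")
    case True thus ?thesis using order_idealD[OF assms(2)] by simp
  next
    case False
    thus ?thesis using order_idealD[OF admissible_power[OF assms(1)], of i j p q] ij by simp
  qed
  thus "subst2 f \<pi> $ j $ i = 0" by (simp only: subst2_nth sum.neutral_const)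
qed

lemma subst2_mono:
  assumes "admissible \<pi>"
  shows "subst2 (mono2 c p q) \<pi> = fps_const (fps_const c) * (fst \<pi> ^ p * snd \<pi> ^ q)"
proof (intro fps_ext)
  fix i j
  let ?m = "\<lambda>p q. (fst \<pi> ^ p * snd \<pi> ^ q) $ j $ i"
  have "subst2 (mono2 c p q) \<pi> $ j $ i =
      (\<Sum>p'\<le>i+j. \<Sum>q'\<le>i+j. if p' = p \<and> q' = q then c * ?m p' q' else 0)"
    unfolding subst2_nth mono2_nth by (intro sum.cong refl) auto
  also have "\<dots> = (\<Sum>p'\<le>i+j. if p' = p then \<Sum>q'\<le>i+j. if q' = q then c * ?m p' q' else 0 else 0)"
    by (intro sum.cong refl) auto
  also have "\<dots> = (if p \<le> i + j \<and> q \<le> i + j then c * ?m p q else 0)"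
    by simp
  also have "\<dots> = c * ?m p q"
    using order_idealD[OF admissible_power[OF assms], of i j p q] by auto
  finally show "subst2 (mono2 c p q) \<pi> $ j $ i =
      (fps_const (fps_const c) * (fst \<pi> ^ p * snd \<pi> ^ q)) $ j $ i" by simp
qed

lemma mono2_mult: "mono2 c p q * mono2 d r s = mono2 (c * d) (p + r) (q + s)"
  by (simp add: mono2_def power_add mult_ac flip: fps_const_mult)

text \<open>Both sides are additive and continuous in each factor separately. The right factor is
  specialized to a monomial, where the reduction in the left factor leaves a product of two
  monomials; a second reduction then frees the right factor.\<close>

lemma subst2_mult:
  assumes "admissible \<pi>"
  shows "subst2 (f * g) \<pi> = subst2 f \<pi> * subst2 g \<pi>"
proof -
  have *: "subst2 (f * mono2 c p q) \<pi> = subst2 f \<pi> * subst2 (mono2 c p q) \<pi>" for c p q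
  proof (rule eq_if_agree_on_monomials[of "\<lambda>f. subst2 (f * mono2 c p q) \<pi>"
                                         "\<lambda>f. subst2 f \<pi> * subst2 (mono2 c p q) \<pi>"])
    show "subst2 (mono2 c' p' q' * mono2 c p q) \<pi> = subst2 (mono2 c' p' q') \<pi> * subst2 (mono2 c p q) \<pi>"
      for c' p' q'
      by (simp add: mono2_mult subst2_mono assms power_add mult_ac flip: fps_const_mult)
  qed (auto simp: distrib_right subst2_add intro!: subst2_cont order_ideal_mult_right assms
            elim: order_ideal_mono)
  show ?thesis
  proof (rule eq_if_agree_on_monomials[of "\<lambda>g. subst2 (f * g) \<pi>" "\<lambda>g. subst2 f \<pi> * subst2 g \<pi>"])
  qed (auto simp: * distrib_left subst2_add intro!: subst2_cont order_ideal_mult_left assms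
            elim: order_ideal_mono)
qed

lemma subst2_const:
  assumes "admissible \<pi>"
  shows "subst2 (fps_const (fps_const c)) \<pi> = fps_const (fps_const c)"
  using subst2_mono[OF assms, of c 0 0] by (simp add: mono2_def)

lemma subst2_1: "admissible \<pi> \<Longrightarrow> subst2 1 \<pi> = 1"
  using subst2_const[of \<pi> 1] by simp

lemma subst2_power: "admissible \<pi> \<Longrightarrow> subst2 (f ^ n) \<pi> = subst2 f \<pi> ^ n"
  by (induction n) (simp_all add: subst2_1 subst2_mult)

lemma subst2_var_x: "admissible \<pi> \<Longrightarrow> subst2 var_x \<pi> = fst \<pi>"
  using subst2_mono[of \<pi> 1 1 0] by (simp add: mono2_def)

lemma subst2_var_y: "admissible \<pi> \<Longrightarrow> subst2 var_y \<pi> = snd \<pi>"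
  using subst2_mono[of \<pi> 1 0 1] by (simp add: mono2_def)

definition compose2 :: "complex fps fps \<times> complex fps fps \<Rightarrow> complex fps fps \<times> complex fps fps \<Rightarrow>
    complex fps fps \<times> complex fps fps" where
  "compose2 \<pi> \<psi> = (subst2 (fst \<pi>) \<psi>, subst2 (snd \<pi>) \<psi>)"

lemma admissible_compose2: "admissible \<pi> \<Longrightarrow> admissible \<psi> \<Longrightarrow> admissible (compose2 \<pi> \<psi>)"
  using subst2_cont[of \<psi> _ 1] unfolding admissible_def compose2_def order_ideal_1_iff[symmetric]
  by auto

lemma subst2_subst2:
  assumes "admissible \<pi>" "admissible \<psi>"
  shows "subst2 (subst2 f \<pi>) \<psi> = subst2 f (compose2 \<pi> \<psi>)"
proof (rule eq_if_agree_on_monomials[of "\<lambda>f. subst2 (subst2 f \<pi>) \<psi>" "\<lambda>f. subst2 f (compose2 \<pi> \<psi>)"])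
  note c = admissible_compose2[OF assms]
  show "subst2 (subst2 (mono2 c p q) \<pi>) \<psi> = subst2 (mono2 c p q) (compose2 \<pi> \<psi>)" for c p q
    by (simp add: subst2_mono assms c subst2_mult subst2_const subst2_power)
       (simp add: compose2_def)
qed (auto simp: subst2_add intro!: subst2_cont admissible_compose2 assms elim: order_ideal_mono)

section \<open>Partial derivatives, the chain rule and pull-backs of forms\<close>

lemma dx2_nth: "dx2 f $ j $ i = of_nat (Suc i) * f $ j $ Suc i"
  by (simp add: dx2_def)

lemma dy2_nth: "dy2 f $ j $ i = of_nat (Suc j) * f $ Suc j $ i"
  by (simp add: dy2_def fps_of_nat[symmetric] del: of_nat_Suc)

lemma dx2_add: "dx2 (f + g) = dx2 f + dx2 g"
  by (intro fps_ext) (simp add: dx2_nth distrib_left)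

lemma dy2_add: "dy2 (f + g) = dy2 f + dy2 g"
  by (simp add: dy2_def)

lemma dx2_mult: "dx2 (f * g) = dx2 f * g + f * dx2 g"
  by (rule fps_ext)
     (simp add: dx2_def fps_mult_nth fps_deriv_sum sum.distrib add.commute)

lemma dy2_mult: "dy2 (f * g) = dy2 f * g + f * dy2 g"
  by (simp add: dy2_def add.commute)

lemma dx2_const [simp]: "dx2 (fps_const (fps_const c)) = 0"
  by (intro fps_ext) (simp add: dx2_def)

lemma dy2_const [simp]: "dy2 (fps_const c) = 0"
  by (simp add: dy2_def)

lemma dx2_cont: "f \<in> order_ideal (Suc K) \<Longrightarrow> dx2 f \<in> order_ideal K"
  by (rule order_idealI) (simp add: dx2_nth order_idealD)

lemma dy2_cont: "f \<in> order_ideal (Suc K) \<Longrightarrow> dy2 f \<in> order_ideal K"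
  by (rule order_idealI) (simp add: dy2_nth order_idealD)

text \<open>The chain rule is needed for both partial derivatives; their common properties are
  collected so that it is proved once. Only complex constants are to be killed, since a series in
  \<open>x\<close> alone is not constant for \<open>dx2\<close>.\<close>

locale derivation =
  fixes D :: "complex fps fps \<Rightarrow> complex fps fps"
  assumes add: "D (f + g) = D f + D g"
    and mult: "D (f * g) = D f * g + f * D g"
    and const: "D (fps_const (fps_const c)) = 0"
    and cont: "f \<in> order_ideal (Suc K) \<Longrightarrow> D f \<in> order_ideal K"
begin

lemma power: "D (f ^ n) = of_nat n * f ^ (n - 1) * D f"
proof (induction n)
  case 0
  show ?case using const[of 1] by simp
next
  case (Suc n)
  thus ?case by (cases n) (simp_all add: mult algebra_simps)
qed

lemma chain_rule:
  assumes "admissible \<pi>"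
  shows "D (subst2 f \<pi>) = subst2 (dx2 f) \<pi> * D (fst \<pi>) + subst2 (dy2 f) \<pi> * D (snd \<pi>)"
proof (rule eq_if_agree_on_monomials[of "\<lambda>f. D (subst2 f \<pi>)"
      "\<lambda>f. subst2 (dx2 f) \<pi> * D (fst \<pi>) + subst2 (dy2 f) \<pi> * D (snd \<pi>)"])
  interpret x: derivation dx2
    by unfold_locales (simp_all add: dx2_add dx2_mult dx2_cont)
  interpret y: derivation dy2
    by unfold_locales (simp_all add: dy2_add dy2_mult dy2_cont)
  have [simp]: "dx2 var_x = 1" "dy2 var_x = 0" "dx2 var_y = 0" "dy2 var_y = 1"
    by (intro fps_ext; simp add: var_x_def var_y_def dx2_def dy2_def)+
  have n: "subst2 (of_nat n) \<pi> = of_nat n" for n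
    using subst2_const[OF assms, of "of_nat n"] by (simp flip: fps_of_nat)
  show "D (subst2 (mono2 c p q) \<pi>) = subst2 (dx2 (mono2 c p q)) \<pi> * D (fst \<pi>) +
      subst2 (dy2 (mono2 c p q)) \<pi> * D (snd \<pi>)" for c p q
    unfolding mono2_def
    by (simp add: subst2_mult[OF assms] subst2_const[OF assms] subst2_power[OF assms] n
      subst2_var_x[OF assms] subst2_var_y[OF assms] mult const x.mult y.mult x.power y.power power)
      (simp add: algebra_simps)
  show "subst2 (dx2 f) \<pi> * D (fst \<pi>) + subst2 (dy2 f) \<pi> * D (snd \<pi>) \<in> order_ideal K"
    if "f \<in> order_ideal (Suc K)" for f K
    using that by (intro order_ideal_add order_ideal_mult_right subst2_cont assms dx2_cont dy2_cont)
qed (auto simp: subst2_add add dx2_add dy2_add algebra_simps intro!: subst2_cont cont assms)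

end

interpretation dx2: derivation dx2
  by unfold_locales (simp_all add: dx2_add dx2_mult dx2_cont)

interpretation dy2: derivation dy2
  by unfold_locales (simp_all add: dy2_add dy2_mult dy2_cont)

text \<open>Contravariance of the pull-back, from the chain rule for each partial derivative. It
  collapses the successive charts and the final lift into one pull-back along the family.\<close>

lemma pullback_pullback:
  assumes "admissible \<pi>" "admissible \<psi>"
  shows "pullback_form \<psi> (pullback_form \<pi> \<omega>) = pullback_form (compose2 \<pi> \<psi>) \<omega>"
proof -
  note s = subst2_add subst2_mult[OF assms(2)] subst2_subst2[OF assms]
  have f: "fst (compose2 \<pi> \<psi>) = subst2 (fst \<pi>) \<psi>" "snd (compose2 \<pi> \<psi>) = subst2 (snd \<pi>) \<psi>"
    by (simp_all add: compose2_def)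
  show ?thesis unfolding pullback_form_def f fst_conv snd_conv
    by (simp add: s dx2.chain_rule[OF assms(2)] dy2.chain_rule[OF assms(2)]) (simp add: algebra_simps)
qed

text \<open>Setting the outer variable to zero kills every term that contains the first component,
  so what remains is the restriction of \<open>g\<close> to \<open>x = 0\<close>, composed with the
  restriction of the second component.\<close>

lemma subst2_nth_0:
  assumes "admissible \<pi>" "fst \<pi> $ 0 = 0"
  shows "subst2 g \<pi> $ 0 = Abs_fps (\<lambda>j. g $ j $ 0) oo (snd \<pi> $ 0)"
proof (rule fps_ext)
  fix i
  have *: "(fst \<pi> ^ p * snd \<pi> ^ q) $ 0 = (if p = 0 then (snd \<pi> $ 0) ^ q else 0)" for p q
    using assms by (simp add: fps_power_zeroth)
  have "subst2 g \<pi> $ 0 $ i = (\<Sum>p\<le>i. if p = 0 then \<Sum>q\<le>i. g $ q $ p * ((snd \<pi> $ 0) ^ q) $ i else 0)"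
    unfolding subst2_nth * by (intro sum.cong) auto
  also have "\<dots> = (\<Sum>q\<le>i. g $ q $ 0 * ((snd \<pi> $ 0) ^ q) $ i)" by simp
  finally show "subst2 g \<pi> $ 0 $ i = (Abs_fps (\<lambda>j. g $ j $ 0) oo (snd \<pi> $ 0)) $ i"
    by (simp add: fps_compose_nth atLeast0AtMost)
qed

section \<open>Separatrices as solutions of a differential equation\<close>

text \<open>Partial sums of the weighted l1-norm are finite for every formal series, so they can be
  estimated for a formal solution; a bound uniform in \<open>K\<close> for some positive radius is
  convergence.\<close>

definition trunc_norm :: "nat \<Rightarrow> real \<Rightarrow> complex fps \<Rightarrow> real" where
  "trunc_norm K \<rho> f = (\<Sum>k<K. norm (f $ k) * \<rho> ^ k)"

lemma trunc_norm_nonneg: "0 \<le> \<rho> \<Longrightarrow> 0 \<le> trunc_norm K \<rho> f"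
  by (auto simp: trunc_norm_def intro!: sum_nonneg)

lemma trunc_norm_0 [simp]: "trunc_norm 0 \<rho> f = 0" "trunc_norm K \<rho> 0 = 0"
  by (simp_all add: trunc_norm_def)

lemma trunc_norm_uminus [simp]: "trunc_norm K \<rho> (- f) = trunc_norm K \<rho> f"
  by (simp add: trunc_norm_def)

lemma trunc_norm_add: "0 \<le> \<rho> \<Longrightarrow> trunc_norm K \<rho> (f + g) \<le> trunc_norm K \<rho> f + trunc_norm K \<rho> g"
  unfolding trunc_norm_def sum.distrib[symmetric]
  by (intro sum_mono) (simp add: mult_right_mono norm_triangle_ineq flip: distrib_right)

lemma trunc_norm_mono: "0 \<le> \<rho> \<Longrightarrow> K \<le> L \<Longrightarrow> trunc_norm K \<rho> f \<le> trunc_norm L \<rho> f"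
  unfolding trunc_norm_def by (intro sum_mono2) auto

lemma trunc_norm_mono_radius:
  "0 \<le> \<rho> \<Longrightarrow> \<rho> \<le> \<rho>' \<Longrightarrow> trunc_norm K \<rho> f \<le> trunc_norm K \<rho>' f"
  unfolding trunc_norm_def by (intro sum_mono mult_left_mono power_mono) auto

lemma trunc_norm_const: "0 \<le> \<rho> \<Longrightarrow> trunc_norm K \<rho> (fps_const c) \<le> norm c"
proof (cases K)
  case (Suc L)
  have "trunc_norm K \<rho> (fps_const c) = (\<Sum>k<K. if k = 0 then norm c else 0)"
    unfolding trunc_norm_def by (intro sum.cong) auto
  thus ?thesis by (simp add: Suc)
qed simp

lemma trunc_norm_mult:
  assumes "0 \<le> \<rho>"
  shows "trunc_norm K \<rho> (f * g) \<le> trunc_norm K \<rho> f * trunc_norm K \<rho> g"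
proof -
  have "trunc_norm K \<rho> (f * g) \<le>
      (\<Sum>k<K. \<Sum>i\<le>k. (norm (f $ i) * \<rho> ^ i) * (norm (g $ (k - i)) * \<rho> ^ (k - i)))"
    unfolding trunc_norm_def
  proof (intro sum_mono)
    fix k
    have "norm ((f * g) $ k) * \<rho> ^ k \<le> (\<Sum>i\<le>k. norm (f $ i) * norm (g $ (k - i))) * \<rho> ^ k"
      using assms by (intro mult_right_mono)
        (auto simp: fps_mult_nth atLeast0AtMost norm_mult[symmetric] intro!: sum_norm_le)
    also have "\<dots> = (\<Sum>i\<le>k. (norm (f $ i) * \<rho> ^ i) * (norm (g $ (k - i)) * \<rho> ^ (k - i)))"
      unfolding sum_distrib_right
    proof (intro sum.cong refl)
      fix i assume "i \<in> {..k}"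
      hence "\<rho> ^ k = \<rho> ^ i * \<rho> ^ (k - i)" by (simp flip: power_add)
      thus "norm (f $ i) * norm (g $ (k - i)) * \<rho> ^ k =
          norm (f $ i) * \<rho> ^ i * (norm (g $ (k - i)) * \<rho> ^ (k - i))" by simp
    qed
    finally show "norm ((f * g) $ k) * \<rho> ^ k \<le> \<dots>" .
  qed
  also have "\<dots> = (\<Sum>(i,j)\<in>{(i,j). i + j < K}.
      (norm (f $ i) * \<rho> ^ i) * (norm (g $ j) * \<rho> ^ j))"
    by (rule sum.triangle_reindex[symmetric])
  also have "\<dots> \<le> (\<Sum>(i,j)\<in>{..<K}\<times>{..<K}. (norm (f $ i) * \<rho> ^ i) * (norm (g $ j) * \<rho> ^ j))"
    using assms by (intro sum_mono2) auto
  also have "\<dots> = trunc_norm K \<rho> f * trunc_norm K \<rho> g"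
    by (simp add: trunc_norm_def sum_product sum.cartesian_product)
  finally show ?thesis .
qed

lemma trunc_norm_X_mult: "trunc_norm (Suc K) \<rho> (fps_X * f) = \<rho> * trunc_norm K \<rho> f"
  by (simp add: trunc_norm_def sum.lessThan_Suc_shift sum_distrib_left mult_ac del: sum.lessThan_Suc)

lemma fps_X_dvd_decompose: "f $ 0 = 0 \<Longrightarrow> f = fps_X * fps_shift 1 f" for f :: "complex fps"
  by (intro fps_ext) simp

text \<open>Since \<open>f\<close> starts in order one, the coefficients of the product below order
  \<open>K + 1\<close> involve only those of \<open>g\<close> below order \<open>K\<close>. This
  drop of the index is what makes an induction on \<open>K\<close> possible.\<close>

lemma trunc_norm_mult_vanishing:
  assumes "0 \<le> \<rho>" "f $ 0 = 0"
  shows "trunc_norm (Suc K) \<rho> (f * g) \<le> trunc_norm (Suc K) \<rho> f * trunc_norm K \<rho> g"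
proof -
  note f = fps_X_dvd_decompose[OF assms(2)]
  have "trunc_norm (Suc K) \<rho> (f * g) = \<rho> * trunc_norm K \<rho> (fps_shift 1 f * g)"
    by (subst f) (simp only: mult.assoc trunc_norm_X_mult)
  also have "\<dots> \<le> \<rho> * (trunc_norm K \<rho> (fps_shift 1 f) * trunc_norm K \<rho> g)"
    using assms by (intro mult_left_mono trunc_norm_mult)
  also have "\<dots> = trunc_norm (Suc K) \<rho> f * trunc_norm K \<rho> g"
    by (subst (2) f) (simp only: mult.assoc trunc_norm_X_mult)
  finally show ?thesis .
qed

text \<open>Integration divides the coefficients by positive integers and raises the order by one,
  which gives the factor \<open>\<rho>\<close>: a small radius makes the variation of
  \<open>U\<close> small.\<close>

lemma trunc_norm_antideriv:
  assumes "0 \<le> \<rho>"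
  shows "trunc_norm (Suc K) \<rho> (f - fps_const (f $ 0)) \<le> \<rho> * trunc_norm K \<rho> (fps_deriv f)"
proof -
  have "trunc_norm (Suc K) \<rho> (f - fps_const (f $ 0)) = (\<Sum>k<K. norm (f $ Suc k) * \<rho> ^ Suc k)"
    by (simp add: trunc_norm_def sum.lessThan_Suc_shift del: sum.lessThan_Suc)
  also have "\<dots> \<le> (\<Sum>k<K. \<rho> * (norm (fps_deriv f $ k) * \<rho> ^ k))"
  proof (intro sum_mono)
    fix k
    have "norm (f $ Suc k) \<le> norm (fps_deriv f $ k)"
      by (simp add: norm_mult del: of_nat_Suc) (simp add: mult_le_cancel_right1)
    thus "norm (f $ Suc k) * \<rho> ^ Suc k \<le> \<rho> * (norm (fps_deriv f $ k) * \<rho> ^ k)"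
      using mult_left_mono[of "norm (f $ Suc k)" "norm (fps_deriv f $ k)" "\<rho> ^ Suc k"] assms
      by (simp add: mult_ac del: fps_deriv_nth)
  qed
  finally show ?thesis by (simp add: trunc_norm_def sum_distrib_left)
qed

lemma convergent_series_iff:
  "f \<in> convergent_series \<longleftrightarrow> (\<exists>\<rho>>0. \<exists>C. \<forall>K. trunc_norm K \<rho> f \<le> C)"
proof
  assume "f \<in> convergent_series"
  then obtain r where r: "0 < r" "ereal r < fps_conv_radius f"
    unfolding convergent_series_def using ereal_dense2[of 0 "fps_conv_radius f"] by auto
  hence "summable (\<lambda>k. norm (f $ k * of_real r ^ k))"
    by (intro abs_summable_in_conv_radius) (simp add: fps_conv_radius_def)
  hence s: "summable (\<lambda>k. norm (f $ k) * r ^ k)" using r by (simp add: norm_mult norm_power)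
  have "trunc_norm K r f \<le> (\<Sum>k. norm (f $ k) * r ^ k)" for K
    unfolding trunc_norm_def using r s by (intro sum_le_suminf) auto
  thus "\<exists>\<rho>>0. \<exists>C. \<forall>K. trunc_norm K \<rho> f \<le> C" using r by blast
next
  assume "\<exists>\<rho>>0. \<exists>C. \<forall>K. trunc_norm K \<rho> f \<le> C"
  then obtain \<rho> C where rC: "\<rho> > 0" "\<And>K. trunc_norm K \<rho> f \<le> C" by blast
  have "summable (\<lambda>k. norm (f $ k) * \<rho> ^ k)"
    by (rule summableI_nonneg_bounded[of _ C]) (use rC in \<open>auto simp: trunc_norm_def\<close>)
  hence "summable (\<lambda>k. norm (f $ k * of_real \<rho> ^ k))"
    using rC by (simp add: norm_mult norm_power)
  hence "summable (\<lambda>k. f $ k * of_real \<rho> ^ k)" by (rule summable_norm_cancel)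
  from conv_radius_geI[OF this] have "ereal \<rho> \<le> fps_conv_radius f"
    using rC by (simp add: fps_conv_radius_def)
  thus "f \<in> convergent_series" using rC unfolding convergent_series_def
    by (metis (no_types, lifting) ereal_less(2) less_le_trans mem_Collect_eq)
qed

lemma convergent_poly_pCons:
  "pCons a A \<in> convergent_polys \<longleftrightarrow> a \<in> convergent_series \<and> A \<in> convergent_polys"
  unfolding convergent_polys_def by (auto simp: coeff_pCons split: nat.splits)

text \<open>Induction along the Horner scheme. The bound and the radius depend on \<open>A\<close>
  and \<open>R\<close> only, not on \<open>K\<close> or \<open>U\<close>; the induction on
  \<open>K\<close> in the convergence proof relies on this uniformity.\<close>

lemma poly_bounded:
  assumes "A \<in> convergent_polys" "0 \<le> R"
  shows "\<exists>\<rho>0>0. \<exists>C\<ge>0. \<forall>\<rho> K U. 0 \<le> \<rho> \<longrightarrow> \<rho> \<le> \<rho>0 \<longrightarrow> trunc_norm K \<rho> U \<le> R \<longrightarrow>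
           trunc_norm K \<rho> (poly A U) \<le> C"
  using assms(1)
proof (induction A)
  case 0
  show ?case by (intro exI[of _ 1] conjI exI[of _ 0]) auto
next
  case (pCons a A)
  hence "a \<in> convergent_series" "A \<in> convergent_polys" by (auto simp: convergent_poly_pCons)
  from pCons(2)[OF this(2)] obtain r1 C1 where 1: "r1 > 0" "C1 \<ge> 0"
    "\<And>\<rho> K U. 0 \<le> \<rho> \<Longrightarrow> \<rho> \<le> r1 \<Longrightarrow> trunc_norm K \<rho> U \<le> R \<Longrightarrow> trunc_norm K \<rho> (poly A U) \<le> C1"
    by blast
  obtain r2 C2 where 2: "r2 > 0" "\<And>K. trunc_norm K r2 a \<le> C2"
    using \<open>a \<in> convergent_series\<close> by (auto simp: convergent_series_iff)
  have "C2 \<ge> 0" using 2(2)[of 0] by simp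
  show ?case
  proof (rule exI[of _ "min r1 r2"], rule conjI[rotated], rule exI[of _ "C2 + R * C1"], intro conjI allI impI)
    fix \<rho> K U assume \<rho>: "0 \<le> \<rho>" "\<rho> \<le> min r1 r2" and U: "trunc_norm K \<rho> U \<le> R"
    have "trunc_norm K \<rho> (poly (pCons a A) U) \<le>
        trunc_norm K \<rho> a + trunc_norm K \<rho> U * trunc_norm K \<rho> (poly A U)"
      using trunc_norm_add[OF \<rho>(1), of K a "U * poly A U"] trunc_norm_mult[OF \<rho>(1), of K U "poly A U"]
      by simp
    also have "trunc_norm K \<rho> a \<le> C2"
      using trunc_norm_mono_radius[of \<rho> r2 K a] 2(2)[of K] \<rho> by simp
    also have "trunc_norm K \<rho> U * trunc_norm K \<rho> (poly A U) \<le> R * C1"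
      using \<rho> U 1 assms(2) by (intro mult_mono trunc_norm_nonneg) auto
    finally show "trunc_norm K \<rho> (poly (pCons a A) U) \<le> C2 + R * C1" by simp
  next
    show "min r1 r2 > 0" "C2 + R * C1 \<ge> 0" using 1 2 \<open>C2 \<ge> 0\<close> assms(2) by auto
  qed
qed

lemma trunc_norm_minus_const:
  assumes "0 \<le> \<rho>" "\<rho> \<le> r" "r > 0" "\<And>K. trunc_norm K r a \<le> C"
  shows "trunc_norm K \<rho> (a - fps_const (a $ 0)) \<le> \<rho> * (C / r)"
proof -
  have "norm ((a - fps_const (a $ 0)) $ k) * \<rho> ^ k \<le> \<rho> / r * (norm (a $ k) * r ^ k)" for k
  proof (cases k)
    case (Suc j)
    have "\<rho> ^ j \<le> r ^ j" using assms by (intro power_mono) auto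
    hence "norm (a $ k) * \<rho> ^ k \<le> norm (a $ k) * (\<rho> * r ^ j)"
      using assms unfolding Suc by (intro mult_left_mono) (auto simp: mult_left_mono)
    thus ?thesis using assms by (simp add: Suc mult.left_commute)
  qed (use assms in simp)
  hence "trunc_norm K \<rho> (a - fps_const (a $ 0)) \<le> (\<Sum>k<K. \<rho> / r * (norm (a $ k) * r ^ k))"
    unfolding trunc_norm_def by (intro sum_mono)
  also have "\<dots> = \<rho> / r * trunc_norm K r a" by (simp add: trunc_norm_def sum_distrib_left)
  also have "\<dots> \<le> \<rho> / r * C" using assms by (intro mult_left_mono) auto
  finally show ?thesis by simp
qed

text \<open>The nonconstant part of \<open>A(t,U)\<close> comes from the explicit dependence on
  \<open>t\<close>, which is of size \<open>O(\<rho>)\<close>, and from the variation of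
  \<open>U\<close>. In the Horner step, \<open>U g - U(0) g(0)\<close> is split into
  \<open>(U - U(0)) g + U(0) (g - g(0))\<close>.\<close>

lemma poly_oscillation:
  assumes "A \<in> convergent_polys" "0 \<le> R"
  shows "\<exists>\<rho>0>0. \<exists>C\<ge>0. \<forall>\<rho> K U. 0 \<le> \<rho> \<longrightarrow> \<rho> \<le> \<rho>0 \<longrightarrow> trunc_norm K \<rho> U \<le> R \<longrightarrow>
           trunc_norm K \<rho> (poly A U - fps_const (poly A U $ 0)) \<le>
             C * (\<rho> + trunc_norm K \<rho> (U - fps_const (U $ 0)))"
  using assms(1)
proof (induction A)
  case 0
  show ?case by (intro exI[of _ 1] conjI exI[of _ 0]) auto
next
  case (pCons a A)
  hence a: "a \<in> convergent_series" and A: "A \<in> convergent_polys"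
    by (auto simp: convergent_poly_pCons)
  from pCons(2)[OF A] obtain r1 C1 where 1: "r1 > 0" "C1 \<ge> 0"
    "\<And>\<rho> K U. 0 \<le> \<rho> \<Longrightarrow> \<rho> \<le> r1 \<Longrightarrow> trunc_norm K \<rho> U \<le> R \<Longrightarrow>
        trunc_norm K \<rho> (poly A U - fps_const (poly A U $ 0)) \<le>
             C1 * (\<rho> + trunc_norm K \<rho> (U - fps_const (U $ 0)))"
    by blast
  obtain r2 C2 where 2: "r2 > 0" "\<And>K. trunc_norm K r2 a \<le> C2"
    using a by (auto simp: convergent_series_iff)
  from poly_bounded[OF A assms(2)] obtain r3 C3 where 3: "r3 > 0" "C3 \<ge> 0"
    "\<And>\<rho> K U. 0 \<le> \<rho> \<Longrightarrow> \<rho> \<le> r3 \<Longrightarrow> trunc_norm K \<rho> U \<le> R \<Longrightarrow> trunc_norm K \<rho> (poly A U) \<le> C3"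
    by blast
  have "C2 \<ge> 0" using 2(2)[of 0] by simp
  let ?C = "C2 / r2 + C3 + R * C1"
  show ?case
  proof (rule exI[of _ "min r1 (min r2 r3)"], rule conjI[rotated], rule exI[of _ ?C], intro conjI allI impI)
    fix \<rho> K U assume \<rho>: "0 \<le> \<rho>" "\<rho> \<le> min r1 (min r2 r3)" and U: "trunc_norm K \<rho> U \<le> R"
    let ?N = "trunc_norm K \<rho>" and ?W = "U - fps_const (U $ 0)" and ?g = "poly A U"
    let ?G = "?g - fps_const (?g $ 0)"
    have U0: "?N (fps_const (U $ 0)) \<le> R"
    proof (cases K)
      case (Suc L)
      have "?N (fps_const (U $ 0)) \<le> norm (U $ 0)" by (rule trunc_norm_const[OF \<rho>(1)])
      also have "\<dots> \<le> ?N U" using \<rho>(1) unfolding Suc trunc_norm_def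
        by (simp add: sum.lessThan_Suc_shift sum_nonneg del: sum.lessThan_Suc)
      finally show ?thesis using U by simp
    qed (use assms(2) in simp)
    have "poly (pCons a A) U - fps_const (poly (pCons a A) U $ 0) =
        (a - fps_const (a $ 0)) + (?W * ?g + fps_const (U $ 0) * ?G)"
      by (simp add: algebra_simps flip: fps_const_mult fps_const_add)
    hence "?N (poly (pCons a A) U - fps_const (poly (pCons a A) U $ 0)) \<le>
        ?N (a - fps_const (a $ 0)) + (?N (?W * ?g) + ?N (fps_const (U $ 0) * ?G))"
      using trunc_norm_add[OF \<rho>(1)] by (smt (verit))
    also have "?N (a - fps_const (a $ 0)) \<le> \<rho> * (C2 / r2)"
      by (rule trunc_norm_minus_const) (use \<rho> 2 in auto)
    also have "?N (?W * ?g) \<le> ?N ?W * C3"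
      using trunc_norm_mult[OF \<rho>(1), of K ?W ?g] 3(3)[OF \<rho>(1) _ U] \<rho>
      by (smt (verit) mult_left_mono trunc_norm_nonneg)
    also have "?N (fps_const (U $ 0) * ?G) \<le> R * (C1 * (\<rho> + ?N ?W))"
    proof -
      have "?N (fps_const (U $ 0) * ?G) \<le> ?N (fps_const (U $ 0)) * ?N ?G"
        by (rule trunc_norm_mult[OF \<rho>(1)])
      also have "\<dots> \<le> R * (C1 * (\<rho> + ?N ?W))"
        using 1(3)[OF \<rho>(1) _ U] \<rho> U0 assms(2) by (intro mult_mono trunc_norm_nonneg) auto
      finally show ?thesis .
    qed
    also have "\<rho> * (C2 / r2) + (?N ?W * C3 + R * (C1 * (\<rho> + ?N ?W))) \<le> ?C * (\<rho> + ?N ?W)"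
    proof -
      have "0 \<le> ?N ?W" by (rule trunc_norm_nonneg[OF \<rho>(1)])
      hence "0 \<le> ?N ?W * (C2 / r2)" "0 \<le> \<rho> * C3" using \<open>C2 \<ge> 0\<close> 2 3 \<rho> by auto
      thus ?thesis by (simp add: algebra_simps)
    qed
    finally show "?N (poly (pCons a A) U - fps_const (poly (pCons a A) U $ 0)) \<le> ?C * (\<rho> + ?N ?W)"
      by simp
  next
    show "min r1 (min r2 r3) > 0" "?C \<ge> 0" using 1 2 3 \<open>C2 \<ge> 0\<close> assms(2) by auto
  qed
qed

text \<open>
  Comparing coefficients of order \<open>K\<close> in the equation bounds the truncated norm of \<open>U'\<close> up to \<open>K\<close>
  by the one before \<open>K\<close>; for a small radius both stay below the same constant \<open>\<delta>\<close>.
\<close>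

lemma ode_solution_convergent:
  assumes A: "A \<in> convergent_polys" and B: "B \<in> convergent_polys"
    and nz: "poly B U $ 0 \<noteq> 0"
    and ode: "poly A U + poly B U * fps_deriv U = 0"
  shows "U \<in> convergent_series"
proof -
  define \<beta> where "\<beta> = poly B U $ 0"
  define R where "R = norm (U $ 0) + 1"
  have R: "R \<ge> 0" by (simp add: R_def)
  from poly_bounded[OF A R] obtain r1 C1 where 1: "r1 > 0" "C1 \<ge> 0"
    "\<And>\<rho> K U. 0 \<le> \<rho> \<Longrightarrow> \<rho> \<le> r1 \<Longrightarrow> trunc_norm K \<rho> U \<le> R \<Longrightarrow> trunc_norm K \<rho> (poly A U) \<le> C1"
    by blast
  from poly_oscillation[OF B R] obtain r2 C2 where 2: "r2 > 0" "C2 \<ge> 0"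
    "\<And>\<rho> K U. 0 \<le> \<rho> \<Longrightarrow> \<rho> \<le> r2 \<Longrightarrow> trunc_norm K \<rho> U \<le> R \<Longrightarrow>
        trunc_norm K \<rho> (poly B U - fps_const (poly B U $ 0)) \<le>
             C2 * (\<rho> + trunc_norm K \<rho> (U - fps_const (U $ 0)))"
    by blast
  have b: "norm \<beta> > 0" using nz by (simp add: \<beta>_def)
  \<comment> \<open>As \<open>norm \<beta> * \<delta> = C1 + norm \<beta>\<close>, the term
    \<open>A\<close> uses up \<open>C1\<close> and \<open>norm \<beta>\<close> is left for the
    perturbation of \<open>B\<close>. The radius keeps \<open>U\<close> within \<open>R\<close>, by
    \<open>\<rho> * \<delta> \<le> 1\<close>, and makes
    \<open>C2 * (\<rho> + \<rho> * \<delta>) * \<delta>\<close> at most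
    \<open>norm \<beta>\<close>.\<close>
  define \<delta> where "\<delta> = C1 / norm \<beta> + 1"
  have \<delta>: "\<delta> \<ge> 1" "norm \<beta> * \<delta> = C1 + norm \<beta>" using b 1 by (auto simp: \<delta>_def field_simps)
  define \<rho> where "\<rho> = min (min r1 r2) (min (1 / \<delta>) (norm \<beta> / (C2 * (1 + \<delta>) * \<delta> + 1)))"
  have den: "C2 * (1 + \<delta>) * \<delta> + 1 > 0" using 2 \<delta> by (simp add: add_nonneg_pos)
  have \<rho>: "\<rho> > 0" "\<rho> \<le> r1" "\<rho> \<le> r2" "\<rho> * \<delta> \<le> 1" "\<rho> * (C2 * (1 + \<delta>) * \<delta> + 1) \<le> norm \<beta>"
  proof -
    show "\<rho> > 0" using 1 2 \<delta> b den by (simp add: \<rho>_def)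
    show "\<rho> \<le> r1" "\<rho> \<le> r2" by (simp_all add: \<rho>_def)
    have "\<rho> \<le> 1 / \<delta>" by (simp add: \<rho>_def)
    thus "\<rho> * \<delta> \<le> 1" using \<delta> by (simp add: field_simps)
    have "\<rho> \<le> norm \<beta> / (C2 * (1 + \<delta>) * \<delta> + 1)" by (simp add: \<rho>_def)
    thus "\<rho> * (C2 * (1 + \<delta>) * \<delta> + 1) \<le> norm \<beta>" using den by (simp only: pos_le_divide_eq)
  qed
  hence \<rho>0: "0 \<le> \<rho>" by simp
  let ?V = "fps_deriv U" and ?W = "U - fps_const (U $ 0)"
  let ?Q = "poly B U - fps_const \<beta>"
  have UR: "trunc_norm (Suc K) \<rho> U \<le> R" and W: "trunc_norm (Suc K) \<rho> ?W \<le> \<rho> * \<delta>"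
    if "trunc_norm K \<rho> ?V \<le> \<delta>" for K
  proof -
    have "trunc_norm (Suc K) \<rho> ?W \<le> \<rho> * trunc_norm K \<rho> ?V" by (rule trunc_norm_antideriv[OF \<rho>0])
    also have "\<dots> \<le> \<rho> * \<delta>" using that \<rho>0 by (intro mult_left_mono)
    finally show *: "trunc_norm (Suc K) \<rho> ?W \<le> \<rho> * \<delta>" .
    have "trunc_norm (Suc K) \<rho> U \<le> trunc_norm (Suc K) \<rho> ?W + trunc_norm (Suc K) \<rho> (fps_const (U $ 0))"
      using trunc_norm_add[OF \<rho>0, of "Suc K" ?W "fps_const (U $ 0)"] by simp
    thus "trunc_norm (Suc K) \<rho> U \<le> R"
      using * \<rho> trunc_norm_const[OF \<rho>0, of "Suc K" "U $ 0"] unfolding R_def by simp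
  qed
  have V: "trunc_norm K \<rho> ?V \<le> \<delta>" for K
  proof (induction K)
    case (Suc K)
    have "fps_const \<beta> * ?V = - poly A U + - (?Q * ?V)"
      using ode by (simp add: algebra_simps eq_neg_iff_add_eq_0)
    hence "trunc_norm (Suc K) \<rho> (fps_const \<beta> * ?V) \<le>
        trunc_norm (Suc K) \<rho> (poly A U) + trunc_norm (Suc K) \<rho> (?Q * ?V)"
      using trunc_norm_add[OF \<rho>0, of "Suc K" "- poly A U" "- (?Q * ?V)"] by simp
    also have "trunc_norm (Suc K) \<rho> (poly A U) \<le> C1"
      by (intro 1 \<rho>0 \<rho> UR Suc)
    also have "trunc_norm (Suc K) \<rho> (?Q * ?V) \<le> trunc_norm (Suc K) \<rho> ?Q * trunc_norm K \<rho> ?V"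
      by (rule trunc_norm_mult_vanishing[OF \<rho>0]) (simp add: \<beta>_def)
    also have "\<dots> \<le> (C2 * (\<rho> + \<rho> * \<delta>)) * \<delta>"
    proof (intro mult_mono trunc_norm_nonneg \<rho>0 Suc)
      have "trunc_norm (Suc K) \<rho> ?Q \<le> C2 * (\<rho> + trunc_norm (Suc K) \<rho> ?W)"
        unfolding \<beta>_def by (intro 2 \<rho>0 \<rho> UR Suc)
      also have "\<dots> \<le> C2 * (\<rho> + \<rho> * \<delta>)" using W[OF Suc] 2 by (intro mult_left_mono) auto
      finally show "trunc_norm (Suc K) \<rho> ?Q \<le> C2 * (\<rho> + \<rho> * \<delta>)" .
    qed (use 2 \<rho>0 \<delta> in auto)
    also have "(C2 * (\<rho> + \<rho> * \<delta>)) * \<delta> \<le> norm \<beta>"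
      using \<rho>(5) \<rho>0 by (simp add: algebra_simps)
    also have "trunc_norm (Suc K) \<rho> (fps_const \<beta> * ?V) = norm \<beta> * trunc_norm (Suc K) \<rho> ?V"
      unfolding trunc_norm_def sum_distrib_left by (simp only: fps_mult_left_const_nth norm_mult mult.assoc)
    finally have "norm \<beta> * trunc_norm (Suc K) \<rho> ?V \<le> norm \<beta> * \<delta>"
      unfolding \<delta> by simp
    thus ?case using b by simp
  qed (use \<delta> in simp)
  have "trunc_norm K \<rho> U \<le> R" for K
    using UR[OF V, of K] trunc_norm_mono[OF \<rho>0, of K "Suc K" U] by simp
  thus ?thesis unfolding convergent_series_iff using \<rho> by blast
qed

section \<open>Rational dependence on the initial value\<close>

lemma rational_defined_on_const: "rational_defined_on D (\<lambda>_. c)"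
  unfolding rational_defined_on_def by (intro exI[of _ "[:c:]"] exI[of _ 1]) simp

lemma rational_defined_on_id: "rational_defined_on D (\<lambda>u. u)"
  unfolding rational_defined_on_def by (intro exI[of _ "[:0, 1:]"] exI[of _ 1]) simp

lemma rational_defined_on_add:
  assumes "rational_defined_on D f" "rational_defined_on D g"
  shows "rational_defined_on D (\<lambda>u. f u + g u)"
proof -
  obtain p q p' q' where *: "\<forall>u\<in>D. poly q u \<noteq> 0 \<and> f u = poly p u / poly q u"
      "\<forall>u\<in>D. poly q' u \<noteq> 0 \<and> g u = poly p' u / poly q' u"
    using assms unfolding rational_defined_on_def by blast
  show ?thesis unfolding rational_defined_on_def
    by (intro exI[of _ "p * q' + p' * q"] exI[of _ "q * q'"]) (use * in \<open>auto simp: add_frac_eq\<close>)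
qed

lemma rational_defined_on_mult:
  assumes "rational_defined_on D f" "rational_defined_on D g"
  shows "rational_defined_on D (\<lambda>u. f u * g u)"
proof -
  obtain p q p' q' where *: "\<forall>u\<in>D. poly q u \<noteq> 0 \<and> f u = poly p u / poly q u"
      "\<forall>u\<in>D. poly q' u \<noteq> 0 \<and> g u = poly p' u / poly q' u"
    using assms unfolding rational_defined_on_def by blast
  show ?thesis unfolding rational_defined_on_def
    by (intro exI[of _ "p * p'"] exI[of _ "q * q'"]) (use * in auto)
qed

lemma rational_defined_on_sum:
  "(\<And>x. x \<in> X \<Longrightarrow> rational_defined_on D (f x)) \<Longrightarrow> rational_defined_on D (\<lambda>u. \<Sum>x\<in>X. f x u)"
  by (induction X rule: infinite_finite_induct)
     (auto intro: rational_defined_on_const rational_defined_on_add)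

definition rational_series :: "(complex \<Rightarrow> complex fps) \<Rightarrow> bool" where
  "rational_series f \<longleftrightarrow> (\<forall>i. rational_defined_on (- {0}) (\<lambda>u. f u $ i))"

lemma rational_series_const: "rational_series (\<lambda>_. c)"
  by (simp add: rational_series_def rational_defined_on_const)

lemma rational_series_add:
  "rational_series f \<Longrightarrow> rational_series g \<Longrightarrow> rational_series (\<lambda>u. f u + g u)"
  by (simp add: rational_series_def rational_defined_on_add)

lemma rational_series_mult:
  "rational_series f \<Longrightarrow> rational_series g \<Longrightarrow> rational_series (\<lambda>u. f u * g u)"
  unfolding rational_series_def fps_mult_nth
  by (intro allI rational_defined_on_sum rational_defined_on_mult) auto

lemma rational_series_deriv: "rational_series f \<Longrightarrow> rational_series (\<lambda>u. fps_deriv (f u))"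
  unfolding rational_series_def fps_deriv_nth
  by (intro allI rational_defined_on_mult rational_defined_on_const) auto

lemma rational_series_poly:
  assumes "rational_series f"
  shows "rational_series (\<lambda>u. poly A (f u))"
  by (induction A) (simp_all add: rational_series_const rational_series_add rational_series_mult assms)

text \<open>Undetermined coefficients: stage \<open>j + 1\<close> removes the residual of order
  \<open>j\<close> by changing the coefficient of order \<open>j + 1\<close>; \<open>b u\<close>
  stands for the inverse of \<open>B(0,u)\<close>. Each stage uses only ring operations, derivatives
  and \<open>b\<close>, so rationality in \<open>u\<close> is inherited.\<close>

primrec ode_approx :: "complex fps poly \<Rightarrow> complex fps poly \<Rightarrow> (complex \<Rightarrow> complex) \<Rightarrow> nat \<Rightarrow>
    complex \<Rightarrow> complex fps" where
  "ode_approx A B b 0 u = fps_const u"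
| "ode_approx A B b (Suc j) u = ode_approx A B b j u -
     fps_const ((poly A (ode_approx A B b j u) +
        poly B (ode_approx A B b j u) * fps_deriv (ode_approx A B b j u)) $ j * (b u / of_nat (Suc j)))
       * fps_X ^ Suc j"

lemma ode_approx_stable:
  "k \<le> j \<Longrightarrow> ode_approx A B b (j + i) u $ k = ode_approx A B b j u $ k"
  by (induction i) (simp_all add: fps_X_power_mult_right_nth del: power_Suc of_nat_Suc)

lemma ode_approx_rational:
  assumes "rational_defined_on (- {0}) b"
  shows "rational_series (ode_approx A B b j)"
proof (induction j)
  case 0
  have "rational_defined_on (- {0}) (\<lambda>u. fps_const u $ i)" for i
    by (cases i) (simp_all add: rational_defined_on_const rational_defined_on_id)
  thus ?case by (simp add: rational_series_def)
next
  case (Suc j)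
  let ?T = "ode_approx A B b j"
  have r: "rational_series (\<lambda>u. poly A (?T u) + poly B (?T u) * fps_deriv (?T u))"
    by (intro rational_series_add rational_series_mult rational_series_poly rational_series_deriv Suc)
  have eq: "ode_approx A B b (Suc j) u $ i = ?T u $ i +
      (poly A (?T u) + poly B (?T u) * fps_deriv (?T u)) $ j * (b u * (- (fps_X ^ Suc j $ i) / of_nat (Suc j)))"
    for u i by (simp del: power_Suc of_nat_Suc)
  have "rational_defined_on (- {0}) (\<lambda>u. ode_approx A B b (Suc j) u $ i)" for i
    unfolding eq using Suc r unfolding rational_series_def
    by (intro rational_defined_on_add rational_defined_on_mult rational_defined_on_const assms) auto
  thus ?case by (simp add: rational_series_def)
qed

lemma fps_mult_nth_cong:
  assumes "\<And>k. k \<le> j \<Longrightarrow> f $ k = f' $ k" "\<And>k. k \<le> j \<Longrightarrow> g $ k = g' $ k" "k \<le> j"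
  shows "(f * g) $ k = (f' * g') $ (k :: nat)"
  unfolding fps_mult_nth using assms by (intro sum.cong) auto

lemma poly_nth_cong:
  assumes "\<And>k. k \<le> j \<Longrightarrow> U $ k = V $ k"
  shows "k \<le> j \<Longrightarrow> poly A U $ k = poly A V $ (k :: nat)"
proof (induction A arbitrary: k)
  case (pCons a A)
  have "(U * poly A U) $ k = (V * poly A V) $ k"
    by (rule fps_mult_nth_cong[where j = j]) (use assms pCons in auto)
  thus ?case by simp
qed simp

theorem ode_formal_solution:
  fixes A B :: "complex fps poly" and b :: "complex \<Rightarrow> complex"
  assumes b: "rational_defined_on (- {0}) b" "\<And>u. u \<noteq> 0 \<Longrightarrow> poly B (fps_const u) $ 0 * b u = 1"
  obtains r :: "nat \<Rightarrow> complex \<Rightarrow> complex" where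
    "\<And>j. rational_defined_on (- {0}) (r j)" "\<And>u. r 0 u = u"
    "\<And>u. u \<noteq> 0 \<Longrightarrow> poly A (Abs_fps (\<lambda>j. r j u)) +
        poly B (Abs_fps (\<lambda>j. r j u)) * fps_deriv (Abs_fps (\<lambda>j. r j u)) = 0"
proof
  let ?r = "\<lambda>j u. ode_approx A B b j u $ j"
  show "rational_defined_on (- {0}) (?r j)" for j
    using ode_approx_rational[OF b(1), of A B j] by (simp add: rational_series_def)
  show "?r 0 u = u" for u by simp
  fix u :: complex assume u: "u \<noteq> 0"
  define U where "U = Abs_fps (\<lambda>j. ?r j u)"
  have U: "U $ k = ode_approx A B b j u $ k" if "k \<le> j" for k j
    using ode_approx_stable[of k k A B b "j - k" u] that by (simp add: U_def)
  have B0: "poly B T $ 0 * b u = 1" if "T $ 0 = u" for T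
    using poly_nth_cong[of 0 T "fps_const u" 0 B] b(2)[OF u] that by simp
  show "poly A U + poly B U * fps_deriv U = 0"
  proof (rule fps_ext)
    fix j
    define T where "T = ode_approx A B b j u"
    define c where "c = (poly A T + poly B T * fps_deriv T) $ j"
    have T0: "T $ 0 = u" unfolding T_def using ode_approx_stable[of 0 0 A B b j u] by simp
    have UT: "U $ k = T $ k" if "k \<le> j" for k using U[OF that] by (simp add: T_def)
    have USuc: "U $ Suc j = T $ Suc j - c * (b u / of_nat (Suc j))"
      using U[of "Suc j" "Suc j"] by (simp add: c_def T_def del: power_Suc of_nat_Suc)
    let ?E = "fps_const (c * b u) * fps_X ^ j"
    have d: "fps_deriv U $ k = (fps_deriv T - ?E) $ k" if "k \<le> j" for k
    proof (cases "k = j")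
      case True
      have "of_nat (Suc j) * (b u / of_nat (Suc j)) = b u" by (simp del: of_nat_Suc)
      thus ?thesis unfolding True
        by (simp add: USuc right_diff_distrib fps_X_power_iff del: of_nat_Suc)
    next
      case False
      thus ?thesis using that UT[of "Suc k"] by (simp add: fps_X_power_iff)
    qed
    have "(poly B U * fps_deriv U) $ j = (poly B T * (fps_deriv T - ?E)) $ j"
      by (rule fps_mult_nth_cong[where j = j]) (use d poly_nth_cong[of j U T] UT in auto)
    also have "\<dots> = (poly B T * fps_deriv T) $ j - c * b u * poly B T $ 0"
      by (simp add: right_diff_distrib mult.assoc mult.left_commute[of "poly B T"] fps_X_power_mult_right_nth)
    also have "c * b u * poly B T $ 0 = c" using B0[OF T0] by (simp add: mult.assoc mult.commute)
    finally show "(poly A U + poly B U * fps_deriv U) $ j = 0 $ j"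
      using poly_nth_cong[of j U T j A] UT by (simp add: c_def)
  qed
qed

section \<open>Characteristic exponents\<close>

locale puiseux =
  fixes n :: nat and s :: "complex fps"
  assumes n_gt_1: "n > 1" and n_less: "n < subdegree s" and not_dvd: "\<not> n dvd subdegree s"
    and Gcd_1: "Gcd (insert n {k. s $ k \<noteq> 0}) = 1"
begin

abbreviation "ce \<equiv> char_gcd n s"
abbreviation "cb \<equiv> char_exp n s"
abbreviation "gen \<equiv> genus n s"
abbreviation "val \<equiv> semigroup_gen n s"

lemma s_nz: "s \<noteq> 0" using n_less by auto

lemma ce_0 [simp]: "ce 0 = n" and cb_0 [simp]: "cb 0 = n"
  by (simp_all add: char_gcd_def char_exp_def)

lemma cb_Suc: "cb (Suc j) = (LEAST k. \<not> ce j dvd k \<and> s $ k \<noteq> 0)"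
  and ce_Suc: "ce (Suc j) = gcd (ce j) (cb (Suc j))"
  by (simp_all add: char_gcd_def char_exp_def Let_def)

lemma ce_pos: "ce j > 0"
  by (induction j) (use n_gt_1 in \<open>auto simp: ce_Suc\<close>)

lemma ce_Suc_dvd: "ce (Suc j) dvd ce j" by (simp add: ce_Suc)

lemma ce_antimono: "i \<le> j \<Longrightarrow> ce j dvd ce i"
  by (induction j rule: dec_induct) (auto intro: dvd_trans ce_Suc_dvd)

lemma ce_dvd_n: "ce j dvd n" using ce_antimono[of 0 j] by simp

lemma ce_dvd_cb: "ce j dvd cb j"
  by (cases j) (simp_all add: ce_Suc)

lemma cb_Suc_props:
  assumes "ce j \<noteq> 1"
  shows "\<not> ce j dvd cb (Suc j)" "s $ cb (Suc j) \<noteq> 0"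
    "\<And>k. k < cb (Suc j) \<Longrightarrow> s $ k \<noteq> 0 \<Longrightarrow> ce j dvd k"
proof -
  have "\<exists>k. \<not> ce j dvd k \<and> s $ k \<noteq> 0"
  proof (rule ccontr)
    assume "\<not> ?thesis"
    hence "ce j dvd Gcd (insert n {k. s $ k \<noteq> 0})"
      using ce_dvd_n by (intro Gcd_greatest) auto
    thus False using assms unfolding Gcd_1 by simp
  qed
  from LeastI_ex[OF this] show "\<not> ce j dvd cb (Suc j)" "s $ cb (Suc j) \<noteq> 0"
    by (simp_all add: cb_Suc)
  show "ce j dvd k" if "k < cb (Suc j)" "s $ k \<noteq> 0" for k
    using not_less_Least[of k "\<lambda>k. \<not> ce j dvd k \<and> s $ k \<noteq> 0"] that by (auto simp: cb_Suc)
qed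

lemma ce_Suc_less:
  assumes "ce j \<noteq> 1" shows "ce (Suc j) < ce j"
proof -
  have "ce (Suc j) \<noteq> ce j" using cb_Suc_props(1)[OF assms] ce_dvd_cb[of "Suc j"] by auto
  thus ?thesis using dvd_imp_le[OF ce_Suc_dvd ce_pos, of j] by simp
qed

lemma ex_ce_1: "\<exists>j. ce j = 1"
proof (rule ccontr)
  assume *: "\<not> ?thesis"
  have "ce j + j \<le> n" for j
  proof (induction j)
    case (Suc j)
    thus ?case using ce_Suc_less[of j] * by fastforce
  qed simp
  from this[of n] * ce_pos[of n] show False by simp
qed

lemma ce_gen: "ce gen = 1"
  unfolding genus_def by (rule LeastI_ex[OF ex_ce_1])

lemma ce_before_gen: "j < gen \<Longrightarrow> ce j \<noteq> 1"
  unfolding genus_def by (rule not_less_Least)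

lemma gen_pos: "gen > 0"
  using ce_gen n_gt_1 by (cases gen) auto

lemma cb_1: "cb 1 = subdegree s"
  using not_dvd s_nz unfolding One_nat_def cb_Suc
  by (intro Least_equality) (auto simp: nth_subdegree_nonzero intro: subdegree_leI)

lemma cb_strict: "j < gen \<Longrightarrow> cb j < cb (Suc j)"
proof (induction j)
  case 0
  show ?case using cb_1 n_less by simp
next
  case (Suc j)
  note p = cb_Suc_props[OF ce_before_gen[OF Suc.prems]]
  have "j < gen" using Suc by simp
  note q = cb_Suc_props[OF ce_before_gen[OF this]]
  have "cb (Suc (Suc j)) \<noteq> cb (Suc j)" using p(1) ce_dvd_cb[of "Suc j"] by auto
  moreover have "\<not> cb (Suc (Suc j)) < cb (Suc j)"
    using q(3)[of "cb (Suc (Suc j))"] p(1,2) dvd_trans[OF ce_Suc_dvd] by blast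
  ultimately show ?case by simp
qed

lemma cb_less: "i < j \<Longrightarrow> j \<le> gen \<Longrightarrow> cb i < cb j"
  by (induction j) (auto simp: less_Suc_eq intro: cb_strict less_trans dest: Suc_le_lessD)

lemma cb_le: "i \<le> j \<Longrightarrow> j \<le> gen \<Longrightarrow> cb i \<le> cb j"
  using cb_less[of i j] by (cases "i = j") auto

lemma s_cb: "0 < i \<Longrightarrow> i \<le> gen \<Longrightarrow> s $ cb i \<noteq> 0"
  using cb_Suc_props(2)[OF ce_before_gen, of "i - 1"] by (cases i) auto

lemma support_below_cb: "0 < i \<Longrightarrow> i \<le> gen \<Longrightarrow> k < cb i \<Longrightarrow> s $ k \<noteq> 0 \<Longrightarrow> ce (i - 1) dvd k"
  using cb_Suc_props(3)[OF ce_before_gen, of "i - 1"] by (cases i) auto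

text \<open>The term \<open>cb i\<close> is moved to the left, so that no truncated subtraction
  remains.\<close>

lemma val_rec: "i < gen \<Longrightarrow> val (Suc i) + cb i = char_quot n s i * val i + cb (Suc i)"
  using cb_strict[of i] by simp

text \<open>In the recursion the terms with the previous generator and the previous exponent are
  multiples of the current gcd, so modulo this gcd the new generator agrees with the new
  characteristic exponent.\<close>

lemma gcd_val: "i < gen \<Longrightarrow> gcd (ce i) (val (Suc i)) = ce (Suc i) \<and> ce i dvd val i"
proof (induction i)
  case 0
  have "val (Suc 0) = cb 1" using val_rec[OF 0] by (simp add: char_quot_def)
  thus ?case by (simp add: ce_Suc)
next
  case (Suc i)
  hence "ce (Suc i) dvd val (Suc i)"
    by (metis Suc_lessD gcd_dvd2)
  moreover have "gcd (ce (Suc i)) (val (Suc (Suc i))) = ce (Suc (Suc i))"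
  proof -
    obtain a where a: "cb (Suc i) = ce (Suc i) * a" using ce_dvd_cb by blast
    obtain b where b: "val (Suc i) = ce (Suc i) * b" using calculation by blast
    have "gcd (ce (Suc i)) (val (Suc (Suc i))) = gcd (ce (Suc i)) (val (Suc (Suc i)) + cb (Suc i))"
      unfolding a by (metis gcd_add_mult add.commute mult.commute gcd.commute)
    also have "\<dots> = gcd (ce (Suc i)) (cb (Suc (Suc i)))"
      unfolding val_rec[OF Suc.prems] b by (metis gcd_add_mult mult.assoc mult.commute)
    finally show ?thesis by (simp add: ce_Suc)
  qed
  ultimately show ?case by simp
qed

lemma gcd_val': "0 < i \<Longrightarrow> i \<le> gen \<Longrightarrow> gcd (ce (i - 1)) (val i) = ce i"
  using gcd_val[of "i - 1"] by (cases i) auto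

lemma ce_dvd_val: "i \<le> gen \<Longrightarrow> ce i dvd val i"
  using gcd_val'[of i] by (cases "i = 0") (auto, metis gcd_dvd2)

lemma val_ge_cb: "0 < i \<Longrightarrow> i \<le> gen \<Longrightarrow> cb i \<le> val i"
proof (induction i)
  case (Suc i)
  show ?case
  proof (cases "i = 0")
    case True
    thus ?thesis using val_rec[of 0] Suc by (simp add: char_quot_def)
  next
    case False
    hence "cb i \<le> val i" using Suc by simp
    moreover have "char_quot n s i > 0"
      using ce_antimono[of "i - 1" i] ce_pos dvd_imp_le[of "ce i" "ce (i-1)"]
      by (auto simp: char_quot_def div_greater_zero_iff)
    hence "val i \<le> char_quot n s i * val i" by simp
    ultimately show ?thesis using val_rec[of i] Suc by linarith
  qed
qed simp

lemma cb_pos: "i \<le> gen \<Longrightarrow> cb i > 0"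
  using cb_le[of 0 i] n_gt_1 by simp

lemma val_pos: "i \<le> gen \<Longrightarrow> val i > 0"
  using val_ge_cb[of i] cb_pos[of i] n_gt_1 by (cases "i = 0") auto

section \<open>Conjugates of the truncated series\<close>

text \<open>The number of distinct conjugates of the series truncated below the \<open>i\<close>-th
  characteristic exponent, hence the degree of the \<open>i\<close>-th semiroot.\<close>

definition conj_count :: "nat \<Rightarrow> nat" where
  "conj_count i = n div ce (i - 1)"

lemma conj_count_mult: "conj_count i * ce (i - 1) = n"
  using ce_dvd_n by (simp add: conj_count_def)

lemma conj_count_pos: "conj_count i > 0"
  using conj_count_mult[of i] n_gt_1 by (cases "conj_count i = 0") auto

lemma conj_count_dvd_iff: "conj_count i dvd k \<longleftrightarrow> n dvd k * ce (i - 1)"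
  using conj_count_mult[of i] ce_pos[of "i - 1"]
  by (metis dvd_times_right_cancel_iff mult.commute not_gr0)

lemma conj_count_1 [simp]: "conj_count (Suc 0) = 1"
  using n_gt_1 by (simp add: conj_count_def)

lemma conj_count_Suc:
  assumes "i > 0"
  shows "conj_count (Suc i) = char_quot n s i * conj_count i"
proof -
  have "ce (i - 1) = char_quot n s i * ce i"
    using assms ce_antimono[of "i - 1" i] by (simp add: char_quot_def)
  hence "char_quot n s i * conj_count i * ce i = n"
    using conj_count_mult[of i] by (simp add: mult_ac)
  thus ?thesis using conj_count_mult[of "Suc i"] ce_pos[of i]
    by (metis diff_Suc_1 mult_cancel2 not_gr0)
qed

lemma char_quot_pos: "char_quot n s i > 0"
  using conj_count_Suc[of i] conj_count_pos[of "Suc i"] by (cases "i = 0") (auto simp: char_quot_def)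

text \<open>
  With \<open>\<zeta>\<close> a primitive \<open>n\<close>-th root of unity, \<open>conj_order k\<close> is the order of \<open>s(t) - s(\<zeta>\<^sup>k t)\<close>.
\<close>

definition conj_order :: "nat \<Rightarrow> nat" where
  "conj_order k = (LEAST j. s $ j \<noteq> 0 \<and> \<not> n dvd k * j)"

text \<open>If every exponent below \<open>cb i\<close> were fixed, the characteristic ones would be
  as well, and \<open>n dvd k * ce l\<close> would pass from \<open>l\<close> to
  \<open>l + 1\<close> by taking gcds, up to \<open>l = i - 1\<close>.\<close>

lemma ex_moved:
  assumes "0 < i" "i \<le> gen" "\<not> conj_count i dvd k"
  shows "\<exists>j<cb i. s $ j \<noteq> 0 \<and> \<not> n dvd k * j"
proof (rule ccontr)
  assume *: "\<not> ?thesis"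
  have "l < i \<Longrightarrow> n dvd k * ce l" for l
  proof (induction l)
    case (Suc l)
    have "cb (Suc l) < cb i" using cb_less[of "Suc l" i] Suc assms by simp
    moreover have "s $ cb (Suc l) \<noteq> 0" using s_cb[of "Suc l"] Suc assms by simp
    ultimately have "n dvd k * cb (Suc l)" using * by blast
    moreover have "n dvd k * ce l" using Suc by simp
    ultimately have "n dvd gcd (k * ce l) (k * cb (Suc l))" by simp
    thus ?case by (simp add: ce_Suc gcd_mult_distrib_nat)
  qed simp
  from this[of "i - 1"] assms show False by (simp add: conj_count_dvd_iff)
qed

lemma conj_order_props:
  assumes "0 < i" "i \<le> gen" "\<not> conj_count i dvd k"
  shows "conj_order k < cb i" "s $ conj_order k \<noteq> 0" "\<not> n dvd k * conj_order k"
    "\<And>j. j < conj_order k \<Longrightarrow> s $ j \<noteq> 0 \<Longrightarrow> n dvd k * j"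
proof -
  obtain j where j: "j < cb i" "s $ j \<noteq> 0 \<and> \<not> n dvd k * j" using ex_moved[OF assms] by blast
  from LeastI[of "\<lambda>j. s $ j \<noteq> 0 \<and> \<not> n dvd k * j", OF j(2)]
  show "s $ conj_order k \<noteq> 0" "\<not> n dvd k * conj_order k" by (simp_all add: conj_order_def)
  show "conj_order k < cb i" using Least_le[of "\<lambda>j. s $ j \<noteq> 0 \<and> \<not> n dvd k * j", OF j(2)] j
    by (simp add: conj_order_def)
  show "n dvd k * j" if "j < conj_order k" "s $ j \<noteq> 0" for j
    using not_less_Least[of j "\<lambda>j. s $ j \<noteq> 0 \<and> \<not> n dvd k * j"] that by (auto simp: conj_order_def)
qed

lemma fixed_below:
  assumes "0 < i" "i \<le> gen" "j < cb i" "s $ j \<noteq> 0"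
  shows "n dvd conj_count i * j"
  using support_below_cb[OF assms] conj_count_mult[of i]
  by (metis dvd_mult_right dvd_triv_left mult_dvd_mono dvd_refl)

text \<open>Rotations by multiples of \<open>conj_count i\<close> act trivially on the terms below
  \<open>cb i\<close>, and the first term moved by \<open>r\<close> lies there.\<close>

lemma conj_order_periodic:
  assumes "0 < i" "i \<le> gen" "\<not> conj_count i dvd r"
  shows "conj_order (a * conj_count i + r) = conj_order r"
proof -
  have "n dvd (a * conj_count i + r) * j \<longleftrightarrow> n dvd r * j" if "j < cb i" "s $ j \<noteq> 0" for j
    using fixed_below[OF assms(1,2) that]
    by (simp add: distrib_right dvd_add_right_iff mult.assoc)
  note * = this
  have r': "\<not> conj_count i dvd a * conj_count i + r"
    using assms(3) by (simp add: dvd_add_right_iff)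
  note p = conj_order_props[OF assms] and q = conj_order_props[OF assms(1,2) r']
  show ?thesis
  proof (rule linorder_cases)
    assume "conj_order (a * conj_count i + r) < conj_order r"
    thus ?thesis using p(4) q(1-3) * by blast
  next
    assume "conj_order r < conj_order (a * conj_count i + r)"
    thus ?thesis using q(4) p(1-3) * by blast
  qed
qed

text \<open>Such a rotation fixes all terms below \<open>cb i\<close>. If it also fixed the one of
  order \<open>cb i\<close>, its index would be a multiple of \<open>conj_count (Suc i)\<close>, so
  \<open>char_quot n s i\<close> would divide \<open>a\<close>.\<close>

lemma conj_order_multiple:
  assumes "0 < i" "i \<le> gen" "0 < a" "a < char_quot n s i"
  shows "conj_order (a * conj_count i) = cb i"
proof -
  let ?k = "a * conj_count i"
  have fxd: "n dvd ?k * j" if "j < cb i" "s $ j \<noteq> 0" for j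
    using fixed_below[OF assms(1,2) that] by (simp add: mult.assoc)
  have "\<not> n dvd ?k * cb i"
  proof
    assume "n dvd ?k * cb i"
    moreover have "n dvd ?k * ce (i - 1)" using conj_count_dvd_iff[of i ?k] by simp
    ultimately have "n dvd gcd (?k * ce (i - 1)) (?k * cb i)" by simp
    hence "n dvd ?k * ce i" using assms(1) ce_Suc[of "i - 1"] by (simp add: gcd_mult_distrib_nat)
    hence "conj_count (Suc i) dvd ?k" by (simp add: conj_count_dvd_iff)
    hence "char_quot n s i dvd a" using conj_count_Suc[OF assms(1)] conj_count_pos[of i] by simp
    thus False using assms by (auto dest: dvd_imp_le)
  qed
  thus ?thesis unfolding conj_order_def using fxd s_cb[OF assms(1,2)]
    by (intro Least_equality) (auto simp: not_less[symmetric])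
qed

text \<open>The right-hand side is the order of a product over the conjugates, so this links the
  recursion for the semigroup generators with intersection multiplicities. The indices below
  \<open>conj_count (Suc i)\<close> form \<open>char_quot n s i\<close> blocks of length
  \<open>conj_count i\<close>. By the two preceding lemmas each block repeats the old sum, and its
  first index contributes \<open>cb i\<close>, except in the block of 0.\<close>

lemma val_eq_sum:
  assumes "0 < i" "i \<le> gen"
  shows "val i = cb i + (\<Sum>k=1..<conj_count i. conj_order k)"
  using assms
proof (induction i)
  case (Suc i)
  show ?case
  proof (cases "i = 0")
    case True
    thus ?thesis using val_rec[of 0] Suc by (simp add: char_quot_def)
  next
    case False
    hence i: "0 < i" "i \<le> gen" using Suc.prems by auto
    define N q where "N = conj_count i" and "q = char_quot n s i"
    have N: "N > 0" and q: "q > 0" using conj_count_pos char_quot_pos by (simp_all add: N_def q_def)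
    \<comment> \<open>Index 0 gets the value 0, so that all blocks have full length.\<close>
    define f where "f k = (if k = 0 then 0 else conj_order k)" for k
    define D where "D = (\<Sum>k=1..<N. conj_order k)"
    have rng: "(\<Sum>k=1..<M. conj_order k) = (\<Sum>k<M. f k)" if "M > 0" for M
    proof -
      have "{..<M} = insert 0 {1..<M}" using that by auto
      thus ?thesis by (simp add: f_def)
    qed
    have "(\<Sum>k=1..<conj_count (Suc i). conj_order k) = (\<Sum>k<q * N. f k)"
      using rng[of "q * N"] N q conj_count_Suc[OF i(1)] by (simp add: N_def q_def)
    also have "\<dots> = (\<Sum>a<q. \<Sum>k=a * N..<a * N + N. f k)"
      by (rule sum.nat_group[symmetric])
    also have "\<dots> = (\<Sum>a<q. (if a = 0 then 0 else cb i) + D)"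
    proof (intro sum.cong refl)
      fix a assume a: "a \<in> {..<q}"
      have "(\<Sum>k=a * N..<a * N + N. f k) = (\<Sum>r<N. f (a * N + r))"
        using sum.shift_bounds_nat_ivl[of f 0 "a * N" N] by (simp add: atLeast0LessThan add.commute)
      also have "{..<N} = insert 0 {1..<N}" using N by auto
      also have "(\<Sum>r\<in>insert 0 {1..<N}. f (a * N + r)) = f (a * N) + (\<Sum>r=1..<N. f (a * N + r))"
        by simp
      also have "f (a * N) = (if a = 0 then 0 else cb i)"
        using conj_order_multiple[OF i, of a] a N by (auto simp: f_def N_def q_def)
      also have "(\<Sum>r=1..<N. f (a * N + r)) = D"
        unfolding D_def
      proof (intro sum.cong refl)
        fix r assume r: "r \<in> {1..<N}"
        hence "\<not> N dvd r" by (auto dest: dvd_imp_le)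
        thus "f (a * N + r) = conj_order r"
          using conj_order_periodic[OF i, of r a] r by (simp add: f_def N_def)
      qed
      finally show "(\<Sum>k=a * N..<a * N + N. f k) = (if a = 0 then 0 else cb i) + D" .
    qed
    also have "\<dots> = (q - 1) * cb i + q * D"
    proof -
      have "(\<Sum>a<q. if a = 0 then 0 else cb i) = (\<Sum>a\<in>{1..<q}. cb i)"
        using q by (intro sum.mono_neutral_cong_right) auto
      thus ?thesis by (simp add: sum.distrib)
    qed
    finally have S: "(\<Sum>k=1..<conj_count (Suc i). conj_order k) = (q - 1) * cb i + q * D" .
    have "val i = cb i + D" using Suc i by (simp add: D_def N_def)
    moreover have "val (Suc i) + cb i = q * val i + cb (Suc i)"
      using val_rec[of i] Suc.prems by (simp add: q_def)
    ultimately have "val (Suc i) + cb i = cb (Suc i) + (q - 1) * cb i + q * D + cb i"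
      using q by (cases q) (auto simp: algebra_simps)
    thus ?thesis using S by simp
  qed
qed simp

end

section \<open>Leading terms and semiroots\<close>

text \<open>The coefficient \<open>p\<close> may be zero, and then only a lower bound for the order
  is recorded. So sums and differences need no case distinction on cancellation.\<close>

definition leading :: "'a::comm_ring_1 fps \<Rightarrow> nat \<Rightarrow> 'a \<Rightarrow> bool" where
  "leading f m p \<longleftrightarrow> (\<forall>i<m. f $ i = 0) \<and> f $ m = p"

lemma leadingI: "(\<And>i. i < m \<Longrightarrow> f $ i = 0) \<Longrightarrow> f $ m = p \<Longrightarrow> leading f m p"
  by (simp add: leading_def)

lemma leading_nth: "leading f m p \<Longrightarrow> f $ m = p"
  and leading_nth_less: "leading f m p \<Longrightarrow> i < m \<Longrightarrow> f $ i = 0"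
  by (simp_all add: leading_def)

lemma leading_iff: "leading f m p \<longleftrightarrow> (\<exists>g. f = fps_X ^ m * g \<and> g $ 0 = p)"
proof
  assume l: "leading f m p"
  have "f = fps_X ^ m * fps_shift m f"
    using l by (intro fps_ext) (simp add: fps_X_power_mult_nth leading_def)
  thus "\<exists>g. f = fps_X ^ m * g \<and> g $ 0 = p"
    using l by (intro exI[of _ "fps_shift m f"]) (simp add: leading_def)
qed (auto simp: leading_def fps_X_power_mult_nth)

lemma leading_mult:
  assumes "leading f m p" "leading g k q"
  shows "leading (f * g) (m + k) (p * q)"
proof -
  obtain f' g' where "f = fps_X ^ m * f'" "f' $ 0 = p" "g = fps_X ^ k * g'" "g' $ 0 = q"
    using assms unfolding leading_iff by blast
  thus ?thesis unfolding leading_iff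
    by (intro exI[of _ "f' * g'"]) (auto simp: power_add mult_ac)
qed

lemma leading_add: "leading f m p \<Longrightarrow> leading g m q \<Longrightarrow> leading (f + g) m (p + q)"
  and leading_diff: "leading f m p \<Longrightarrow> leading g m q \<Longrightarrow> leading (f - g) m (p - q)"
  by (simp_all add: leading_def)

lemma leading_lower: "leading f m p \<Longrightarrow> k < m \<Longrightarrow> leading f k 0"
  by (simp add: leading_def)

lemma leading_0 [simp]: "leading 0 m 0" by (simp add: leading_def)

lemma leading_of_nat: "leading (of_nat c) 0 (of_nat c)"
  by (simp add: leading_def)

lemma leading_deriv: "leading f (Suc m) p \<Longrightarrow> leading (fps_deriv f) m (of_nat (Suc m) * p)"
  by (auto simp: leading_def)

lemma leading_deriv': "leading f m p \<Longrightarrow> m > 0 \<Longrightarrow> leading (fps_deriv f) (m - 1) (of_nat m * p)"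
  using leading_deriv[of f "m - 1" p] by simp

lemma leading_unique:
  "leading f m p \<Longrightarrow> leading f k q \<Longrightarrow> p \<noteq> 0 \<Longrightarrow> q \<noteq> 0 \<Longrightarrow> m = k"
  by (metis leading_def nat_neq_iff)

lemma leading_prod:
  "finite A \<Longrightarrow> (\<And>x. x \<in> A \<Longrightarrow> leading (f x) (m x) (p x)) \<Longrightarrow>
     leading (\<Prod>x\<in>A. f x) (\<Sum>x\<in>A. m x) (\<Prod>x\<in>A. p x)"
proof (induction A rule: finite_induct)
  case empty
  show ?case by (simp add: leading_def)
qed (simp add: leading_mult)

lemma leading_power: "leading f m p \<Longrightarrow> leading (f ^ k) (k * m) (p ^ k)"
proof (induction k)
  case (Suc k)
  from leading_mult[OF Suc.prems Suc.IH[OF Suc.prems]] show ?case by simp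
qed (simp add: leading_def)

lemma leading_subdegree: "leading f m p \<Longrightarrow> p \<noteq> 0 \<Longrightarrow> subdegree f = m"
  unfolding leading_def by (intro subdegreeI) auto

lemma leading_nz: "leading f m p \<Longrightarrow> p \<noteq> 0 \<Longrightarrow> f \<noteq> 0"
  unfolding leading_def by auto

lemma leading_of_nz: "f \<noteq> 0 \<Longrightarrow> leading f (subdegree f) (f $ subdegree f)"
  unfolding leading_def using nth_less_subdegree_zero by auto


text \<open>
  The ring \<open>\<complex>[[t]][u]\<close> is \<^typ>\<open>complex fps poly\<close>; regarded as power series in \<open>t\<close>, its elements
  lie in \<open>\<complex>[u][[t]]\<close>, which is \<^typ>\<open>complex poly fps\<close>.
\<close>

definition by_t :: "complex fps poly \<Rightarrow> complex poly fps" where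
  "by_t A = Abs_fps (\<lambda>i. map_poly (\<lambda>f. f $ i) A)"

lemma by_t_nth: "coeff (by_t A $ i) l = coeff A l $ i"
  by (simp add: by_t_def coeff_map_poly)

lemma by_t_eqI: "(\<And>i l. coeff (f $ i) l = coeff (g $ i) l) \<Longrightarrow> f = (g :: complex poly fps)"
  by (intro fps_ext poly_eqI)

lemma by_t_0 [simp]: "by_t 0 = 0" by (intro by_t_eqI) (simp add: by_t_nth)

lemma by_t_add: "by_t (A + B) = by_t A + by_t B"
  and by_t_diff: "by_t (A - B) = by_t A - by_t B"
  by (intro by_t_eqI; simp add: by_t_nth)+

lemma by_t_1 [simp]: "by_t 1 = 1"
  by (intro by_t_eqI) (auto simp: by_t_nth split: nat.splits)

lemma by_t_mult: "by_t (A * B) = by_t A * by_t B"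
proof (intro by_t_eqI)
  fix i l
  have "coeff (by_t (A * B) $ i) l = (\<Sum>k\<le>l. \<Sum>j=0..i. coeff A k $ j * coeff B (l - k) $ (i - j))"
    by (simp add: by_t_nth coeff_mult fps_sum_nth fps_mult_nth)
  also have "\<dots> = (\<Sum>j=0..i. \<Sum>k\<le>l. coeff A k $ j * coeff B (l - k) $ (i - j))"
    by (rule sum.swap)
  also have "\<dots> = coeff ((by_t A * by_t B) $ i) l"
    by (simp add: fps_mult_nth coeff_sum coeff_mult by_t_nth)
  finally show "coeff (by_t (A * B) $ i) l = coeff ((by_t A * by_t B) $ i) l" .
qed

lemma by_t_prod: "by_t (\<Prod>x\<in>A. f x) = (\<Prod>x\<in>A. by_t (f x))"
  by (induction A rule: infinite_finite_induct) (simp_all add: by_t_mult)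

lemma by_t_of_nat: "by_t (of_nat c) = of_nat c"
  by (induction c) (simp_all add: by_t_add)

lemma by_t_eq_0_iff: "by_t A = 0 \<longleftrightarrow> A = 0"
proof
  assume "by_t A = 0"
  hence "coeff A l $ i = 0" for i l by (simp flip: by_t_nth)
  thus "A = 0" by (intro poly_eqI fps_ext) simp
qed simp

definition pd_u :: "complex poly fps \<Rightarrow> complex poly fps" where
  "pd_u f = Abs_fps (\<lambda>i. pderiv (f $ i))"

lemma pd_u_nth [simp]: "pd_u f $ i = pderiv (f $ i)" by (simp add: pd_u_def)

lemma by_t_pderiv: "by_t (pderiv A) = pd_u (by_t A)"
  by (intro by_t_eqI) (simp add: by_t_nth coeff_pderiv fps_of_nat[symmetric] del: of_nat_Suc)

lemma by_t_dx: "by_t (dx_poly A) = fps_deriv (by_t A)"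
proof (intro by_t_eqI)
  fix i l
  have "coeff (of_nat k * p) l = of_nat k * coeff p l" for k and p :: "complex poly"
    by (simp add: of_nat_poly)
  thus "coeff (by_t (dx_poly A) $ i) l = coeff (fps_deriv (by_t A) $ i) l"
    by (simp add: by_t_nth dx_poly_def coeff_map_poly del: of_nat_Suc)
qed

lemma leading_pd_u: "leading f m p \<Longrightarrow> leading (pd_u f) m (pderiv p)"
  by (simp add: leading_def)

section \<open>Pull-back of polynomials along the family\<close>

text \<open>The composite of \<open>G\<close> with the family. As \<open>G\<close> is a polynomial
  in \<open>y\<close>, the result is a polynomial in \<open>u\<close>, so that \<open>u\<close> may
  later be replaced by any series in \<open>t\<close>, also one with a constant term.\<close>

definition subst_u :: "nat \<Rightarrow> complex fps \<Rightarrow> nat \<Rightarrow> complex fps poly \<Rightarrow> complex fps poly" where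
  "subst_u n S b G = pcompose (map_poly (\<lambda>a. a oo fps_X ^ n) G) [:S, fps_X ^ b:]"

lemma map_poly_hom_add:
  assumes "f 0 = 0" "\<And>a b. f (a + b) = f a + f b"
  shows "map_poly f (p + q) = map_poly f p + map_poly f q"
  by (intro poly_eqI) (simp add: coeff_map_poly assms)

lemma map_poly_hom_mult:
  fixes f :: "'a::comm_ring_1 \<Rightarrow> 'b::comm_ring_1"
  assumes "f 0 = 0" "\<And>a b. f (a + b) = f a + f b" "\<And>a b. f (a * b) = f a * f b"
  shows "map_poly f (p * q) = map_poly f p * map_poly f q"
proof -
  have s: "f (sum g A) = (\<Sum>x\<in>A. f (g x))" for g :: "nat \<Rightarrow> 'a" and A
    by (induction A rule: infinite_finite_induct) (simp_all add: assms)
  show ?thesis by (intro poly_eqI) (simp add: coeff_map_poly assms coeff_mult s)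
qed

lemma map_poly_hom_prod:
  fixes f :: "'a::comm_ring_1 \<Rightarrow> 'b::comm_ring_1"
  assumes "f 0 = 0" "f 1 = 1" "\<And>a b. f (a + b) = f a + f b" "\<And>a b. f (a * b) = f a * f b"
  shows "map_poly f (\<Prod>x\<in>A. p x) = (\<Prod>x\<in>A. map_poly f (p x))"
  by (induction A rule: infinite_finite_induct) (simp_all add: assms map_poly_hom_mult)

lemma map_poly_hom_poly:
  fixes f :: "'a::comm_ring_1 \<Rightarrow> 'b::comm_ring_1"
  assumes "f 0 = 0" "\<And>a b. f (a + b) = f a + f b" "\<And>a b. f (a * b) = f a * f b"
  shows "poly (map_poly f p) (f x) = f (poly p x)"
  by (induction p) (simp_all add: assms map_poly_pCons)

context
  fixes n :: nat
  assumes n: "n > 0"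
begin

lemma Xn_0: "(fps_X ^ n :: complex fps) $ 0 = 0" using n by simp

lemma subst_u_0 [simp]: "subst_u n S b 0 = 0" by (simp add: subst_u_def)

lemma subst_u_add: "subst_u n S b (G + H) = subst_u n S b G + subst_u n S b H"
  by (simp add: subst_u_def map_poly_hom_add fps_compose_add_distrib pcompose_add)

lemma subst_u_mult: "subst_u n S b (G * H) = subst_u n S b G * subst_u n S b H"
  by (simp add: subst_u_def map_poly_hom_mult fps_compose_add_distrib
      fps_compose_mult_distrib[OF Xn_0] pcompose_mult)

lemma subst_u_pCons: "subst_u n S b (pCons a G) = [:a oo fps_X ^ n:] + [:S, fps_X ^ b:] * subst_u n S b G"
  by (simp add: subst_u_def map_poly_pCons pcompose_pCons)

lemma subst_u_const: "subst_u n S b [:a:] = [:a oo fps_X ^ n:]"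
  by (simp add: subst_u_pCons)

lemma subst_u_1: "subst_u n S b 1 = 1"
  using subst_u_const[of S b 1] by (simp add: one_pCons)

lemma subst_u_eval: "poly (subst_u n S b G) U = eval_param G (puiseux_param n (S + fps_X ^ b * U))"
  by (simp add: subst_u_def eval_param_def puiseux_param_def poly_pcompose mult.commute)

end

section \<open>Semiroots as products over conjugates\<close>

definition rot :: "complex \<Rightarrow> complex fps \<Rightarrow> complex fps" where
  "rot z f = f oo (fps_const z * fps_X)"

lemma rot_nth: "rot z f $ j = z ^ j * f $ j"
  by (simp add: rot_def fps_compose_linear)

lemma rot_add: "rot z (f + g) = rot z f + rot z g"
  by (simp add: rot_def fps_compose_add_distrib)

lemma rot_mult: "rot z (f * g) = rot z f * rot z g"
  by (simp add: rot_def fps_compose_mult_distrib)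

lemma rot_0 [simp]: "rot z 0 = 0" and rot_1 [simp]: "rot z 1 = 1"
  by (simp_all add: rot_def)

lemma rot_uminus: "rot z (- f) = - rot z f"
  by (simp add: rot_def fps_compose_uminus)

lemma rot_rot: "rot z (rot w f) = rot (z * w) f"
  by (rule fps_ext) (simp add: rot_nth power_mult_distrib)

definition zeta :: "nat \<Rightarrow> complex" where
  "zeta n = exp (2 * of_real pi * \<i> / of_nat n)"

lemma zeta_power: "n > 0 \<Longrightarrow> zeta n ^ k = 1 \<longleftrightarrow> n dvd k"
  using complex_root_unity_eq_1[of n k]
  by (simp add: zeta_def exp_of_nat_mult[symmetric] mult_ac)

lemma rot_compose_X_power: "z ^ n = 1 \<Longrightarrow> rot z (a oo fps_X ^ n) = a oo fps_X ^ n"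
  by (rule fps_ext) (auto simp: rot_nth fps_nth_compose_X_power power_mult)

lemma rot_invariant_iff: "n > 0 \<Longrightarrow> rot (zeta n) f = f \<longleftrightarrow> (\<forall>i. \<not> n dvd i \<longrightarrow> f $ i = 0)"
  unfolding fps_eq_iff rot_nth by (auto simp: zeta_power[symmetric])

lemma poly_fps_to_fls:
  assumes "n > 0"
  shows "poly (map_poly (\<lambda>a. fls_compose_power a n) (map_poly fps_to_fls G)) (fps_to_fls T) =
    fps_to_fls (poly (map_poly (\<lambda>a. a oo fps_X ^ n) G) T)"
  by (induction G) (simp_all add: map_poly_pCons fls_compose_power_fps_to_fls assms
      fls_times_fps_to_fls)

locale branch = puiseux +
  fixes Fs :: "nat \<Rightarrow> complex fps poly"
  assumes Fs_0: "Fs 0 = [:fps_X:]"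
    and Fs_min: "\<And>i. 0 < i \<Longrightarrow> i \<le> gen \<Longrightarrow>
       is_min_poly n (map_poly fps_to_fls (Fs i)) (fps_to_fls (fps_cutoff (cb i) s))"
begin

abbreviation "trunc i \<equiv> fps_cutoff (cb i) s"

lemma n_pos: "n > 0" using n_gt_1 by simp

lemma rot_trunc_eq_iff:
  assumes "0 < i" "i \<le> gen" "k \<le> l"
  shows "rot (zeta n ^ k) (trunc i) = rot (zeta n ^ l) (trunc i) \<longleftrightarrow> conj_count i dvd (l - k)"
proof -
  have z: "zeta n \<noteq> 0" by (simp add: zeta_def)
  have "zeta n ^ (k * j) = zeta n ^ (l * j) \<longleftrightarrow> n dvd (l - k) * j" for j
  proof -
    have "zeta n ^ (l * j) = zeta n ^ (k * j) * zeta n ^ ((l - k) * j)"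
      using assms(3) by (simp flip: power_add add: add_mult_distrib[symmetric])
    hence "zeta n ^ (k * j) = zeta n ^ (l * j) \<longleftrightarrow> zeta n ^ ((l - k) * j) = 1"
      using z by simp
    thus ?thesis by (simp add: zeta_power n_pos)
  qed
  hence "rot (zeta n ^ k) (trunc i) = rot (zeta n ^ l) (trunc i) \<longleftrightarrow>
      (\<forall>j<cb i. s $ j \<noteq> 0 \<longrightarrow> n dvd (l - k) * j)"
    unfolding fps_eq_iff rot_nth by (auto simp: power_mult[symmetric])
  also have "\<dots> \<longleftrightarrow> conj_count i dvd (l - k)"
  proof
    assume "conj_count i dvd (l - k)"
    thus "\<forall>j<cb i. s $ j \<noteq> 0 \<longrightarrow> n dvd (l - k) * j"
      using fixed_below[OF assms(1,2)] by (meson dvd_refl dvd_trans mult_dvd_mono)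
  qed (use ex_moved[OF assms(1,2)] in blast)
  finally show ?thesis .
qed

definition "conj_prod i = (\<Prod>k<conj_count i. [:- rot (zeta n ^ k) (trunc i), 1:])"

lemma monic_conj_prod: "degree (conj_prod i) = conj_count i" "lead_coeff (conj_prod i) = 1"
proof -
  show "degree (conj_prod i) = conj_count i"
    unfolding conj_prod_def by (simp add: degree_prod_sum_eq)
  show "lead_coeff (conj_prod i) = 1" unfolding conj_prod_def lead_coeff_prod by simp
qed

text \<open>Rotation shifts the index of the factors by one, and the factor of index
  \<open>conj_count i\<close> is again the one of index 0. The products are compared after
  multiplication by this factor, which is then cancelled.\<close>

lemma conj_prod_invariant:
  assumes "0 < i" "i \<le> gen"
  shows "map_poly (rot (zeta n)) (conj_prod i) = conj_prod i"
proof -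
  let ?N = "conj_count i" and ?f = "\<lambda>k. [:- rot (zeta n ^ k) (trunc i), 1:]"
  have "map_poly (rot (zeta n)) (conj_prod i) = (\<Prod>k<?N. ?f (Suc k))"
    unfolding conj_prod_def
    by (subst map_poly_hom_prod) (simp_all add: rot_add rot_mult map_poly_pCons rot_uminus rot_rot)
  also have "\<dots> * ?f 0 = (\<Prod>k<Suc ?N. ?f k)" by (simp add: prod.lessThan_Suc_shift del: prod.lessThan_Suc)
  also have "\<dots> = conj_prod i * ?f ?N" by (simp add: conj_prod_def)
  also have "?f ?N = ?f 0" using rot_trunc_eq_iff[OF assms, of 0 ?N] by simp
  finally have "map_poly (rot (zeta n)) (conj_prod i) * ?f 0 = conj_prod i * ?f 0" .
  moreover have "?f 0 \<noteq> 0" by simp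
  ultimately show ?thesis using mult_right_cancel by blast
qed

text \<open>By invariance the product over the conjugates has coefficients that are series in
  \<open>t^n\<close>, so it descends to a polynomial over the series in \<open>x\<close>, and
  minimality bounds the degree of \<open>Fs i\<close>. Conversely all conjugates are roots of
  \<open>Fs i\<close>, whose coefficients are fixed by the rotations. Two monic polynomials of
  degree \<open>conj_count i\<close> with that many common roots agree.\<close>

lemma Fs_conj_prod:
  assumes i: "0 < i" "i \<le> gen"
  shows "map_poly (\<lambda>a. a oo fps_X ^ n) (Fs i) = conj_prod i"
    and degree_Fs: "degree (Fs i) = conj_count i" and lead_Fs: "lead_coeff (Fs i) = 1"
proof -
  let ?N = "conj_count i"
  define P where "P = map_poly (\<lambda>a. a oo fps_X ^ n) (Fs i)"
  note m = Fs_min[OF i, unfolded is_min_poly_def annihilates_def poly_fps_to_fls[OF n_pos]]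
  have inj: "map_poly fps_to_fls G = 0 \<longleftrightarrow> G = 0" for G :: "complex fps poly"
    by (auto simp: poly_eq_iff coeff_map_poly)
  have deg: "degree (map_poly fps_to_fls G) = degree G" for G :: "complex fps poly"
    by (cases "G = 0") (auto intro!: map_poly_degree_eq)
  have lc: "lead_coeff (map_poly fps_to_fls G) = fps_to_fls (lead_coeff G)" for G :: "complex fps poly"
    by (simp add: deg coeff_map_poly)
  show lead: "lead_coeff (Fs i) = 1" using m by (simp add: lc)
  have root: "poly P (trunc i) = 0" using m by (simp add: P_def)
  define R where "R = map_poly (\<lambda>c. Abs_fps (\<lambda>j. c $ (n * j))) (conj_prod i)"
  have R: "map_poly (\<lambda>a. a oo fps_X ^ n) R = conj_prod i"
  proof (intro poly_eqI fps_ext)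
    fix l j
    have "rot (zeta n) (coeff (conj_prod i) l) = coeff (conj_prod i) l"
      using arg_cong[OF conj_prod_invariant[OF i], of "\<lambda>p. coeff p l"] by (simp add: coeff_map_poly)
    hence "\<forall>i'. \<not> n dvd i' \<longrightarrow> coeff (conj_prod i) l $ i' = 0" by (simp add: rot_invariant_iff n_pos)
    thus "coeff (map_poly (\<lambda>a. a oo fps_X ^ n) R) l $ j = coeff (conj_prod i) l $ j"
      using n_pos by (auto simp: R_def coeff_map_poly fps_nth_compose_X_power fps_zero_def[symmetric])
  qed
  have "R \<noteq> 0" using R monic_conj_prod(2)[of i] by auto
  moreover have "poly (conj_prod i) (trunc i) = 0"
  proof -
    have "rot 1 f = f" for f by (rule fps_ext) (simp add: rot_nth)
    thus ?thesis using conj_count_pos[of i] by (auto simp: conj_prod_def poly_prod intro!: bexI[of _ 0])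
  qed
  ultimately have "degree (Fs i) \<le> degree R"
    using m[THEN conjunct2, THEN conjunct2, rule_format, of "map_poly fps_to_fls R"]
    by (simp add: inj deg R poly_fps_to_fls[OF n_pos])
  also have "degree R \<le> degree (conj_prod i)"
    unfolding R_def by (rule map_poly_degree_leq)
  finally have le: "degree (Fs i) \<le> ?N" by (simp add: monic_conj_prod)
  have degP: "degree P = degree (Fs i)" unfolding P_def
    by (rule map_poly_degree_eq) (use lead in auto)
  have leadP: "coeff P (degree (Fs i)) = 1" using lead by (simp add: P_def coeff_map_poly)
  define Z where "Z = (\<lambda>k. rot (zeta n ^ k) (trunc i)) ` {..<?N}"
  have "inj_on (\<lambda>k. rot (zeta n ^ k) (trunc i)) {..<?N}"
  proof (rule linorder_inj_onI')
    fix k l assume "k \<in> {..<?N}" "l \<in> {..<?N}" "k < l"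
    thus "rot (zeta n ^ k) (trunc i) \<noteq> rot (zeta n ^ l) (trunc i)"
      using rot_trunc_eq_iff[OF i, of k l] by (auto dest: dvd_imp_le)
  qed
  hence card: "card Z = ?N" by (simp add: Z_def card_image)
  have Z: "poly P z = 0 \<and> poly (conj_prod i) z = 0" if "z \<in> Z" for z
  proof -
    obtain k where k: "k < ?N" "z = rot (zeta n ^ k) (trunc i)" using \<open>z \<in> Z\<close> by (auto simp: Z_def)
    have "map_poly (rot (zeta n ^ k)) P = P"
    proof -
      have "(zeta n ^ k) ^ n = 1" by (metis dvd_refl mult.commute n_pos power_mult power_one zeta_power)
      thus ?thesis unfolding P_def by (intro poly_eqI) (simp add: coeff_map_poly rot_compose_X_power)
    qed
    hence "poly P z = rot (zeta n ^ k) (poly P (trunc i))"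
      unfolding k using map_poly_hom_poly[of "rot (zeta n ^ k)" P "trunc i"]
      by (simp add: rot_add rot_mult)
    thus ?thesis using k root by (auto simp: conj_prod_def poly_prod)
  qed
  have Pnz: "P \<noteq> 0" using leadP by auto
  have "?N = card Z" by (simp add: card)
  also have "\<dots> \<le> card {z. poly P z = 0}" using Z by (intro card_mono poly_roots_finite Pnz) auto
  also have "\<dots> \<le> degree (Fs i)" using card_poly_roots_bound[OF Pnz] degP by simp
  finally show deg_eq: "degree (Fs i) = ?N" using le by simp
  show "map_poly (\<lambda>a. a oo fps_X ^ n) (Fs i) = conj_prod i"
    unfolding P_def[symmetric]
    by (rule poly_eqI_degree_lead_coeff[of _ ?N _ Z])
       (use leadP deg_eq degP monic_conj_prod[of i] card Z in auto)
qed

abbreviation "bg \<equiv> cb gen"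
abbreviation "base \<equiv> fps_cutoff bg s"
abbreviation "hat \<equiv> subst_u n base bg"

lemma hat_Fs:
  assumes "0 < i" "i \<le> gen"
  shows "hat (Fs i) = (\<Prod>k<conj_count i. [:base - rot (zeta n ^ k) (trunc i), fps_X ^ bg:])"
  unfolding subst_u_def Fs_conj_prod[OF assms] conj_prod_def pcompose_prod by (simp add: pcompose_pCons)

lemma leading_linear_factor:
  assumes "leading A m c" "m < b"
  shows "leading (by_t [:A, fps_X ^ b:]) m [:c:]"
proof -
  have "by_t [:A, fps_X ^ b:] $ i = [:A $ i, fps_X ^ b $ i:]" for i
    by (intro poly_eqI) (simp add: by_t_nth coeff_pCons split: nat.splits)
  thus ?thesis using assms by (auto simp: leading_def fps_X_power_iff)
qed

text \<open>Only the factor of index 0 can show \<open>u\<close> in its leading term: there the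
  truncation cancels against \<open>base\<close> below order \<open>cb i\<close>. Every other factor
  has an order below \<open>cb i \<le> bg\<close>, coming from a coefficient moved by the rotation.
  The orders add up to \<open>val i\<close> by \<open>val_eq_sum\<close>.\<close>

lemma leading_hat_Fs:
  assumes i: "0 < i" "i \<le> gen"
  shows "\<exists>c. c \<noteq> 0 \<and> leading (by_t (hat (Fs i))) (val i) (if i = gen then [:0, c:] else [:c:])"
proof -
  let ?N = "conj_count i"
  let ?f = "\<lambda>k. by_t [:base - rot (zeta n ^ k) (trunc i), fps_X ^ bg:]"
  define p0 where "p0 = (if i = gen then [:0, 1:] else [:s $ cb i:])"
  have r1: "rot 1 f = f" for f by (rule fps_ext) (simp add: rot_nth)
  have 0: "leading (?f 0) (cb i) p0"
  proof (cases "i = gen")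
    case True
    have "?f 0 $ j = [:0, fps_X ^ bg $ j:]" for j
      by (intro poly_eqI) (simp add: by_t_nth r1 True coeff_pCons split: nat.splits)
    thus ?thesis using True by (auto simp: p0_def leading_def fps_X_power_iff)
  next
    case False
    hence "cb i < bg" using cb_less[of i gen] i by simp
    moreover from this have "leading (base - rot (zeta n ^ 0) (trunc i)) (cb i) (s $ cb i)"
      by (auto simp: leading_def r1)
    ultimately show ?thesis using False leading_linear_factor by (simp add: p0_def)
  qed
  have k: "leading (?f k) (conj_order k) [:s $ conj_order k * (1 - zeta n ^ (k * conj_order k)):]"
    if "k \<in> {1..<?N}" for k
  proof (rule leading_linear_factor)
    have "\<not> ?N dvd k" using that by (auto dest: dvd_imp_le)
    note o = conj_order_props[OF i this]
    show "conj_order k < bg" using o(1) cb_le[of i gen] i by simp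
    have "s $ j = 0 \<or> zeta n ^ (k * j) = 1" if "j < conj_order k" for j
      using o(4)[OF that] by (auto simp: zeta_power n_pos)
    thus "leading (base - rot (zeta n ^ k) (trunc i)) (conj_order k)
        (s $ conj_order k * (1 - zeta n ^ (k * conj_order k)))"
      using o(1) \<open>conj_order k < bg\<close>
      by (auto simp: leading_def rot_nth power_mult[symmetric] algebra_simps)
  qed
  have nz: "s $ conj_order k * (1 - zeta n ^ (k * conj_order k)) \<noteq> 0" if "k \<in> {1..<?N}" for k
  proof -
    have "\<not> ?N dvd k" using that by (auto dest: dvd_imp_le)
    from conj_order_props[OF i this] show ?thesis by (simp add: zeta_power n_pos)
  qed
  define c where "c = (\<Prod>k=1..<?N. s $ conj_order k * (1 - zeta n ^ (k * conj_order k)))"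
  have c: "c \<noteq> 0" unfolding c_def using nz by simp
  have pc: "(\<Prod>k=1..<?N. [:g k:]) = [:\<Prod>k=1..<?N. g k:]" for g :: "nat \<Rightarrow> complex"
  proof -
    have "(\<Prod>k\<in>A. [:g k:]) = [:\<Prod>k\<in>A. g k:]" for A
      by (induction A rule: infinite_finite_induct) (simp_all add: one_pCons)
    thus ?thesis .
  qed
  have "{..<?N} = insert 0 {1..<?N}" using conj_count_pos[of i] by auto
  hence L1: "by_t (hat (Fs i)) = ?f 0 * (\<Prod>k=1..<?N. ?f k)"
    unfolding hat_Fs[OF i] by_t_prod by simp
  have L2: "leading (\<Prod>k=1..<?N. ?f k) (\<Sum>k=1..<?N. conj_order k) [:c:]"
    unfolding c_def pc[symmetric] by (rule leading_prod) (simp_all only: finite_atLeastLessThan k)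
  have "leading (by_t (hat (Fs i))) (val i) (p0 * [:c:])"
    using leading_mult[OF 0 L2] by (simp only: L1 val_eq_sum[OF i])
  moreover have "p0 * [:c:] = (if i = gen then [:0, c:] else [:s $ cb i * c:])"
    by (simp add: p0_def)
  ultimately show ?thesis using c s_cb[OF i] by (intro exI[of _ "if i = gen then c else s $ cb i * c"]) auto
qed

lemma leading_hat_Fs_0: "leading (by_t (hat (Fs 0))) (val 0) [:1:]"
proof -
  have "by_t [:fps_X ^ n:] $ i = [:fps_X ^ n $ i:]" for i
    by (intro poly_eqI) (simp add: by_t_nth coeff_pCons split: nat.splits)
  thus ?thesis by (auto simp: Fs_0 subst_u_const n_pos leading_def fps_X_power_iff)
qed

end

section \<open>Expansions in powers of the semiroots\<close>

lemma monic_division: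
  fixes H G :: "'a::idom poly"
  assumes "lead_coeff G = 1"
  obtains Q R where "H = G * Q + R" "R = 0 \<or> degree R < degree G"
proof -
  have "G \<noteq> 0" using assms by auto
  from pseudo_divmod[OF this prod.collapse[symmetric], of H] that assms show ?thesis by auto
qed

context branch
begin

text \<open>\<open>char_quot n s i\<close> is coprime to \<open>val i div ce i\<close>. Hence orders
  \<open>\<alpha> * val i + c\<close> with \<open>\<alpha> < char_quot n s i\<close> and
  \<open>ce (i - 1) dvd c\<close> differ for different \<open>\<alpha>\<close>.\<close>

lemma val_multiple_dvd:
  assumes "0 < i" "i \<le> gen" "ce (i - 1) dvd a * val i"
  shows "char_quot n s i dvd a"
proof -
  have q: "ce (i - 1) = char_quot n s i * ce i"
    using assms ce_antimono[of "i - 1" i] by (simp add: char_quot_def)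
  obtain w where w: "val i = w * ce i" using ce_dvd_val[OF assms(2)] by (metis dvd_def mult.commute)
  have "gcd (char_quot n s i * ce i) (w * ce i) = ce i" using gcd_val'[OF assms(1,2)] q w by simp
  hence "ce i * gcd (char_quot n s i) w = ce i * 1"
    by (simp add: gcd_mult_distrib_nat mult.commute)
  hence "coprime (char_quot n s i) w" using ce_pos[of i] by (simp add: coprime_iff_gcd_eq_1)
  moreover have "char_quot n s i dvd a * w"
    using assms(3) ce_pos[of i] unfolding q w by (simp add: mult.assoc[symmetric])
  ultimately show ?thesis using coprime_dvd_mult_left_iff by blast
qed

text \<open>Expansion of \<open>H\<close> in powers of \<open>Fs i\<close> with \<open>q\<close>
  digits of degree below \<open>conj_count i\<close>, one digit being split off per step. The orders
  of different terms lie in different classes modulo \<open>ce (i - 1)\<close>, so they cannot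
  cancel; \<open>\<alpha>\<close> and \<open>c\<close> record the class. For \<open>i = gen\<close>
  the exponent \<open>k\<close> of \<open>u\<close> counts the factors \<open>Fs gen\<close> in the
  term of least order.\<close>

lemma leading_hat_below_step:
  assumes i: "0 < i" "i \<le> gen"
    and IH: "\<And>H. H \<noteq> 0 \<Longrightarrow> degree H < conj_count i \<Longrightarrow>
       \<exists>m \<kappa>. \<kappa> \<noteq> 0 \<and> leading (by_t (hat H)) m [:\<kappa>:] \<and> ce (i - 1) dvd m"
  shows "q \<le> char_quot n s i \<Longrightarrow> H \<noteq> 0 \<Longrightarrow> degree H < q * conj_count i \<Longrightarrow>
    \<exists>m k \<kappa> \<alpha> c. \<kappa> \<noteq> 0 \<and> leading (by_t (hat H)) m (monom \<kappa> k) \<and> \<alpha> < q \<and>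
       m = \<alpha> * val i + c \<and> ce (i - 1) dvd c \<and> (i < gen \<longrightarrow> k = 0)"
proof (induction q arbitrary: H)
  case (Suc q)
  obtain Q R where QR: "H = Fs i * Q + R" "R = 0 \<or> degree R < degree (Fs i)"
    using monic_division[OF lead_Fs[OF i]] by blast
  have R: "R \<noteq> 0 \<Longrightarrow> \<exists>m \<kappa>. \<kappa> \<noteq> 0 \<and> leading (by_t (hat R)) m (monom \<kappa> 0) \<and> ce (i - 1) dvd m"
    using QR(2) IH[of R] degree_Fs[OF i] by (simp add: monom_0)
  have Q: "\<exists>m k \<kappa> \<alpha> c. \<kappa> \<noteq> 0 \<and> leading (by_t (hat (Fs i * Q))) m (monom \<kappa> k) \<and> 0 < \<alpha> \<and> \<alpha> \<le> q \<and>
       m = \<alpha> * val i + c \<and> ce (i - 1) dvd c \<and> (i < gen \<longrightarrow> k = 0)" if Qnz: "Q \<noteq> 0"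
  proof -
    have degQ: "degree Q < q * conj_count i"
    proof (rule ccontr)
      assume "\<not> ?thesis"
      moreover have deg: "degree (Fs i * Q) = conj_count i + degree Q"
        using Qnz lead_Fs[OF i] degree_Fs[OF i] by (subst degree_mult_eq) auto
      moreover have "degree R < degree (Fs i * Q)"
        using QR(2) degree_Fs[OF i] deg conj_count_pos[of i] by auto
      hence "degree H = degree (Fs i * Q)" unfolding QR(1) by (rule degree_add_eq_left)
      ultimately show False using Suc.prems(3) by simp
    qed
    then obtain m k \<kappa> \<alpha> c where IHQ: "\<kappa> \<noteq> 0" "leading (by_t (hat Q)) m (monom \<kappa> k)" "\<alpha> < q"
        "m = \<alpha> * val i + c" "ce (i - 1) dvd c" "i < gen \<longrightarrow> k = 0"
      using Suc.IH[OF Suc_leD[OF Suc.prems(1)] Qnz degQ] by blast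
    obtain b where b: "b \<noteq> 0" "leading (by_t (hat (Fs i))) (val i) (if i = gen then [:0, b:] else [:b:])"
      using leading_hat_Fs[OF i] by blast
    define k' where "k' = (if i = gen then Suc k else k)"
    have "(if i = gen then [:0, b:] else [:b:]) * monom \<kappa> k = monom (b * \<kappa>) k'"
      by (simp add: k'_def monom_Suc smult_monom)
    hence "leading (by_t (hat (Fs i * Q))) (val i + m) (monom (b * \<kappa>) k')"
      using leading_mult[OF b(2) IHQ(2)] by (simp add: subst_u_mult n_pos by_t_mult)
    moreover have "b * \<kappa> \<noteq> 0" "0 < Suc \<alpha>" "Suc \<alpha> \<le> q" "val i + m = Suc \<alpha> * val i + c"
      "i < gen \<longrightarrow> k' = 0"
      using IHQ b by (auto simp: k'_def)
    ultimately show ?thesis using IHQ(5) by blast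
  qed
  show ?case
  proof (cases "Q = 0")
    case True
    hence "H = R" "R \<noteq> 0" using QR Suc.prems by auto
    with R obtain m \<kappa> where "\<kappa> \<noteq> 0" "leading (by_t (hat H)) m (monom \<kappa> 0)" "ce (i - 1) dvd m" by blast
    moreover have "m = 0 * val i + m" "0 < Suc q" by auto
    ultimately show ?thesis by blast
  next
    case False
    from Q[OF this] obtain m k \<kappa> \<alpha> c where 1: "\<kappa> \<noteq> 0"
      "leading (by_t (hat (Fs i * Q))) m (monom \<kappa> k)" "0 < \<alpha>" "\<alpha> \<le> q"
      "m = \<alpha> * val i + c" "ce (i - 1) dvd c" "i < gen \<longrightarrow> k = 0" by blast
    show ?thesis
    proof (cases "R = 0")
      case True
      hence "H = Fs i * Q" using QR by simp
      moreover have "\<alpha> < Suc q" using 1 by simp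
      ultimately show ?thesis using 1 by blast
    next
      case False
      with R obtain m' \<kappa>' where 2: "\<kappa>' \<noteq> 0" "leading (by_t (hat R)) m' (monom \<kappa>' 0)"
        "ce (i - 1) dvd m'" by blast
      have h: "by_t (hat H) = by_t (hat (Fs i * Q)) + by_t (hat R)"
        by (simp add: QR(1) subst_u_add n_pos by_t_add)
      \<comment> \<open>Equality would make \<open>\<alpha> * val i\<close> a multiple of
        \<open>ce (i - 1)\<close> although \<open>0 < \<alpha> < char_quot n s i\<close>.\<close>
      have "m \<noteq> m'"
      proof
        assume "m = m'"
        hence "ce (i - 1) dvd \<alpha> * val i" using 1(5,6) 2(3) by (metis dvd_add_left_iff)
        hence "char_quot n s i dvd \<alpha>" by (rule val_multiple_dvd[OF i])
        thus False using 1(3,4) Suc.prems(1) by (auto dest: dvd_imp_le)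
      qed
      then consider "m < m'" | "m' < m" by linarith
      thus ?thesis
      proof cases
        case a: 1
        have "leading (by_t (hat H)) m (monom \<kappa> k)"
          unfolding h using leading_add[OF 1(2) leading_lower[OF 2(2) a]] by simp
        moreover have "\<alpha> < Suc q" using 1 by simp
        ultimately show ?thesis using 1 by blast
      next
        case a: 2
        have "leading (by_t (hat H)) m' (monom \<kappa>' 0)"
          unfolding h using leading_add[OF leading_lower[OF 1(2) a] 2(2)] by simp
        moreover have "m' = 0 * val i + m'" "0 < Suc q" by auto
        ultimately show ?thesis using 2 by blast
      qed
    qed
  qed
qed simp

lemma conj_count_Suc_gen: "conj_count (Suc gen) = n"
  by (simp add: conj_count_def ce_gen)

text \<open>Repeated expansion through the semiroots of smaller index, none of which shows
  \<open>u\<close> in its leading term. The start is a series in \<open>x\<close> alone, whose order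
  in \<open>t\<close> is a multiple of \<open>n\<close>.\<close>

lemma leading_hat_below:
  "0 < i \<Longrightarrow> i \<le> gen \<Longrightarrow> H \<noteq> 0 \<Longrightarrow> degree H < conj_count i \<Longrightarrow>
     \<exists>m \<kappa>. \<kappa> \<noteq> 0 \<and> leading (by_t (hat H)) m [:\<kappa>:] \<and> ce (i - 1) dvd m"
proof (induction i arbitrary: H)
  case (Suc i)
  show ?case
  proof (cases "i = 0")
    case True
    hence "degree H = 0" using Suc.prems(4) by simp
    then obtain a where a: "H = [:a:]" by (rule degree_eq_zeroE)
    have anz: "a \<noteq> 0" using Suc.prems(3) a by simp
    have "by_t [:b:] $ j = [:b $ j:]" for b j
      by (intro poly_eqI) (simp add: by_t_nth coeff_pCons split: nat.splits)
    moreover have "a $ (j div n) = 0" if "j < n * subdegree a" for j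
      using that n_pos by (intro nth_less_subdegree_zero) (simp add: div_less_iff_less_mult mult.commute)
    ultimately have "leading (by_t (hat H)) (n * subdegree a) [:a $ subdegree a:]"
      using n_pos by (auto simp: a subst_u_const leading_def fps_nth_compose_X_power)
    moreover have "ce (Suc i - 1) dvd n * subdegree a" using ce_dvd_n by simp
    moreover have "a $ subdegree a \<noteq> 0" using anz by simp
    ultimately show ?thesis by blast
  next
    case False
    hence i: "0 < i" "i \<le> gen" "i < gen" using Suc.prems by auto
    have "degree H < char_quot n s i * conj_count i"
      using Suc.prems conj_count_Suc[OF i(1)] by simp
    from leading_hat_below_step[OF i(1,2) Suc.IH[OF i(1,2)] order_refl Suc.prems(3) this]
    obtain m k \<kappa> \<alpha> c where *: "\<kappa> \<noteq> 0" "leading (by_t (hat H)) m (monom \<kappa> k)"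
       "m = \<alpha> * val i + c" "ce (i - 1) dvd c" "k = 0" using i by blast
    have "ce i dvd m" unfolding *(3)
      using ce_dvd_val[OF i(2)] dvd_trans[OF ce_antimono *(4), of i] by simp
    thus ?thesis using * by (metis diff_Suc_1 monom_0)
  qed
qed simp

theorem leading_hat:
  assumes "H \<noteq> 0" "degree H < n"
  shows "\<exists>m k \<kappa>. \<kappa> \<noteq> 0 \<and> leading (by_t (hat H)) m (monom \<kappa> k)"
proof -
  have "degree H < char_quot n s gen * conj_count gen"
    using assms conj_count_Suc[OF gen_pos] conj_count_Suc_gen by simp
  from leading_hat_below_step[OF gen_pos order_refl leading_hat_below[OF gen_pos order_refl]
      order_refl assms(1) this] show ?thesis by blast
qed

end

section \<open>Blowing up the family of branches\<close>

text \<open>With a unit as leading coefficient the order survives specialization of the parameters,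
  and division by \<open>f\<close> is possible. Units are the nonzero constants in
  \<open>\<complex>[u]\<close> and the series with nonzero constant term in
  \<open>\<complex>[[w]]\<close>.\<close>

definition unit_leading :: "'a::comm_ring_1 fps \<Rightarrow> nat \<Rightarrow> bool" where
  "unit_leading f m \<longleftrightarrow> (\<exists>p. leading f m p \<and> p dvd 1)"

text \<open>
  A blow-up step for families of branches: the coefficient ring may contain parameters, and
  \<open>\<kappa>\<close> is the embedding of the constants.
\<close>

definition bstep :: "(complex \<Rightarrow> 'a::comm_ring_1) \<Rightarrow> direction \<Rightarrow> 'a fps \<times> 'a fps \<Rightarrow> 'a fps \<times> 'a fps \<Rightarrow> bool" where
  "bstep \<kappa> d x y \<longleftrightarrow>
     (\<exists>a>0. unit_leading (fst x) a) \<and> (\<exists>b>0. unit_leading (snd x) b) \<and>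
     (case d of
        Some c \<Rightarrow> fst x = fst y \<and> snd x = fst y * (snd y + fps_const (\<kappa> c)) \<and> snd y $ 0 = 0
      | None \<Rightarrow> snd x = snd y \<and> fst x = fst y * snd y \<and> fst y $ 0 = 0)"

definition blowup_run :: "(complex \<Rightarrow> 'a::comm_ring_1) \<Rightarrow> nat \<Rightarrow> (nat \<Rightarrow> direction) \<Rightarrow>
    (nat \<Rightarrow> 'a fps \<times> 'a fps) \<Rightarrow> bool" where
  "blowup_run \<kappa> K dir \<Psi> \<longleftrightarrow> (\<forall>k<K. bstep \<kappa> (dir k) (\<Psi> k) (\<Psi> (Suc k)))"

lemma blowup_run_Cons:
  "bstep \<kappa> d x (\<Psi> 0) \<Longrightarrow> blowup_run \<kappa> K dir \<Psi> \<Longrightarrow>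
     blowup_run \<kappa> (Suc K) (case_nat d dir) (case_nat x \<Psi>)"
  by (auto simp: blowup_run_def split: nat.splits)

lemma leading_quotient:
  fixes P Q :: "'a::comm_ring_1 fps"
  assumes "leading P a p" "p dvd 1" "leading Q b q" "a \<le> b"
  shows "\<exists>Q' q'. Q = P * Q' \<and> leading Q' (b - a) q' \<and> p * q' = q"
proof -
  obtain P' where P: "P = fps_X ^ a * P'" "P' $ 0 = p" using assms(1) by (auto simp: leading_iff)
  obtain Q'' where Q: "Q = fps_X ^ b * Q''" "Q'' $ 0 = q" using assms(3) by (auto simp: leading_iff)
  obtain y where y: "1 = p * y" using assms(2) by (rule dvdE)
  define I where "I = fps_right_inverse P' y"
  have I: "P' * I = 1" unfolding I_def by (rule fps_right_inverse) (simp add: P y)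
  have "p * I $ 0 = 1" using arg_cong[OF I, of "\<lambda>f. f $ 0"] P by simp
  hence I0: "p * (q * I $ 0) = q" by (metis mult.left_commute mult.right_neutral)
  have "Q = P * (fps_X ^ (b - a) * (Q'' * I))"
  proof -
    have "P * (fps_X ^ (b - a) * (Q'' * I)) = fps_X ^ a * fps_X ^ (b - a) * Q'' * (P' * I)"
      by (simp add: P mult_ac)
    also have "\<dots> = Q" using assms(4) by (simp add: I Q flip: power_add)
    finally show ?thesis by simp
  qed
  moreover have "leading (fps_X ^ (b - a) * (Q'' * I)) (b - a) (q * I $ 0)"
    unfolding leading_iff using Q by auto
  ultimately show ?thesis using I0 by blast
qed

lemma leading_cancel:
  fixes P g :: "'a::idom fps"
  assumes "leading P a p" "p \<noteq> 0" "leading (P * g) d r" "r \<noteq> 0"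
  shows "a \<le> d" "\<exists>r'. leading g (d - a) r' \<and> p * r' = r"
proof -
  have g: "g \<noteq> 0" using assms(3,4) by (auto simp: leading_def)
  from leading_mult[OF assms(1) leading_of_nz[OF g]]
  have l: "leading (P * g) (a + subdegree g) (p * g $ subdegree g)" .
  have nz: "p * g $ subdegree g \<noteq> 0" using g assms(2) by simp
  have d: "d = a + subdegree g" by (rule leading_unique[OF assms(3) l assms(4) nz])
  thus "a \<le> d" by simp
  have "p * g $ subdegree g = r" using l assms(3) d by (simp add: leading_def)
  thus "\<exists>r'. leading g (d - a) r' \<and> p * r' = r"
    using leading_of_nz[OF g] d by auto
qed

section \<open>The Jacobian of the family before the parameter enters\<close>

lemma pderiv_sum: "pderiv (sum f A) = (\<Sum>x\<in>A. pderiv (f x))"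
  by (induction A rule: infinite_finite_induct) (simp_all add: pderiv_add)

lemma pd_u_mult: "pd_u (f * g) = pd_u f * g + f * pd_u g"
  by (intro fps_ext)
     (simp add: fps_mult_nth pderiv_sum pderiv_mult sum.distrib mult.commute[of "pderiv _"] add.commute)

lemma pd_u_add: "pd_u (f + g) = pd_u f + pd_u g"
  by (intro fps_ext) (simp add: pderiv_add)

lemma pd_u_const [simp]: "pd_u (fps_const [:c:]) = 0"
  by (intro fps_ext) simp

definition jac :: "complex poly fps \<Rightarrow> complex poly fps \<Rightarrow> complex poly fps" where
  "jac P Q = fps_deriv P * pd_u Q - pd_u P * fps_deriv Q"

lemma jac_swap: "jac Q P = - jac P Q"
  by (simp add: jac_def mult.commute)

text \<open>The Jacobian determinant of a blow-up chart is its exceptional coordinate.\<close>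

lemma jac_blowup: "jac P (P * (Q + fps_const [:c:])) = P * jac P Q"
  by (simp add: jac_def pd_u_mult pd_u_add algebra_simps)

definition at_u0 :: "complex poly fps \<Rightarrow> complex fps" where
  "at_u0 f = Abs_fps (\<lambda>i. coeff (f $ i) 0)"

lemma at_u0_nth [simp]: "at_u0 f $ i = coeff (f $ i) 0"
  by (simp add: at_u0_def)

lemma at_u0_mult: "at_u0 (f * g) = at_u0 f * at_u0 g"
  by (intro fps_ext) (simp add: fps_mult_nth coeff_sum coeff_mult_0)

lemma at_u0_diff: "at_u0 (f - g) = at_u0 f - at_u0 g"
  by (intro fps_ext) simp

inductive_set alg :: "complex poly fps \<Rightarrow> complex poly fps \<Rightarrow> complex poly fps set"
  for P Q where
  const: "fps_const [:c:] \<in> alg P Q"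
| gen1: "P \<in> alg P Q"
| gen2: "Q \<in> alg P Q"
| add: "f \<in> alg P Q \<Longrightarrow> g \<in> alg P Q \<Longrightarrow> f + g \<in> alg P Q"
| mult: "f \<in> alg P Q \<Longrightarrow> g \<in> alg P Q \<Longrightarrow> f * g \<in> alg P Q"

lemma alg_trans:
  assumes "f \<in> alg P Q" "P \<in> alg P' Q'" "Q \<in> alg P' Q'"
  shows "f \<in> alg P' Q'"
  using assms(1) by induction (auto intro: alg.intros assms)

text \<open>Stated as invariance under a rotation, the property passes to quotients by mere
  cancellation.\<close>

definition u_invariant :: "nat \<Rightarrow> complex poly fps \<Rightarrow> bool" where
  "u_invariant e f \<longleftrightarrow> rot (zeta e) (at_u0 f) = at_u0 f"

lemma u_invariant_dvd:
  assumes "e > 0" "u_invariant e f" "coeff (f $ m) 0 \<noteq> 0"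
  shows "e dvd m"
  using assms unfolding u_invariant_def rot_invariant_iff[OF assms(1)] by auto

lemma u_invariant_cancel:
  assumes "u_invariant e P" "u_invariant e (P * Q)" "at_u0 P \<noteq> 0"
  shows "u_invariant e Q"
  using assms by (simp add: u_invariant_def at_u0_mult rot_mult)

lemma rot_const: "rot z (fps_const c) = fps_const c"
  by (rule fps_ext) (simp add: rot_nth)

lemma u_invariant_diff_const: "u_invariant e Q \<Longrightarrow> u_invariant e (Q - fps_const [:c:])"
proof -
  have "at_u0 (fps_const [:c:]) = fps_const c" by (intro fps_ext) simp
  moreover have "rot z (f - g) = rot z f - rot z g" for z f g
    using rot_add[of z f "- g"] by (simp add: rot_uminus)
  ultimately show "u_invariant e Q \<Longrightarrow> ?thesis"
    by (simp add: u_invariant_def at_u0_diff rot_const)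
qed

text \<open>
  Before the leading coefficients depend on \<open>u\<close>, the Jacobian has higher order than the leading
  terms of the coordinates suggest. The specialization \<open>u = 0\<close> is a series in \<open>t\<^sup>e\<close>.
\<close>

definition preterminal :: "nat \<Rightarrow> nat \<Rightarrow> complex poly fps \<Rightarrow> complex poly fps \<Rightarrow> bool" where
  "preterminal e d P Q \<longleftrightarrow> (\<exists>a b p q j. a > 0 \<and> b > 0 \<and>
     leading P a [:p:] \<and> p \<noteq> 0 \<and> leading Q b [:q:] \<and> q \<noteq> 0 \<and>
     leading (jac P Q) d [:j:] \<and> j \<noteq> 0 \<and> a + b \<le> d \<and> \<not> e dvd Suc d \<and>
     u_invariant e P \<and> u_invariant e Q)"

text \<open>For \<open>e > 1\<close> the divisibility gives \<open>a > 1\<close>: the first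
  coordinate still has order above 1 when \<open>u\<close> enters.\<close>

definition terminal :: "nat \<Rightarrow> complex poly fps \<Rightarrow> complex poly fps \<Rightarrow> bool" where
  "terminal e P Q \<longleftrightarrow> (\<exists>a b p q. a > 0 \<and> b > 0 \<and> e dvd a \<and>
     leading P a [:p:] \<and> p \<noteq> 0 \<and> leading Q b [:0, q:] \<and> q \<noteq> 0)"

lemma preterminal_swap: "preterminal e d P Q \<Longrightarrow> preterminal e d Q P"
proof -
  assume "preterminal e d P Q"
  then obtain a b p q j where *: "a > 0" "b > 0" "leading P a [:p:]" "p \<noteq> 0" "leading Q b [:q:]" "q \<noteq> 0"
     "leading (jac P Q) d [:j:]" "j \<noteq> 0" "a + b \<le> d" "\<not> e dvd Suc d" "u_invariant e P" "u_invariant e Q"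
    unfolding preterminal_def by blast
  have "leading (jac Q P) d [:- j:]" using leading_diff[OF leading_0 *(7)] by (simp add: jac_swap[of Q P])
  thus ?thesis unfolding preterminal_def using *
    by (metis add.commute neg_equal_0_iff_equal)
qed

lemma const_poly_unit: "p \<noteq> 0 \<Longrightarrow> [:p :: complex:] dvd 1"
  by (simp add: is_unit_pCons_iff)

lemma const_poly_mult_eq: "p \<noteq> 0 \<Longrightarrow> [:p:] * r = [:q:] \<Longrightarrow> r = [:q / p :: complex:]"
proof -
  assume "p \<noteq> 0" "[:p:] * r = [:q:]"
  hence "smult p r = smult p [:q / p:]" by simp
  thus ?thesis using \<open>p \<noteq> 0\<close> by (metis smult_cancel)
qed

text \<open>By invariance \<open>a\<close> is a multiple of \<open>e\<close>, so division by
  \<open>P\<close> changes the order of the Jacobian by a multiple of \<open>e\<close> and keeps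
  \<open>\<not> e dvd Suc d\<close>. In \<open>a + b \<le> d\<close> both sides lose
  \<open>a\<close>.\<close>

lemma preterminal_less:
  assumes e: "e > 0" and lP: "leading P a [:p:]" "p \<noteq> 0" "a > 0"
    and lQ: "leading Q b [:q:]" "q \<noteq> 0" and J: "leading (jac P Q) d [:j:]" "j \<noteq> 0"
    and d: "a + b \<le> d" "\<not> e dvd Suc d" and inv: "u_invariant e P" "u_invariant e Q" and "a < b"
  shows "\<exists>Q'. Q = P * Q' \<and> preterminal e (d - a) P Q'"
proof -
  obtain Q' q' where Q': "Q = P * Q'" "leading Q' (b - a) q'" "[:p:] * q' = [:q:]"
    using leading_quotient[OF lP(1) const_poly_unit[OF lP(2)] lQ(1)] \<open>a < b\<close> by auto
  have q': "q' = [:q / p:]" by (rule const_poly_mult_eq[OF lP(2) Q'(3)])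
  have "jac P Q = P * jac P Q'" using jac_blowup[of P Q' 0] Q' by simp
  hence "leading (P * jac P Q') d [:j:]" using J by simp
  from leading_cancel[OF lP(1) _ this] lP(2) J(2)
  obtain r' where r': "leading (jac P Q') (d - a) r'" "[:p:] * r' = [:j:]" by auto
  have "r' = [:j / p:]" by (rule const_poly_mult_eq[OF lP(2) r'(2)])
  have ea: "e dvd a" using u_invariant_dvd[OF e inv(1), of a] lP by (simp add: leading_def)
  have "Suc d = Suc (d - a) + a" using d by simp
  hence nd: "\<not> e dvd Suc (d - a)" using d ea by (metis dvd_add)
  have "at_u0 P \<noteq> 0"
  proof
    assume "at_u0 P = 0"
    hence "at_u0 P $ a = 0" by simp
    thus False using lP by (simp add: leading_def)
  qed
  hence inv': "u_invariant e Q'" using u_invariant_cancel[OF inv(1)] inv(2) Q' by simp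
  have "preterminal e (d - a) P Q'"
    unfolding preterminal_def
    by (rule exI[where x = a], rule exI[where x = "b - a"], rule exI[where x = p],
        rule exI[where x = "q / p"], rule exI[where x = "j / p"])
       (use lP lQ J(2) Q'(2) q' r' \<open>r' = [:j / p:]\<close> d inv \<open>a < b\<close> nd inv' in auto)
  thus ?thesis using Q' by blast
qed

text \<open>
  The Jacobian detects whether the leading coefficient of the new coordinate depends on \<open>u\<close>, and
  its order modulo \<open>e\<close> forbids a constant term.
\<close>

lemma preterminal_equal:
  assumes e: "e > 0" and lP: "leading P a [:p:]" "p \<noteq> 0" "a > 0"
    and lQ: "leading Q a [:q:]" "q \<noteq> 0" and J: "leading (jac P Q) d [:j:]" "j \<noteq> 0"
    and d: "\<not> e dvd Suc d" and inv: "u_invariant e P" "u_invariant e Q"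
  shows "\<exists>Q' c. Q = P * (Q' + fps_const [:c:]) \<and> Q' $ 0 = 0 \<and> (preterminal e (d - a) P Q' \<or> terminal e P Q')"
proof -
  obtain Q1 q' where Q1: "Q = P * Q1" "leading Q1 0 q'" "[:p:] * q' = [:q:]"
    using leading_quotient[OF lP(1) const_poly_unit[OF lP(2)] lQ(1)] by auto
  define c where "c = q / p"
  have q': "q' = [:c:]" unfolding c_def by (rule const_poly_mult_eq[OF lP(2) Q1(3)])
  define Q' where "Q' = Q1 - fps_const [:c:]"
  have Q: "Q = P * (Q' + fps_const [:c:])" by (simp add: Q'_def Q1)
  have Q'0: "Q' $ 0 = 0" using Q1 q' by (simp add: Q'_def leading_def)
  have "leading (P * jac P Q') d [:j:]" using J(1) unfolding Q jac_blowup .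
  from leading_cancel[OF lP(1) _ this] lP(2) J(2)
  obtain r' where r': "leading (jac P Q') (d - a) r'" "[:p:] * r' = [:j:]" and ad: "a \<le> d" by auto
  define j' where "j' = j / p"
  have "r' = [:j':]" unfolding j'_def by (rule const_poly_mult_eq[OF lP(2) r'(2)])
  hence J': "leading (jac P Q') (d - a) [:j':]" "j' \<noteq> 0" using r' J lP by (auto simp: j'_def)
  have Q'nz: "Q' \<noteq> 0"
  proof
    assume "Q' = 0"
    hence "jac P Q' = 0" by (simp add: jac_def pd_u_def fps_zero_def[symmetric])
    thus False using J' by (simp add: leading_def)
  qed
  define b r where "b = subdegree Q'" and "r = Q' $ b"
  have lQ': "leading Q' b r" "r \<noteq> 0" using leading_of_nz[OF Q'nz] Q'nz by (simp_all add: b_def r_def)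
  have b: "b > 0" using Q'0 lQ' by (cases b) (auto simp: leading_def)
  \<comment> \<open>The leading coefficient of \<open>P\<close> is constant in \<open>u\<close>, so
    the second product in the Jacobian contributes nothing in this order.\<close>
  have "leading (jac P Q') (a - 1 + b) (of_nat a * [:p:] * pderiv r - 0)"
    unfolding jac_def
  proof (rule leading_diff)
    show "leading (fps_deriv P * pd_u Q') (a - 1 + b) (of_nat a * [:p:] * pderiv r)"
      using leading_mult[OF leading_deriv'[OF lP(1,3)] leading_pd_u[OF lQ'(1)]] .
    have "leading (pd_u P * fps_deriv Q') (a + (b - 1)) (pderiv [:p:] * (of_nat b * r))"
      by (rule leading_mult[OF leading_pd_u[OF lP(1)] leading_deriv'[OF lQ'(1) b]])
    moreover have "a + (b - 1) = a - 1 + b" using lP b by simp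
    ultimately show "leading (pd_u P * fps_deriv Q') (a - 1 + b) 0" by simp
  qed
  hence Jc: "leading (jac P Q') (a - 1 + b) (smult (of_nat a * p) (pderiv r))"
    by (simp add: of_nat_poly mult.commute)
  have le: "a - 1 + b \<le> d - a"
  proof (rule ccontr)
    assume "\<not> ?thesis"
    hence "jac P Q' $ (d - a) = 0" using Jc by (simp add: leading_def)
    thus False using J' by (simp add: leading_def)
  qed
  have ap: "of_nat a * p \<noteq> 0" using lP by simp
  have ea: "e dvd a" using u_invariant_dvd[OF e inv(1), of a] lP by (simp add: leading_def)
  have "Suc d = Suc (d - a) + a" using ad by simp
  hence nd: "\<not> e dvd Suc (d - a)" using d ea by (metis dvd_add)
  have "at_u0 P \<noteq> 0"
  proof
    assume "at_u0 P = 0"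
    hence "at_u0 P $ a = 0" by simp
    thus False using lP by (simp add: leading_def)
  qed
  hence "u_invariant e Q1" using u_invariant_cancel[OF inv(1)] inv(2) Q1 by simp
  hence inv': "u_invariant e Q'" unfolding Q'_def by (rule u_invariant_diff_const)
  have "preterminal e (d - a) P Q' \<or> terminal e P Q'"
  proof (cases "a - 1 + b = d - a")
    case True
    hence "smult (of_nat a * p) (pderiv r) = [:j':]" using Jc J' by (simp add: leading_def)
    hence dr: "pderiv r = [:j' / (of_nat a * p):]"
      using const_poly_mult_eq[OF ap, of "pderiv r" j'] by simp
    have "degree r = 1"
    proof -
      have "degree (pderiv r) = 0" "pderiv r \<noteq> 0" using dr J'(2) ap by auto
      thus ?thesis using degree_pderiv[of r] pderiv_eq_0_iff[of r] by linarith
    qed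
    then obtain r0 r1 where r01: "r = [:r0, r1:]" "r1 \<noteq> 0"
      by (metis degree_eq_zeroE degree_pCons_0 degree_pCons_eq_if one_neq_zero pCons_cases pCons_eq_0_iff nat.inject One_nat_def)
    have "r0 = 0"
    proof (rule ccontr)
      assume "r0 \<noteq> 0"
      hence "e dvd b" using u_invariant_dvd[OF e inv', of b] lQ' r01 by (simp add: leading_def)
      hence "e dvd a + b" using ea by simp
      moreover have "Suc (d - a) = a + b" using True lP by simp
      ultimately show False using nd by simp
    qed
    hence "terminal e P Q'" unfolding terminal_def using lP lQ' r01 b ea by blast
    thus ?thesis ..
  next
    case False
    hence "a - 1 + b < d - a" using le by simp
    hence "smult (of_nat a * p) (pderiv r) = 0" using Jc J' by (simp add: leading_def)
    hence "pderiv r = 0" using ap by simp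
    hence "degree r = 0" by (simp add: pderiv_eq_0_iff)
    then obtain r0 where "r = [:r0:]" by (rule degree_eq_zeroE)
    moreover from this have "r0 \<noteq> 0" using lQ' by simp
    moreover have "a + b \<le> d - a" using \<open>a - 1 + b < d - a\<close> by simp
    ultimately have "preterminal e (d - a) P Q'"
      unfolding preterminal_def using lP lQ' b J' nd inv inv' by blast
    thus ?thesis ..
  qed
  thus ?thesis using Q Q'0 by blast
qed

text \<open>The order of the Jacobian drops in every case, so the process ends, and it can only end
  in a terminal state. The order of the first coordinate is a multiple of \<open>e > 1\<close>; its
  being above 1 later excludes normal crossings.\<close>

lemma preterminal_step:
  assumes e: "e > 1" and pre: "preterminal e d P Q"
  shows "\<exists>dir P' Q'. bstep (\<lambda>c. [:c:]) dir (P, Q) (P', Q') \<and>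
     P $ 1 = 0 \<and> P \<in> alg P' Q' \<and> Q \<in> alg P' Q' \<and>
     ((\<exists>d'<d. preterminal e d' P' Q') \<or> terminal e P' Q')"
proof -
  from pre obtain a b p q j where *: "a > 0" "b > 0" "leading P a [:p:]" "p \<noteq> 0" "leading Q b [:q:]" "q \<noteq> 0"
     "leading (jac P Q) d [:j:]" "j \<noteq> 0" "a + b \<le> d" "\<not> e dvd Suc d" "u_invariant e P" "u_invariant e Q"
    unfolding preterminal_def by blast
  have e0: "e > 0" using e by simp
  have "e dvd a" using u_invariant_dvd[OF e0 *(11), of a] * by (auto simp: leading_def)
  hence "a > 1" using e *(1) by (auto dest!: dvd_imp_le)
  hence low: "P $ 1 = 0" using * by (simp add: leading_def)
  have ul: "\<exists>a>0. unit_leading P a" "\<exists>b>0. unit_leading Q b"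
    unfolding unit_leading_def using * const_poly_unit by blast+
  consider "a < b" | "b < a" | "a = b" by linarith
  thus ?thesis
  proof cases
    case 1
    from preterminal_less[OF e0 *(3,4,1,5-12) 1] obtain Q' where
      Q': "Q = P * Q'" "preterminal e (d - a) P Q'" by blast
    have "Q' $ 0 = 0" using Q'(2) unfolding preterminal_def leading_def by auto
    hence "bstep (\<lambda>c. [:c:]) (Some 0) (P, Q) (P, Q')" unfolding bstep_def using ul Q' by simp
    moreover have "P \<in> alg P Q'" "Q \<in> alg P Q'" unfolding Q'(1) by (auto intro: alg.intros)
    moreover have "d - a < d" using * by simp
    ultimately show ?thesis using low Q'(2) by blast
  next
    case 2
    from preterminal_swap[OF pre] have pre': "preterminal e d Q P" .
    have Jsw: "leading (jac Q P) d [:- j:]"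
      using leading_diff[OF leading_0 *(7)] by (simp add: jac_swap[of Q P])
    have "- j \<noteq> 0" "b + a \<le> d" using * by auto
    from preterminal_less[OF e0 *(5,6,2,3,4) Jsw this *(10,12,11) 2] obtain P' where
      P': "P = Q * P'" "preterminal e (d - b) Q P'" by blast
    have "P' $ 0 = 0" using P'(2) unfolding preterminal_def leading_def by auto
    hence "bstep (\<lambda>c. [:c:]) None (P, Q) (P', Q)"
      unfolding bstep_def using ul P' by (simp add: mult.commute)
    moreover have "P \<in> alg P' Q" "Q \<in> alg P' Q" unfolding P'(1) by (auto intro: alg.intros)
    moreover have "d - b < d" using * by simp
    ultimately show ?thesis using low preterminal_swap[OF P'(2)] by blast
  next
    case 3
    from preterminal_equal[OF e0 *(3,4,1) *(5)[folded 3] *(6-8,10-12)] obtain Q' c where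
      Q': "Q = P * (Q' + fps_const [:c:])" "Q' $ 0 = 0" "preterminal e (d - a) P Q' \<or> terminal e P Q'"
      by blast
    have "bstep (\<lambda>c. [:c:]) (Some c) (P, Q) (P, Q')" unfolding bstep_def using ul Q' by simp
    moreover have "P \<in> alg P Q'" "Q \<in> alg P Q'" unfolding Q'(1) by (auto intro: alg.intros)
    moreover have "d - a < d" using * by simp
    ultimately show ?thesis using low Q'(3) by blast
  qed
qed

text \<open>The last two conditions hold because the charts are polynomial maps; they express
  polynomials in the initial coordinates by the terminal ones, where orders are understood.\<close>

definition terminal_run :: "nat \<Rightarrow> complex poly fps \<Rightarrow> complex poly fps \<Rightarrow> nat \<Rightarrow> (nat \<Rightarrow> direction) \<Rightarrow>
    (nat \<Rightarrow> complex poly fps \<times> complex poly fps) \<Rightarrow> bool" where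
  "terminal_run e P Q K dir \<Psi> \<longleftrightarrow> \<Psi> 0 = (P, Q) \<and> blowup_run (\<lambda>c. [:c:]) K dir \<Psi> \<and>
     (\<forall>k<K. fst (\<Psi> k) $ 1 = 0) \<and> terminal e (fst (\<Psi> K)) (snd (\<Psi> K)) \<and>
     P \<in> alg (fst (\<Psi> K)) (snd (\<Psi> K)) \<and> Q \<in> alg (fst (\<Psi> K)) (snd (\<Psi> K))"

lemma terminal_run_0: "terminal e P Q \<Longrightarrow> terminal_run e P Q 0 dir (\<lambda>_. (P, Q))"
  by (auto simp: terminal_run_def blowup_run_def intro: alg.intros)

theorem preterminal_run:
  assumes e: "e > 1" and pre: "preterminal e d P Q"
  shows "\<exists>K dir \<Psi>. terminal_run e P Q K dir \<Psi>"
  using pre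
proof (induction d arbitrary: P Q rule: less_induct)
  case (less d)
  from preterminal_step[OF e less.prems] obtain d0 P' Q' where
    st: "bstep (\<lambda>c. [:c:]) d0 (P, Q) (P', Q')" "P $ 1 = 0"
    "P \<in> alg P' Q'" "Q \<in> alg P' Q'" "(\<exists>d'<d. preterminal e d' P' Q') \<or> terminal e P' Q'" by blast
  then obtain K dir \<Psi> where IH: "terminal_run e P' Q' K dir \<Psi>"
    using less.IH terminal_run_0 by blast
  hence "terminal_run e P Q (Suc K) (case_nat d0 dir) (case_nat (P, Q) \<Psi>)"
    using st blowup_run_Cons[of "\<lambda>c. [:c:]" d0 "(P, Q)" \<Psi> K dir]
    by (auto simp: terminal_run_def split: nat.splits intro: alg_trans)
  thus ?case by blast
qed

section \<open>Orders of polynomials in the terminal coordinates\<close>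

definition eval_alg :: "complex poly fps \<Rightarrow> complex poly fps \<Rightarrow> complex poly poly \<Rightarrow> complex poly fps" where
  "eval_alg P Q g = poly (map_poly (\<lambda>h. poly (map_poly (\<lambda>c. fps_const [:c:]) h) P) g) Q"

lemma eval_inner_hom:
  "poly (map_poly (\<lambda>c. fps_const [:c :: complex:]) (h + h')) P =
     poly (map_poly (\<lambda>c. fps_const [:c:]) h) P + poly (map_poly (\<lambda>c. fps_const [:c:]) h') P"
  "poly (map_poly (\<lambda>c. fps_const [:c :: complex:]) (h * h')) P =
     poly (map_poly (\<lambda>c. fps_const [:c:]) h) P * poly (map_poly (\<lambda>c. fps_const [:c:]) h') P"
  by (simp_all add: map_poly_hom_add map_poly_hom_mult)

lemma eval_alg_add: "eval_alg P Q (g + h) = eval_alg P Q g + eval_alg P Q h"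
  unfolding eval_alg_def by (subst map_poly_hom_add) (simp_all only: eval_inner_hom poly_add map_poly_0 poly_0)

lemma eval_alg_mult: "eval_alg P Q (g * h) = eval_alg P Q g * eval_alg P Q h"
  unfolding eval_alg_def by (subst map_poly_hom_mult) (simp_all only: eval_inner_hom poly_mult map_poly_0 poly_0)

lemma alg_eval: "f \<in> alg P Q \<Longrightarrow> \<exists>g. f = eval_alg P Q g"
proof (induction rule: alg.induct)
  case (const c)
  have "fps_const [:c:] = eval_alg P Q [:[:c:]:]" by (simp add: eval_alg_def map_poly_pCons)
  thus ?case by blast
next
  case gen1
  have "P = eval_alg P Q [:[:0, 1:]:]" by (simp add: eval_alg_def map_poly_pCons one_pCons[symmetric])
  thus ?case by blast
next
  case gen2
  have "Q = eval_alg P Q [:0, 1:]" by (simp add: eval_alg_def map_poly_pCons one_pCons[symmetric])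
  thus ?case by blast
qed (metis eval_alg_add eval_alg_mult)+

lemma poly_sum_bound:
  fixes p :: "'a::comm_ring_1 poly"
  assumes "degree p \<le> N" shows "poly p x = (\<Sum>i\<le>N. coeff p i * x ^ i)"
proof -
  have "(\<Sum>i\<le>N. coeff p i * x ^ i) = (\<Sum>i\<le>degree p. coeff p i * x ^ i)"
    using assms by (intro sum.mono_neutral_right) (auto simp: coeff_eq_0)
  thus ?thesis by (simp add: poly_altdef)
qed

lemma eval_alg_sum:
  assumes "degree g \<le> N" "\<And>l. degree (coeff g l) \<le> N"
  shows "eval_alg P Q g =
    (\<Sum>(l, i)\<in>{(l, i). l \<le> N \<and> i \<le> N \<and> coeff (coeff g l) i \<noteq> 0}. fps_const [:coeff (coeff g l) i:] * (P ^ i * Q ^ l))"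
proof -
  have inner: "poly (map_poly (\<lambda>c. fps_const [:c:]) h) P = (\<Sum>i\<le>N. fps_const [:coeff h i:] * P ^ i)"
    if "degree h \<le> N" for h :: "complex poly"
    using poly_sum_bound[OF order_trans[OF map_poly_degree_leq that], of "\<lambda>c. fps_const [:c:]" P]
    by (simp add: coeff_map_poly)
  have "eval_alg P Q g = (\<Sum>l\<le>N. (\<Sum>i\<le>N. fps_const [:coeff (coeff g l) i:] * P ^ i) * Q ^ l)"
    unfolding eval_alg_def
    using order_trans[OF map_poly_degree_leq assms(1)]
    by (subst poly_sum_bound[where N = N]) (auto simp: coeff_map_poly inner assms)
  also have "\<dots> = (\<Sum>(l, i)\<in>{..N}\<times>{..N}. fps_const [:coeff (coeff g l) i:] * (P ^ i * Q ^ l))"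
    by (simp add: sum_distrib_right sum.cartesian_product mult.assoc)
  also have "\<dots> = (\<Sum>(l, i)\<in>{(l, i). l \<le> N \<and> i \<le> N \<and> coeff (coeff g l) i \<noteq> 0}.
      fps_const [:coeff (coeff g l) i:] * (P ^ i * Q ^ l))"
    by (intro sum.mono_neutral_right) (auto intro: finite_subset[of _ "{..N}\<times>{..N}"])
  finally show ?thesis .
qed

text \<open>
  The leading form of an element of the algebra is quasi-homogeneous, and its terms have distinct
  powers of \<open>u\<close>, so they cannot cancel.
\<close>

lemma alg_order_dvd:
  assumes P: "leading P a [:p:]" "p \<noteq> 0" "a > 0" and Q: "leading Q b [:0, q:]" "q \<noteq> 0"
    and f: "f \<in> alg P Q" "leading f m c" "c \<noteq> 0"
  shows "gcd a b dvd m"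
proof -
  obtain g where g: "f = eval_alg P Q g" using alg_eval[OF f(1)] by blast
  define N where "N = degree g + (\<Sum>l\<le>degree g. degree (coeff g l))"
  have N: "degree g \<le> N" "degree (coeff g l) \<le> N" for l
  proof -
    show "degree (coeff g l) \<le> N"
    proof (cases "l \<le> degree g")
      case True
      have "degree (coeff g l) \<le> (\<Sum>l\<le>degree g. degree (coeff g l))"
        by (rule member_le_sum) (use True in auto)
      thus ?thesis by (simp add: N_def)
    qed (simp add: coeff_eq_0)
  qed (simp add: N_def)
  define A where "A = {(l, i). l \<le> N \<and> i \<le> N \<and> coeff (coeff g l) i \<noteq> 0}"
  define T where "T = (\<lambda>(l, i). fps_const [:coeff (coeff g l) i:] * (P ^ i * Q ^ l))"
  define w where "w = (\<lambda>(l, i). i * a + l * b)"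
  define z where "z = (\<lambda>(l, i). [:coeff (coeff g l) i:] * ([:p:] ^ i * [:0, q:] ^ l))"
  have fin: "finite A" unfolding A_def by (rule finite_subset[of _ "{..N}\<times>{..N}"]) auto
  have fs: "f = (\<Sum>x\<in>A. T x)" unfolding g eval_alg_sum[OF N] A_def T_def ..
  have lead: "leading (T x) (w x) (z x)" for x
  proof -
    have c: "leading (fps_const k) 0 k" for k :: "complex poly" by (simp add: leading_def)
    obtain l i where x: "x = (l, i)" by (cases x)
    show ?thesis
      using leading_mult[OF c[of "[:coeff (coeff g l) i:]"]
        leading_mult[OF leading_power[OF P(1), of i] leading_power[OF Q(1), of l]]]
      unfolding x T_def w_def z_def by (simp only: prod.case add_0)
  qed
  have "A \<noteq> {}" using f fs by (auto simp: leading_def)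
  define m' where "m' = Min (w ` A)"
  have m'_le: "m' \<le> w x" if "x \<in> A" for x unfolding m'_def using fin that by simp
  have "m' \<in> w ` A" unfolding m'_def using fin \<open>A \<noteq> {}\<close> by (intro Min_in) auto
  then obtain l0 i0 where x0: "(l0, i0) \<in> A" "w (l0, i0) = m'" by auto
  define B where "B = {x \<in> A. w x = m'}"
  have lf: "leading f m' (\<Sum>x\<in>B. z x)"
  proof (rule leadingI)
    show "f $ i = 0" if i: "i < m'" for i
      unfolding fs fps_sum_nth
    proof (intro sum.neutral ballI)
      fix x assume "x \<in> A"
      from m'_le[OF this] i show "T x $ i = 0" by (intro leading_nth_less[OF lead]) simp
    qed
    have "(\<Sum>x\<in>A. T x $ m') = (\<Sum>x\<in>B. T x $ m')"
    proof (intro sum.mono_neutral_right fin ballI)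
      fix x assume "x \<in> A - B"
      hence "m' < w x" using m'_le[of x] unfolding B_def by auto
      thus "T x $ m' = 0" by (rule leading_nth_less[OF lead])
    qed (simp add: B_def)
    hence "f $ m' = (\<Sum>x\<in>B. T x $ m')" by (simp add: fs fps_sum_nth)
    also have "\<dots> = (\<Sum>x\<in>B. z x)"
    proof (intro sum.cong refl)
      fix x assume "x \<in> B"
      hence "m' = w x" by (simp add: B_def)
      thus "T x $ m' = z x" using leading_nth[OF lead[of x]] by simp
    qed
    finally show "f $ m' = (\<Sum>x\<in>B. z x)" .
  qed
  have z: "z (l, i) = monom (coeff (coeff g l) i * p ^ i * q ^ l) l" for l i
  proof -
    have "[:0, q:] = monom q 1" by (simp add: monom_altdef)
    hence "[:0, q:] ^ l = monom (q ^ l) l" by (simp add: monom_power)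
    thus ?thesis by (simp add: z_def poly_const_pow smult_monom mult.assoc)
  qed
  have "coeff (\<Sum>x\<in>B. z x) l0 = (\<Sum>x\<in>B. if x = (l0, i0) then coeff (z (l0, i0)) l0 else 0)"
    unfolding coeff_sum
  proof (intro sum.cong refl)
    fix x assume "x \<in> B"
    then obtain l i where x: "x = (l, i)" "w (l, i) = m'" by (cases x) (auto simp: B_def)
    show "coeff (z x) l0 = (if x = (l0, i0) then coeff (z (l0, i0)) l0 else 0)"
    proof (cases "l = l0")
      case True
      have "w (l, i) = w (l0, i0)" using x(2) x0(2) by simp
      hence "i * a + l * b = i0 * a + l0 * b" unfolding w_def by (simp only: prod.case)
      hence "i = i0" using True P(3) by simp
      thus ?thesis using True by (simp add: x)
    qed (simp add: x z)
  qed
  also have "\<dots> = coeff (z (l0, i0)) l0"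
    using x0 fin by (simp add: B_def)
  also have "\<dots> \<noteq> 0" using x0 P Q by (simp add: z A_def)
  finally have "(\<Sum>x\<in>B. z x) \<noteq> 0" by auto
  hence "m = m'" using leading_unique[OF f(2) lf f(3)] by simp
  thus ?thesis using x0(2) by (auto simp: w_def)
qed

section \<open>The family through the given branch\<close>

context branch
begin

abbreviation (input) "lgcd \<equiv> ce (gen - 1)"

definition "fam1 = (fps_X ^ n :: complex poly fps)"
definition "fam2 = by_t [:base, fps_X ^ bg:]"

lemma fam2_nth: "fam2 $ i = [:base $ i, fps_X ^ bg $ i:]"
  unfolding fam2_def by (intro poly_eqI) (simp add: by_t_nth coeff_pCons split: nat.splits)

lemma by_t_const_nth: "by_t [:a:] $ i = [:a $ i:]"
  by (intro poly_eqI) (simp add: by_t_nth coeff_pCons split: nat.splits)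

lemma fam1_eq: "fam1 = by_t [:fps_X ^ n:]"
  by (intro fps_ext) (simp add: by_t_const_nth fam1_def fps_X_power_iff one_pCons)

lemma lgcd_gt_1: "lgcd > 1"
  using ce_before_gen[of "gen - 1"] ce_pos[of "gen - 1"] gen_pos by linarith

lemma initial_leading_fam1: "leading fam1 n [:1:]"
  by (simp add: fam1_def leading_def fps_X_power_iff one_pCons)

text \<open>For genus one the truncated series vanishes and the second coordinate is
  \<open>u t^bg\<close>, so the state is terminal at once. Otherwise the Jacobian is exactly
  \<open>n t^(n - 1 + bg)\<close>, and its order has the required residue because
  \<open>ce (gen - 1)\<close> divides \<open>n\<close> but not \<open>bg\<close>.\<close>

lemma initial_state:
  "preterminal lgcd (n - 1 + bg) fam1 fam2 \<or> terminal lgcd fam1 fam2"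
proof (cases "gen = 1")
  case True
  have "base = 0" using cb_1 True by (simp add: fps_cutoff_zero_iff)
  hence "leading fam2 bg [:0, 1:]" by (simp add: leading_def fam2_nth fps_X_power_iff)
  moreover have "lgcd dvd n" by (rule ce_dvd_n)
  moreover have "bg > 0" using cb_pos by simp
  ultimately show ?thesis using initial_leading_fam1 n_pos unfolding terminal_def
    by (intro disjI2) (metis zero_neq_one)
next
  case False
  hence "gen > 1" using gen_pos by simp
  have lt: "cb 1 < bg" using cb_less[of 1 gen] \<open>gen > 1\<close> by simp
  have "s $ i = 0" if "i < cb 1" for i using that unfolding cb_1 by (rule nth_less_subdegree_zero)
  hence l2: "leading fam2 (cb 1) [:s $ cb 1:]"
    using lt by (simp add: leading_def fam2_nth fps_X_power_iff)
  have "fps_deriv fam1 = of_nat n * fps_X ^ (n - 1)" by (simp add: fam1_def fps_deriv_power fps_of_nat)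
  moreover have "pd_u fam1 = 0" by (intro fps_ext) (auto simp: fam1_def fps_X_power_iff one_pCons)
  moreover have "pd_u fam2 = fps_X ^ bg"
    by (intro fps_ext) (simp add: fam2_nth pderiv_pCons fps_X_power_iff one_pCons)
  ultimately have "jac fam1 fam2 = of_nat n * fps_X ^ (n - 1 + bg)"
    by (simp add: jac_def power_add mult.assoc)
  moreover have "leading (of_nat n * fps_X ^ (n - 1 + bg)) (0 + (n - 1 + bg)) (of_nat n * 1 :: complex poly)"
    by (intro leading_mult leading_of_nat) (simp add: leading_def fps_X_power_iff)
  ultimately have J: "leading (jac fam1 fam2) (n - 1 + bg) [:of_nat n:]"
    by (simp add: of_nat_poly)
  have "\<not> lgcd dvd bg"
    using cb_Suc_props(1)[OF ce_before_gen, of "gen - 1"] gen_pos by simp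
  moreover have "Suc (n - 1 + bg) = n + bg" using n_pos by simp
  ultimately have nd: "\<not> lgcd dvd Suc (n - 1 + bg)"
    using ce_dvd_n[of "gen - 1"] by (simp add: dvd_add_right_iff)
  have inv1: "u_invariant lgcd fam1"
    unfolding u_invariant_def using lgcd_gt_1 ce_dvd_n[of "gen - 1"]
    by (subst rot_invariant_iff) (auto simp: fam1_def fps_X_power_iff)
  have inv2: "u_invariant lgcd fam2"
    unfolding u_invariant_def using lgcd_gt_1 support_below_cb[OF gen_pos order_refl]
    by (subst rot_invariant_iff) (auto simp: fam2_nth)
  have "cb 1 > 0" "s $ cb 1 \<noteq> 0" using cb_pos[of 1] s_cb[of 1] \<open>gen > 1\<close> by auto
  hence pos: "cb 1 > 0" "s $ cb 1 \<noteq> 0" "n + cb 1 \<le> n - 1 + bg" using lt n_pos by simp_all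
  have "preterminal lgcd (n - 1 + bg) fam1 fam2"
    unfolding preterminal_def
    by (rule exI[where x = n], rule exI[where x = "cb 1"], rule exI[where x = 1], rule exI[where x = "s $ cb 1"],
       rule exI[where x = "of_nat n"]) (use initial_leading_fam1 n_pos l2 J nd inv1 inv2 pos in auto)
  thus ?thesis ..
qed

lemma by_t_hat_pCons: "by_t (hat (pCons a G)) = by_t [:a oo fps_X ^ n:] + fam2 * by_t (hat G)"
  unfolding subst_u_pCons[OF n_pos] fam2_def by_t_add by_t_mult ..

lemma by_t_const_alg: "by_t [:fps_of_poly h oo fps_X ^ n:] \<in> alg fam1 fam2"
proof (induction h)
  case 0
  have "fps_const [:0:] \<in> alg fam1 fam2" by (rule alg.const)
  thus ?case by simp
next
  case (pCons c h)
  have "fps_of_poly (pCons c h) oo fps_X ^ n = fps_const c + fps_X ^ n * (fps_of_poly h oo fps_X ^ n)"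
    using Xn_0[OF n_pos]
    by (simp add: fps_of_poly_pCons fps_compose_add_distrib fps_compose_mult_distrib mult.commute)
  hence "by_t [:fps_of_poly (pCons c h) oo fps_X ^ n:] =
      by_t [:fps_const c:] + by_t [:fps_X ^ n:] * by_t [:fps_of_poly h oo fps_X ^ n:]"
    by (simp flip: by_t_mult by_t_add add: mult.commute)
  moreover have "by_t [:fps_const c:] = fps_const [:c:]"
    by (intro fps_ext) (simp add: by_t_const_nth)
  ultimately show ?case using pCons.IH alg.intros by (simp flip: fam1_eq)
qed

lemma by_t_hat_alg:
  assumes "\<And>l. \<exists>h. coeff G l = fps_of_poly h"
  shows "by_t (hat G) \<in> alg fam1 fam2"
  using assms
proof (induction G)
  case 0
  have "fps_const [:0:] \<in> alg fam1 fam2" by (rule alg.const)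
  thus ?case by (simp add: n_pos)
next
  case (pCons a G)
  have "\<exists>h. coeff G l = fps_of_poly h" for l using pCons.prems[of "Suc l"] by simp
  moreover obtain h where "a = fps_of_poly h" using pCons.prems[of 0] by auto
  ultimately show ?case unfolding by_t_hat_pCons using pCons.IH by_t_const_alg by (auto intro: alg.intros)
qed

text \<open>The coefficients of a semiroot are power series in \<open>x\<close>, so its pull-back
  need not lie in the algebra. Cutting these coefficients off at order \<open>Suc (val i)\<close>
  changes the pull-back only in orders above \<open>val i\<close> and leaves a polynomial.\<close>

lemma val_attained:
  assumes "i \<le> gen"
  shows "\<exists>f c. f \<in> alg fam1 fam2 \<and> leading f (val i) c \<and> c \<noteq> 0"
proof -
  obtain c where c: "c \<noteq> 0" "leading (by_t (hat (Fs i))) (val i) c"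
  proof (cases "i = 0")
    case True
    thus ?thesis using that[of "[:1:]"] leading_hat_Fs_0 by simp
  next
    case False
    then obtain d where "d \<noteq> 0"
      "leading (by_t (hat (Fs i))) (val i) (if i = gen then [:0, d:] else [:d:])"
      using leading_hat_Fs[of i] assms by blast
    thus ?thesis using that[of "if i = gen then [:0, d:] else [:d:]"] by auto
  qed
  define K where "K = Suc (val i)"
  define G where "G = map_poly (fps_cutoff K) (Fs i)"
  define G' where "G' = map_poly (fps_shift K) (Fs i)"
  have "Fs i = G + [:fps_X ^ K:] * G'"
    by (intro poly_eqI) (simp add: G_def G'_def coeff_map_poly fps_shift_cutoff' add.commute[of "fps_cutoff _ _"])
  hence "by_t (hat (Fs i)) = by_t (hat G) + by_t [:fps_X ^ K oo fps_X ^ n:] * by_t (hat G')"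
    by (simp only: subst_u_add[OF n_pos] subst_u_mult[OF n_pos] subst_u_const[OF n_pos] by_t_add by_t_mult)
  moreover have "fps_X ^ K oo fps_X ^ n = (fps_X ^ (n * K) :: complex fps)"
    using Xn_0[OF n_pos] by (simp add: fps_X_power_compose power_mult)
  moreover have "leading (by_t [:fps_X ^ (n * K):] * by_t (hat G')) (n * K + 0) ([:1:] * (by_t (hat G') $ 0))"
    by (intro leading_mult) (auto simp: leading_def by_t_const_nth fps_X_power_iff)
  moreover have "val i < n * K + 0" using n_pos unfolding K_def
    by (metis add.right_neutral lessI less_le_trans mult_le_mono1 nat_mult_1 Suc_leI One_nat_def)
  ultimately have "leading (by_t (hat (Fs i)) - by_t (hat G)) (val i) 0"
    using leading_lower by fastforce
  from leading_diff[OF c(2) this] have "leading (by_t (hat G)) (val i) c" by simp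
  moreover have "by_t (hat G) \<in> alg fam1 fam2"
  proof (rule by_t_hat_alg)
    fix l
    have "coeff G l = fps_of_poly (Poly (map (fps_nth (coeff (Fs i) l)) [0..<K]))"
      by (intro fps_ext) (simp add: G_def coeff_map_poly nth_default_def)
    thus "\<exists>h. coeff G l = fps_of_poly h" by blast
  qed
  ultimately show ?thesis using c by blast
qed

text \<open>From \<open>gcd a b dvd val i\<close> for all \<open>i\<close> the divisibility passes
  to all \<open>ce i\<close> by \<open>gcd_val\<close>, and \<open>ce gen = 1\<close>.\<close>

theorem pre_resolution:
  "\<exists>K \<Psi> dir a b p q. \<Psi> 0 = (fam1, fam2) \<and> blowup_run (\<lambda>c. [:c:]) K dir \<Psi> \<and>
     (\<forall>k<K. fst (\<Psi> k) $ 1 = 0) \<and> a > 1 \<and> b > 0 \<and> coprime a b \<and>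
     leading (fst (\<Psi> K)) a [:p:] \<and> p \<noteq> 0 \<and> leading (snd (\<Psi> K)) b [:0, q:] \<and> q \<noteq> 0"
proof -
  obtain K dir \<Psi> where *: "terminal_run lgcd fam1 fam2 K dir \<Psi>"
    using initial_state preterminal_run[OF lgcd_gt_1] terminal_run_0 by blast
  note * = *[unfolded terminal_run_def]
  obtain a b p q where t: "a > 0" "b > 0" "lgcd dvd a" "leading (fst (\<Psi> K)) a [:p:]" "p \<noteq> 0"
     "leading (snd (\<Psi> K)) b [:0, q:]" "q \<noteq> 0" using * unfolding terminal_def by blast
  have dv: "gcd a b dvd val i" if ig: "i \<le> gen" for i
  proof -
    obtain f c where f: "f \<in> alg fam1 fam2" "leading f (val i) c" "c \<noteq> 0"
      using val_attained[OF ig] by blast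
    have "f \<in> alg (fst (\<Psi> K)) (snd (\<Psi> K))" using alg_trans[OF f(1)] * by blast
    from alg_order_dvd[OF t(4,5,1,6,7) this f(2,3)] show ?thesis .
  qed
  have "i \<le> gen \<Longrightarrow> gcd a b dvd ce i" for i
  proof (induction i)
    case 0
    show ?case using dv[of 0] by simp
  next
    case (Suc i)
    hence "gcd a b dvd gcd (ce i) (val (Suc i))" using dv[OF Suc.prems] by (intro gcd_greatest) simp_all
    thus ?case using conjunct1[OF gcd_val[OF Suc_le_lessD[OF Suc.prems]]] by (simp only:)
  qed
  from this[of gen] have "coprime a b" by (simp add: ce_gen coprime_iff_gcd_eq_1)
  moreover have "a > 1" using t(1,3) lgcd_gt_1 by (auto dest: dvd_imp_le)
  ultimately show ?thesis using * t by blast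
qed

end

text \<open>
  Near a value \<open>u\<close> of the parameter, the family is expanded in \<open>w\<close>, the difference to this value.
  Here an element of \<^typ>\<open>complex fps fps\<close> is a series in \<open>t\<close> (outer variable) over the series
  in \<open>w\<close> (inner variable).
\<close>

definition coeff_map :: "('a::zero \<Rightarrow> 'b::zero) \<Rightarrow> 'a fps \<Rightarrow> 'b fps" where
  "coeff_map h f = Abs_fps (\<lambda>i. h (f $ i))"

lemma coeff_map_nth [simp]: "coeff_map h f $ i = h (f $ i)"
  by (simp add: coeff_map_def)

locale coeff_hom =
  fixes h :: "'a::comm_ring_1 \<Rightarrow> 'b::comm_ring_1"
  assumes hom_1: "h 1 = 1" and hom_add: "h (a + b) = h a + h b" and hom_mult: "h (a * b) = h a * h b"
begin

lemma hom_0: "h 0 = 0"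
  using hom_add[of 0 0] by simp

lemma hom_sum: "h (sum f A) = (\<Sum>x\<in>A. h (f x))"
  by (induction A rule: infinite_finite_induct) (simp_all add: hom_0 hom_add)

lemma coeff_map_add: "coeff_map h (f + g) = coeff_map h f + coeff_map h g"
  by (intro fps_ext) (simp add: hom_add)

lemma coeff_map_mult: "coeff_map h (f * g) = coeff_map h f * coeff_map h g"
  by (intro fps_ext) (simp add: fps_mult_nth hom_sum hom_mult)

lemma coeff_map_const: "coeff_map h (fps_const a) = fps_const (h a)"
  by (intro fps_ext) (simp add: hom_0)

lemma hom_dvd_1: "a dvd 1 \<Longrightarrow> h a dvd 1"
  by (metis dvd_def hom_1 hom_mult)

lemma leading_coeff_map: "leading f m p \<Longrightarrow> leading (coeff_map h f) m (h p)"
  by (simp add: leading_def hom_0)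

lemma unit_leading_coeff_map: "unit_leading f m \<Longrightarrow> unit_leading (coeff_map h f) m"
  unfolding unit_leading_def using leading_coeff_map hom_dvd_1 by blast

lemma bstep_coeff_map:
  assumes "\<And>c. h (\<kappa> c) = \<kappa>' c" "bstep \<kappa> d x y"
  shows "bstep \<kappa>' d (map_prod (coeff_map h) (coeff_map h) x) (map_prod (coeff_map h) (coeff_map h) y)"
proof -
  have "\<exists>a>0. unit_leading (coeff_map h (fst x)) a" "\<exists>b>0. unit_leading (coeff_map h (snd x)) b"
    using assms(2) unit_leading_coeff_map unfolding bstep_def by blast+
  thus ?thesis using assms(2) unfolding bstep_def
    by (simp split: option.splits
        add: coeff_map_mult coeff_map_add coeff_map_const assms(1) hom_0)
qed

end

definition recenter :: "complex \<Rightarrow> complex poly \<Rightarrow> complex fps" where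
  "recenter u p = fps_of_poly (pcompose p [:u, 1:])"

interpretation recenter: coeff_hom "recenter u" for u
  by unfold_locales (simp_all add: recenter_def pcompose_add pcompose_mult pcompose_1 fps_of_poly_add fps_of_poly_mult)

lemma recenter_pCons: "recenter u [:a, b:] = fps_const (a + b * u) + fps_const b * fps_X"
  by (simp add: recenter_def pcompose_pCons fps_of_poly_pCons algebra_simps)

lemma recenter_const: "recenter u [:a:] = fps_const a"
  by (simp add: recenter_def)

lemma recenter_eq_0_iff: "recenter u p = 0 \<longleftrightarrow> p = 0"
  by (simp add: recenter_def pcompose_eq_0_iff)

lemma fps_unit_iff: "f dvd 1 \<longleftrightarrow> f $ 0 \<noteq> 0" for f :: "complex fps"
  by (rule fps_is_unit_iff)

section \<open>The Euclidean algorithm near a nonzero parameter value\<close>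

text \<open>The outer variable is \<open>t\<close> and the inner one is \<open>w\<close>, so
  \<open>dx2\<close> is here the derivative by \<open>w\<close>.\<close>

definition jac2 :: "complex fps fps \<Rightarrow> complex fps fps \<Rightarrow> complex fps fps" where
  "jac2 P Q = fps_deriv P * dx2 Q - dx2 P * fps_deriv Q"

lemma jac2_blowup: "jac2 P (P * (Q + fps_const (fps_const c))) = P * jac2 P Q"
  by (simp add: jac2_def dx2_mult dx2_add algebra_simps)

lemma jac2_blowup': "jac2 (P * Q) Q = Q * jac2 P Q"
  by (simp add: jac2_def dx2_mult algebra_simps)

lemma leading_dx2: "leading f m p \<Longrightarrow> leading (dx2 f) m (fps_deriv p)"
  by (simp add: leading_def dx2_def)

lemma unit_leading_cancel:
  fixes P g :: "'a::idom fps"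
  assumes "unit_leading P a" "unit_leading (P * g) d"
  shows "a \<le> d" "unit_leading g (d - a)"
proof -
  obtain p r where *: "leading P a p" "p dvd 1" "leading (P * g) d r" "r dvd 1"
    using assms unfolding unit_leading_def by blast
  have nz: "p \<noteq> 0" "r \<noteq> 0" using * by auto
  from leading_cancel[OF *(1) nz(1) *(3) nz(2)] obtain r' where "leading g (d - a) r'" "p * r' = r" "a \<le> d"
    by blast
  moreover from this have "r' dvd 1" using *(4) by (metis dvd_mult_right)
  ultimately show "a \<le> d" "unit_leading g (d - a)" unfolding unit_leading_def by blast+
qed

lemma unit_leading_quotient:
  fixes P Q :: "'a::comm_ring_1 fps"
  assumes "unit_leading P a" "unit_leading Q b" "a \<le> b"
  shows "\<exists>Q'. Q = P * Q' \<and> unit_leading Q' (b - a)"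
proof -
  obtain p q where *: "leading P a p" "p dvd 1" "leading Q b q" "q dvd 1"
    using assms unfolding unit_leading_def by blast
  from leading_quotient[OF *(1-3) assms(3)] obtain Q' q' where
    "Q = P * Q'" "leading Q' (b - a) q'" "p * q' = q" by blast
  moreover from this have "q' dvd 1" using *(4) by (metis dvd_mult_right)
  ultimately show ?thesis unfolding unit_leading_def by blast
qed

text \<open>For positive orders and leading coefficients \<open>p\<close> and \<open>q\<close>,
  series in \<open>w\<close>, the last condition says that \<open>a p q' - b p' q\<close> is a unit:
  the leading terms alone already have a nondegenerate Jacobian.\<close>

definition eucl_state :: "nat \<Rightarrow> nat \<Rightarrow> complex fps fps \<times> complex fps fps \<Rightarrow> bool" where
  "eucl_state a b x \<longleftrightarrow> unit_leading (fst x) a \<and> unit_leading (snd x) b \<and>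
     unit_leading (jac2 (fst x) (snd x)) (a + b - 1)"

lemma eucl_step_less:
  assumes "eucl_state a b (P, Q)" "0 < a" "a < b"
  shows "\<exists>Q'. eucl_state a (b - a) (P, Q') \<and> bstep fps_const (Some 0) (P, Q) (P, Q')"
proof -
  have u: "unit_leading P a" "unit_leading Q b" "unit_leading (jac2 P Q) (a + b - 1)"
    using assms(1) by (auto simp: eucl_state_def)
  obtain Q' where Q': "Q = P * Q'" "unit_leading Q' (b - a)"
    using unit_leading_quotient[OF u(1,2)] assms by auto
  have "jac2 P Q = P * jac2 P Q'" using jac2_blowup[of P Q' 0] Q' by simp
  hence "unit_leading (P * jac2 P Q') (a + b - 1)" using u by simp
  from unit_leading_cancel(2)[OF u(1) this] have "unit_leading (jac2 P Q') (b - 1)"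
    using assms by simp
  moreover have "Q' $ 0 = 0" using Q'(2) assms by (auto simp: unit_leading_def leading_def)
  moreover have "a + (b - a) - 1 = b - 1" using assms by simp
  ultimately have "eucl_state a (b - a) (P, Q')" using u Q' by (simp add: eucl_state_def)
  moreover have "bstep fps_const (Some 0) (P, Q) (P, Q')"
    unfolding bstep_def using u Q' \<open>Q' $ 0 = 0\<close> assms by (auto intro: less_trans)
  ultimately show ?thesis by blast
qed

lemma eucl_step_greater:
  assumes "eucl_state a b (P, Q)" "0 < b" "b < a"
  shows "\<exists>P'. eucl_state (a - b) b (P', Q) \<and> bstep fps_const None (P, Q) (P', Q)"
proof -
  have u: "unit_leading P a" "unit_leading Q b" "unit_leading (jac2 P Q) (a + b - 1)"
    using assms(1) by (auto simp: eucl_state_def)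
  obtain P' where P': "P = Q * P'" "unit_leading P' (a - b)"
    using unit_leading_quotient[OF u(2,1)] assms by auto
  have "jac2 P Q = Q * jac2 P' Q" using jac2_blowup'[of P' Q] P' by (simp add: mult.commute)
  hence "unit_leading (Q * jac2 P' Q) (a + b - 1)" using u by simp
  from unit_leading_cancel(2)[OF u(2) this] have "unit_leading (jac2 P' Q) (a - 1)"
    using assms by simp
  moreover have "P' $ 0 = 0" using P'(2) assms by (auto simp: unit_leading_def leading_def)
  moreover have "(a - b) + b - 1 = a - 1" using assms by simp
  ultimately have "eucl_state (a - b) b (P', Q)" using u P' by (simp add: eucl_state_def)
  moreover have "bstep fps_const None (P, Q) (P', Q)"
    unfolding bstep_def using u P' \<open>P' $ 0 = 0\<close> assms by (auto intro: less_trans simp: mult.commute)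
  ultimately show ?thesis by blast
qed

text \<open>Subtractive Euclidean algorithm. Directions and orders are quantified before
  \<open>x\<close>, so all members of the family share them. After \<open>None\<close> the axis
  \<open>y = 0\<close> is exceptional, and \<open>Some 0\<close> preserves both this and the order
  of the first coordinate; the argument about normal crossings rests on it.\<close>

lemma eucl_run:
  assumes "coprime a b" "a > 0" "b > 0"
  shows "\<exists>K dir (o1 :: nat \<Rightarrow> nat). o1 0 = a \<and> o1 K = 1 \<and>
     (\<forall>k<K. dir k = None \<or> dir k = Some 0 \<and> o1 (Suc k) = o1 k) \<and>
     (\<forall>x. eucl_state a b x \<longrightarrow> (\<exists>\<Psi>. \<Psi> 0 = x \<and> blowup_run fps_const K dir \<Psi> \<and>
        (\<forall>k\<le>K. unit_leading (fst (\<Psi> k)) (o1 k)) \<and> eucl_state 1 1 (\<Psi> K)))"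
  using assms
proof (induction "a + b" arbitrary: a b rule: less_induct)
  case less
  show ?case
  proof (cases "a = b")
    case True
    hence ab: "a = 1" "b = 1" using less.prems by auto
    show ?thesis unfolding ab
    proof (rule exI[where x = 0], rule exI[where x = "\<lambda>_. None"], rule exI[where x = "\<lambda>_. 1"],
        intro conjI allI impI)
      fix x assume x: "eucl_state 1 1 x"
      show "\<exists>\<Psi>. \<Psi> 0 = x \<and> blowup_run fps_const 0 (\<lambda>_. None) \<Psi> \<and>
          (\<forall>k\<le>0. unit_leading (fst (\<Psi> k)) 1) \<and> eucl_state 1 1 (\<Psi> 0)"
        using x by (intro exI[where x = "\<lambda>_. x"]) (simp add: blowup_run_def eucl_state_def)
    qed simp_all
  next
    case False
    define a' b' where "a' = (if a < b then a else a - b)" and "b' = (if a < b then b - a else b)"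
    define d where "d = (if a < b then Some 0 else None :: direction)"
    have "coprime a' b'"
      using less.prems(1) gcd_diff1_nat[of a b] gcd_diff1_nat[of b a] gcd.commute[of a]
      by (auto simp: a'_def b'_def coprime_iff_gcd_eq_1)
    moreover have "a' + b' < a + b" "a' > 0" "b' > 0"
      using less.prems False by (auto simp: a'_def b'_def)
    ultimately obtain K dir o1 where
      IH: "o1 0 = a'" "o1 K = 1" "\<forall>k<K. dir k = None \<or> dir k = Some 0 \<and> o1 (Suc k) = o1 k"
      "\<And>x. eucl_state a' b' x \<Longrightarrow> \<exists>\<Psi>. \<Psi> 0 = x \<and> blowup_run fps_const K dir \<Psi> \<and>
        (\<forall>k\<le>K. unit_leading (fst (\<Psi> k)) (o1 k)) \<and> eucl_state 1 1 (\<Psi> K)"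
      using less.hyps[of a' b'] by auto
    have run: "\<exists>\<Psi>. \<Psi> 0 = x \<and> blowup_run fps_const (Suc K) (case_nat d dir) \<Psi> \<and>
        (\<forall>k\<le>Suc K. unit_leading (fst (\<Psi> k)) (case_nat a o1 k)) \<and> eucl_state 1 1 (\<Psi> (Suc K))"
      if x: "eucl_state a b x" for x
    proof -
      obtain y where y: "eucl_state a' b' y" "bstep fps_const d x y"
        using eucl_step_less[of a b "fst x" "snd x"] eucl_step_greater[of a b "fst x" "snd x"]
          x less.prems False by (cases "a < b") (auto simp: a'_def b'_def d_def)
      from IH(4)[OF y(1)] obtain \<Psi> where R: "\<Psi> 0 = y" "blowup_run fps_const K dir \<Psi>"
        "\<forall>k\<le>K. unit_leading (fst (\<Psi> k)) (o1 k)" "eucl_state 1 1 (\<Psi> K)" by blast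
      have "blowup_run fps_const (Suc K) (case_nat d dir) (case_nat x \<Psi>)"
        by (rule blowup_run_Cons) (use R y in simp_all)
      moreover have "unit_leading (fst (case_nat x \<Psi> k)) (case_nat a o1 k)" if "k \<le> Suc K" for k
        using that R(3) x by (cases k) (auto simp: eucl_state_def)
      ultimately show ?thesis using R(4) by (intro exI[where x = "case_nat x \<Psi>"]) simp
    qed
    have "\<forall>k<Suc K. case_nat d dir k = None \<or>
        case_nat d dir k = Some 0 \<and> case_nat a o1 (Suc k) = case_nat a o1 k"
      using IH(1,3) by (auto simp: d_def a'_def split: nat.splits)
    moreover have "case_nat a o1 0 = a" "case_nat a o1 (Suc K) = 1" using IH(2) by simp_all
    ultimately show ?thesis using run by blast
  qed
qed

text \<open>Both orders are 1, so the quotient is a unit and its constant term is a direction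
  \<open>c \<noteq> 0\<close> away from both axes. Dividing the Jacobian by \<open>P\<close> brings
  its order to 0: the lifted family becomes a local isomorphism.\<close>

lemma final_step:
  assumes "eucl_state 1 1 (P, Q)"
  shows "\<exists>c Q'. Q = P * (Q' + fps_const (fps_const c)) \<and> c \<noteq> 0 \<and> Q' $ 0 $ 0 = 0 \<and>
    unit_leading (jac2 P Q') 0"
proof -
  have u: "unit_leading P 1" "unit_leading Q 1" "unit_leading (jac2 P Q) 1"
    using assms by (auto simp: eucl_state_def)
  obtain Q1 where Q1: "Q = P * Q1" "unit_leading Q1 0"
    using unit_leading_quotient[OF u(1,2)] by auto
  define c where "c = Q1 $ 0 $ 0"
  have c: "c \<noteq> 0" using Q1(2) by (auto simp: unit_leading_def leading_def c_def)
  define Q' where "Q' = Q1 - fps_const (fps_const c)"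
  have Q: "Q = P * (Q' + fps_const (fps_const c))" by (simp add: Q'_def Q1)
  have "unit_leading (P * jac2 P Q') 1" using u(3) unfolding Q jac2_blowup .
  from unit_leading_cancel(2)[OF u(1) this] have "unit_leading (jac2 P Q') 0" by simp
  moreover have "Q' $ 0 $ 0 = 0" by (simp add: Q'_def c_def)
  ultimately show ?thesis using c Q by blast
qed

text \<open>Here \<open>u \<noteq> 0\<close> enters: the leading coefficient
  \<open>q (u + w)\<close> is a unit of \<open>\<complex>[[w]]\<close>. Its derivative
  \<open>q\<close> makes the Jacobian nondegenerate.\<close>

lemma eucl_state_terminal:
  assumes "leading P a [:p:]" "p \<noteq> 0" "a > 0" "leading Q b [:0, q:]" "q \<noteq> 0" "b > 0" "u \<noteq> 0"
  shows "eucl_state a b (coeff_map (recenter u) P, coeff_map (recenter u) Q)"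
proof -
  let ?P = "coeff_map (recenter u) P" and ?Q = "coeff_map (recenter u) Q"
  have P: "leading ?P a (fps_const p)"
    using recenter.leading_coeff_map[OF assms(1), of u] by (simp add: recenter_const)
  have Q: "leading ?Q b (fps_const (q * u) + fps_const q * fps_X)"
    using recenter.leading_coeff_map[OF assms(4), of u] by (simp add: recenter_pCons)
  have "leading (fps_deriv ?P * dx2 ?Q) (a - 1 + b)
      (of_nat a * fps_const p * fps_deriv (fps_const (q * u) + fps_const q * fps_X))"
    by (intro leading_mult leading_deriv' leading_dx2 P Q assms)
  moreover have "leading (dx2 ?P * fps_deriv ?Q) (a + (b - 1))
      (fps_deriv (fps_const p) * (of_nat b * (fps_const (q * u) + fps_const q * fps_X)))"
    by (intro leading_mult leading_deriv' leading_dx2 P Q assms)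
  moreover have "a + (b - 1) = a - 1 + b" using assms by simp
  ultimately have "leading (jac2 ?P ?Q) (a - 1 + b) (of_nat a * fps_const p * fps_const q - 0)"
    unfolding jac2_def by (intro leading_diff) simp_all
  hence "leading (jac2 ?P ?Q) (a + b - 1) (of_nat a * fps_const p * fps_const q)"
    using assms by simp
  moreover have "of_nat a * fps_const p * fps_const q dvd (1 :: complex fps)"
    using assms by (simp add: fps_unit_iff)
  moreover have "fps_const p dvd (1 :: complex fps)" using assms by (simp add: fps_unit_iff)
  moreover have "fps_const (q * u) + fps_const q * fps_X dvd (1 :: complex fps)"
    using assms by (simp add: fps_unit_iff)
  ultimately show ?thesis unfolding eucl_state_def unit_leading_def fst_conv snd_conv using P Q by blast
qed

text \<open>
  \<open>\<Psi> k\<close> is the family in the coordinates at \<open>p\<^sub>k\<close> and \<open>o1 k\<close> the order of its first coordinate. The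
  direction of the last blow-up is the only one that depends on \<open>u\<close>; for \<open>w = 0\<close> it is \<open>c\<close>.
\<close>

definition resolved :: "nat \<Rightarrow> (nat \<Rightarrow> direction) \<Rightarrow> (nat \<Rightarrow> nat) \<Rightarrow>
    (nat \<Rightarrow> complex fps fps \<times> complex fps fps) \<Rightarrow> complex \<Rightarrow> bool" where
  "resolved N dir o1 \<Psi> c \<longleftrightarrow>
     blowup_run fps_const N dir \<Psi> \<and> (\<forall>k\<le>N. unit_leading (fst (\<Psi> k)) (o1 k)) \<and> unit_leading (snd (\<Psi> N)) 1 \<and>
     fst (\<Psi> (Suc N)) = fst (\<Psi> N) \<and>
     snd (\<Psi> N) = fst (\<Psi> N) * (snd (\<Psi> (Suc N)) + fps_const (fps_const c)) \<and>
     c \<noteq> 0 \<and> snd (\<Psi> (Suc N)) $ 0 $ 0 = 0 \<and>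
     unit_leading (jac2 (fst (\<Psi> (Suc N))) (snd (\<Psi> (Suc N)))) 0"

context branch
begin

definition family :: "complex \<Rightarrow> complex fps fps \<times> complex fps fps" where
  "family u = (coeff_map (recenter u) fam1, coeff_map (recenter u) fam2)"

text \<open>The phase over \<open>\<complex>[u]\<close> is expanded at \<open>u\<close> and
  continued by the Euclidean phase and \<open>final_step\<close>. The disjunction on directions and
  orders is all that the dual graph needs to know about the run.\<close>

theorem resolution:
  "\<exists>N dir o1. o1 N = 1 \<and>
     (\<forall>k<N. o1 (Suc k) > 1 \<or> dir k = None \<or> dir k = Some 0 \<and> o1 (Suc k) = o1 k) \<and>
     (\<forall>u. u \<noteq> 0 \<longrightarrow> (\<exists>\<Psi> c. \<Psi> 0 = family u \<and> resolved N dir o1 \<Psi> c))"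
proof -
  obtain K PQ dir a b p q where 1: "PQ 0 = (fam1, fam2)" "blowup_run (\<lambda>c. [:c:]) K dir PQ"
     "\<forall>k<K. fst (PQ k) $ 1 = 0" "a > 1" "b > 0" "coprime a b" "leading (fst (PQ K)) a [:p:]" "p \<noteq> 0"
     "leading (snd (PQ K)) b [:0, q:]" "q \<noteq> 0"
    using pre_resolution by blast
  have "a > 0" using 1 by simp
  obtain K' dir' o' where 2: "o' 0 = a" "o' K' = (1 :: nat)"
     "\<forall>k<K'. dir' k = None \<or> dir' k = Some 0 \<and> o' (Suc k) = o' k"
     "\<And>x. eucl_state a b x \<Longrightarrow> \<exists>\<Psi>. \<Psi> 0 = x \<and> blowup_run fps_const K' dir' \<Psi> \<and>
        (\<forall>k\<le>K'. unit_leading (fst (\<Psi> k)) (o' k)) \<and> eucl_state 1 1 (\<Psi> K')"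
    using eucl_run[OF 1(6) \<open>a > 0\<close> 1(5)] by blast
  define N where "N = K + K'"
  define d where "d k = (if k < K then dir k else dir' (k - K))" for k
  define o1 where "o1 k = (if k < K then subdegree (fst (PQ k)) else o' (k - K))" for k
  have o_big: "subdegree (fst (PQ k)) > 1 \<and> unit_leading (fst (PQ k)) (subdegree (fst (PQ k)))" if kK: "k < K" for k
  proof -
    have "\<exists>m>0. unit_leading (fst (PQ k)) m" using 1(2) kK unfolding blowup_run_def bstep_def by blast
    then obtain m p' where m: "m > 0" "leading (fst (PQ k)) m p'" "p' dvd 1"
      unfolding unit_leading_def by blast
    have "p' \<noteq> 0" using m by auto
    hence "subdegree (fst (PQ k)) = m" using m leading_subdegree by blast
    moreover have "fst (PQ k) $ m \<noteq> 0" using m \<open>p' \<noteq> 0\<close> by (simp add: leading_def)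
    hence "m \<noteq> 1" using 1(3) kK by metis
    ultimately show ?thesis using m unfolding unit_leading_def by auto
  qed
  show ?thesis
  proof (rule exI[where x = N], rule exI[where x = d], rule exI[where x = o1], intro conjI allI impI)
    show "o1 N = 1" by (simp add: o1_def N_def 2)
    fix k assume k: "k < N"
    show "o1 (Suc k) > 1 \<or> d k = None \<or> d k = Some 0 \<and> o1 (Suc k) = o1 k"
    proof (cases "Suc k \<le> K")
      case True
      hence "o1 (Suc k) > 1" using o_big[of "Suc k"] 1(4) 2(1) by (cases "Suc k = K") (auto simp: o1_def)
      thus ?thesis by simp
    next
      case False
      hence "d k = dir' (k - K)" "o1 k = o' (k - K)" "o1 (Suc k) = o' (Suc (k - K))" "k - K < K'"
        using k by (auto simp: d_def o1_def N_def Suc_diff_le)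
      thus ?thesis using 2(3) by auto
    qed
  next
    fix u :: complex assume u: "u \<noteq> 0"
    let ?h = "coeff_map (recenter u)"
    let ?x = "map_prod ?h ?h (PQ K)"
    have "eucl_state a b ?x"
      using eucl_state_terminal[OF 1(7,8) \<open>a > 0\<close> 1(9,10,5) u] by (cases "PQ K") simp
    from 2(4)[OF this] obtain R where R: "R 0 = ?x"
      "blowup_run fps_const K' dir' R"
      "\<forall>k\<le>K'. unit_leading (fst (R k)) (o' k)" "eucl_state 1 1 (R K')" by blast
    have "eucl_state 1 1 (fst (R K'), snd (R K'))" using R(4) by simp
    from final_step[OF this] obtain c Q' where f: "snd (R K') = fst (R K') * (Q' + fps_const (fps_const c))"
      "c \<noteq> 0" "Q' $ 0 $ 0 = 0" "unit_leading (jac2 (fst (R K')) Q') 0" by blast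
    define \<Psi> where "\<Psi> k = (if k < K then map_prod ?h ?h (PQ k) else if k \<le> N then R (k - K)
       else (fst (R K'), Q'))" for k
    have \<Psi>_pre: "\<Psi> k = map_prod ?h ?h (PQ k)" if "k \<le> K" for k
      using that R(1) by (cases "k = K") (auto simp: \<Psi>_def N_def)
    have \<Psi>_post: "\<Psi> k = R (k - K)" if "K \<le> k" "k \<le> N" for k
      using that by (simp add: \<Psi>_def)
    have steps: "bstep fps_const (d k) (\<Psi> k) (\<Psi> (Suc k))" if "k < N" for k
    proof (cases "k < K")
      case True
      have "bstep fps_const (dir k) (map_prod ?h ?h (PQ k)) (map_prod ?h ?h (PQ (Suc k)))"
        by (rule recenter.bstep_coeff_map[of _ "\<lambda>c. [:c:]"]) (use 1(2) True in \<open>auto simp: blowup_run_def recenter_const\<close>)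
      thus ?thesis using True by (simp add: \<Psi>_pre d_def)
    next
      case False
      hence "k - K < K'" using that by (simp add: N_def)
      hence "bstep fps_const (dir' (k - K)) (R (k - K)) (R (Suc (k - K)))"
        using R(2) by (simp add: blowup_run_def)
      thus ?thesis using False that by (simp add: \<Psi>_post d_def Suc_diff_le)
    qed
    have ords: "unit_leading (fst (\<Psi> k)) (o1 k)" if "k \<le> N" for k
    proof (cases "k < K")
      case True
      thus ?thesis using o_big[OF True] recenter.unit_leading_coeff_map by (simp add: \<Psi>_pre o1_def)
    next
      case False
      thus ?thesis using R(3) that by (simp add: \<Psi>_post o1_def N_def)
    qed
    have N: "\<Psi> N = R K'" "\<Psi> (Suc N) = (fst (R K'), Q')"
      using \<Psi>_post[of N] by (simp_all add: N_def \<Psi>_def)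
    have "resolved N d o1 \<Psi> c"
      unfolding resolved_def blowup_run_def N using steps ords f R(4) by (auto simp: eucl_state_def)
    moreover have "\<Psi> 0 = family u" using \<Psi>_pre[of 0] 1(1) by (simp add: family_def)
    ultimately show "\<exists>\<Psi> c. \<Psi> 0 = family u \<and> resolved N d o1 \<Psi> c" by blast
  qed
qed

end

section \<open>The dual graph\<close>

text \<open>
  Restriction of a family over \<open>w\<close> to the curve \<open>w = W(t)\<close>. It is a substitution of two-variable
  series whose values only involve the inner variable.
\<close>

definition restrict_to :: "complex fps \<Rightarrow> complex fps fps \<Rightarrow> complex fps" where
  "restrict_to W f = subst2 f (fps_const W, fps_const fps_X) $ 0"

context
  fixes W :: "complex fps"
  assumes W0: "W $ 0 = 0"
begin

lemma admissible_restriction: "admissible (fps_const W, fps_const fps_X)"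
  using W0 by (simp add: admissible_def)

lemma restrict_add: "restrict_to W (f + g) = restrict_to W f + restrict_to W g"
  by (simp add: restrict_to_def subst2_add)

lemma restrict_mult: "restrict_to W (f * g) = restrict_to W f * restrict_to W g"
  by (simp add: restrict_to_def subst2_mult[OF admissible_restriction])

lemma restrict_const: "restrict_to W (fps_const (fps_const c)) = fps_const c"
  by (simp add: restrict_to_def subst2_const[OF admissible_restriction])

lemma restrict_X_power: "restrict_to W (fps_X ^ m) = fps_X ^ m"
  using subst2_power[OF admissible_restriction, of fps_X m] subst2_var_y[OF admissible_restriction]
  by (simp add: restrict_to_def var_y_def fps_const_power)

lemma restrict_w: "restrict_to W (fps_const fps_X) = W"
  using subst2_var_x[OF admissible_restriction] by (simp add: restrict_to_def var_x_def)

lemma restrict_nth_0: "restrict_to W f $ 0 = f $ 0 $ 0"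
  by (simp add: restrict_to_def subst2_nth)

lemma restrict_unit_leading:
  assumes "unit_leading f m"
  shows "leading (restrict_to W f) m (f $ m $ 0)" "f $ m $ 0 \<noteq> 0"
proof -
  obtain p where p: "leading f m p" "p dvd 1" using assms by (auto simp: unit_leading_def)
  then obtain g where g: "f = fps_X ^ m * g" "g $ 0 = p" by (auto simp: leading_iff)
  have "restrict_to W f = fps_X ^ m * restrict_to W g" by (simp add: g restrict_mult restrict_X_power)
  moreover have "f $ m = p" using p by (simp add: leading_def)
  ultimately show "leading (restrict_to W f) m (f $ m $ 0)"
    unfolding leading_iff using g restrict_nth_0 by auto
  show "f $ m $ 0 \<noteq> 0" using \<open>f $ m = p\<close> p fps_unit_iff by simp
qed

lemma restrict_coeff_const: "restrict_to W (coeff_map fps_const S) = S"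
proof (rule fps_ext)
  fix i
  have "restrict_to W (coeff_map fps_const S) $ i =
     (\<Sum>p\<le>i. \<Sum>q\<le>i. if p = 0 then S $ q * (fps_X ^ q $ i) else 0)"
    unfolding restrict_to_def subst2_nth
    by (intro sum.cong) (auto simp: fps_const_power)
  also have "\<dots> = (\<Sum>p\<le>i. if p = 0 then (\<Sum>q\<le>i. S $ q * (fps_X ^ q $ i)) else 0)"
    by (intro sum.cong) auto
  also have "\<dots> = (\<Sum>q\<le>i. if q = i then S $ q else 0)"
    by (simp add: fps_X_power_iff if_distrib cong: if_cong)
  also have "\<dots> = S $ i" by simp
  finally show "restrict_to W (coeff_map fps_const S) $ i = S $ i" .
qed

abbreviation "restrict2 x \<equiv> (restrict_to W (fst x), restrict_to W (snd x))"

lemma tangent_step_Some: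
  assumes "fst x = fst y" "snd x = fst y * (snd y + fps_const c)" "snd y $ 0 = 0" "fst y \<noteq> 0"
  shows "tangent x = Some c" "transform_step x = y"
proof -
  have d: "snd x div fst x = snd y + fps_const c" using assms by simp
  show "tangent x = Some c" using assms d by (simp add: tangent_def)
  thus "transform_step x = y" using assms d by (simp add: transform_step_def prod_eq_iff)
qed

lemma tangent_step_None:
  assumes "snd x = snd y" "fst x = fst y * snd y" "fst y $ 0 = 0" "fst x \<noteq> 0"
  shows "tangent x = None" "transform_step x = y"
proof -
  have sy: "snd y \<noteq> 0" using assms by auto
  have "\<not> fst x dvd snd x"
  proof
    assume "fst x dvd snd x"
    hence "fst y * snd y dvd 1 * snd y" using assms by simp
    hence "fst y dvd 1" using sy dvd_mult_cancel_right[of "fst y" "snd y" 1] by blast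
    thus False using assms by simp
  qed
  thus "tangent x = None" by (simp add: tangent_def)
  thus "transform_step x = y" using assms sy by (simp add: transform_step_def prod_eq_iff)
qed

text \<open>On the curve \<open>w = W(t)\<close> the unit leading coefficients stay nonzero, so the
  relations between consecutive coordinates determine the quotients in \<open>tangent\<close> and
  \<open>transform_step\<close>.\<close>

lemma bstep_restrict:
  assumes "bstep fps_const d x y"
  shows "tangent (restrict2 x) = d" "transform_step (restrict2 x) = restrict2 y"
proof -
  obtain a where a: "unit_leading (fst x) a" using assms by (auto simp: bstep_def)
  have nz: "restrict_to W (fst x) \<noteq> 0" using restrict_unit_leading[OF a] leading_nz by blast
  have "tangent (restrict2 x) = d \<and> transform_step (restrict2 x) = restrict2 y"
  proof (cases d)
    case None
    hence y: "snd x = snd y" "fst x = fst y * snd y" "fst y $ 0 = 0" using assms by (auto simp: bstep_def)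
    have "fst (restrict2 y) $ 0 = 0" by (simp add: restrict_nth_0 y)
    moreover have "snd (restrict2 x) = snd (restrict2 y)" by (simp add: y)
    moreover have "fst (restrict2 x) = fst (restrict2 y) * snd (restrict2 y)"
      by (simp add: y(2) restrict_mult)
    ultimately show ?thesis using tangent_step_None[of "restrict2 x" "restrict2 y"] nz None by simp
  next
    case (Some c)
    hence y: "fst x = fst y" "snd x = fst y * (snd y + fps_const (fps_const c))" "snd y $ 0 = 0"
      using assms by (auto simp: bstep_def)
    have "snd (restrict2 y) $ 0 = 0" by (simp add: restrict_nth_0 y)
    moreover have "snd (restrict2 x) = fst (restrict2 y) * (snd (restrict2 y) + fps_const c)"
      by (simp add: y(2) restrict_mult restrict_add restrict_const)
    ultimately show ?thesis using tangent_step_Some[of "restrict2 x" "restrict2 y" c] nz Some y(1) by simp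
  qed
  thus "tangent (restrict2 x) = d" "transform_step (restrict2 x) = restrict2 y" by auto
qed

lemma resolved_restrict:
  assumes r: "resolved N dir o1 \<Psi> c"
  shows "k \<le> Suc N \<Longrightarrow> strict_transform (restrict2 (\<Psi> 0)) k = restrict2 (\<Psi> k)"
    and "k < N \<Longrightarrow> direction_at (restrict2 (\<Psi> 0)) k = dir k"
    and "direction_at (restrict2 (\<Psi> 0)) N = Some c"
proof -
  note r' = r[unfolded resolved_def blowup_run_def]
  have last: "tangent (restrict2 (\<Psi> N)) = Some c" "transform_step (restrict2 (\<Psi> N)) = restrict2 (\<Psi> (Suc N))"
  proof -
    have "unit_leading (fst (\<Psi> N)) (o1 N)" using r' by simp
    hence "restrict_to W (fst (\<Psi> N)) \<noteq> 0" using restrict_unit_leading leading_nz by blast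
    moreover have "restrict_to W (snd (\<Psi> (Suc N))) $ 0 = 0" using r' by (simp add: restrict_nth_0)
    moreover have "restrict_to W (snd (\<Psi> N)) =
        restrict_to W (fst (\<Psi> N)) * (restrict_to W (snd (\<Psi> (Suc N))) + fps_const c)"
      using r' by (metis restrict_mult restrict_add restrict_const)
    ultimately show "tangent (restrict2 (\<Psi> N)) = Some c"
        "transform_step (restrict2 (\<Psi> N)) = restrict2 (\<Psi> (Suc N))"
      using tangent_step_Some[of "restrict2 (\<Psi> N)" "restrict2 (\<Psi> (Suc N))" c] r' by auto
  qed
  have st: "strict_transform (restrict2 (\<Psi> 0)) k = restrict2 (\<Psi> k)" if "k \<le> Suc N" for k
    using that
  proof (induction k)
    case (Suc k)
    hence IH: "strict_transform (restrict2 (\<Psi> 0)) k = restrict2 (\<Psi> k)" by simp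
    have "transform_step (restrict2 (\<Psi> k)) = restrict2 (\<Psi> (Suc k))"
    proof (cases "k = N")
      case False
      hence "bstep fps_const (dir k) (\<Psi> k) (\<Psi> (Suc k))" using r' Suc.prems by simp
      thus ?thesis by (rule bstep_restrict(2))
    qed (simp add: last)
    thus ?case using IH by (simp add: strict_transform_def)
  qed (simp add: strict_transform_def)
  show "k \<le> Suc N \<Longrightarrow> strict_transform (restrict2 (\<Psi> 0)) k = restrict2 (\<Psi> k)" by (rule st)
  show "k < N \<Longrightarrow> direction_at (restrict2 (\<Psi> 0)) k = dir k"
    using st[of k] bstep_restrict(1)[of "dir k" "\<Psi> k" "\<Psi> (Suc k)"] r' by (simp add: direction_at_def)
  show "direction_at (restrict2 (\<Psi> 0)) N = Some c"
    using st[of N] last by (simp add: direction_at_def)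
qed

end

section \<open>Exceptional components through the centres\<close>

lemma components_bound: "v \<in> components_at \<phi> k \<Longrightarrow> 1 \<le> v \<and> v \<le> k"
proof (induction k arbitrary: v)
  case (Suc k)
  thus ?case by (fastforce simp: components_at_def split: option.splits if_splits)
qed (simp add: components_at_def)

lemma axes_distinct: "fst (axes \<phi> k) = Some v \<Longrightarrow> snd (axes \<phi> k) = Some w \<Longrightarrow> v \<noteq> w"
proof (cases k)
  case (Suc j)
  have b: "x \<le> j" if "fst (axes \<phi> j) = Some x \<or> snd (axes \<phi> j) = Some x" for x
    using components_bound[of x \<phi> j] that by (auto simp: components_at_def)
  assume "fst (axes \<phi> k) = Some v" "snd (axes \<phi> k) = Some w"
  thus "v \<noteq> w" using b[of v] b[of w] by (auto simp: Suc split: option.splits if_splits)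
qed simp

text \<open>A direction \<open>Some c\<close> makes the axis \<open>x = 0\<close> exceptional and
  \<open>None\<close> keeps its status, so only the first step matters.\<close>

lemma first_axis:
  assumes "direction_at \<phi> 0 \<noteq> None" "k > 0"
  shows "fst (axes \<phi> k) \<noteq> None"
  using assms(2)
proof (induction k)
  case (Suc k)
  thus ?case using assms(1) by (cases "k = 0") (auto split: option.splits)
qed simp

lemma components_two:
  assumes "fst (axes \<phi> k) = Some v" "snd (axes \<phi> k) = Some w"
  shows "components_at \<phi> k = {v, w}" "card (components_at \<phi> k) = 2"
  using axes_distinct[OF assms] assms by (simp_all add: components_at_def insert_commute)

text \<open>Two components through the point are too many, and if \<open>x = 0\<close> is the only
  one, transversality requires a first coordinate of order 1.\<close>

lemma not_normal_crossings:
  assumes v: "fst (axes \<phi> k) = Some v"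
    and "snd (axes \<phi> k) \<noteq> None \<or> fst (strict_transform \<phi> k) $ 1 = 0"
  shows "\<not> normal_crossings_at \<phi> k"
proof (cases "snd (axes \<phi> k)")
  case None
  thus ?thesis using assms by (auto simp: normal_crossings_at_def transversal_at_def components_at_def)
next
  case (Some w)
  thus ?thesis using components_two[OF v Some] by (simp add: normal_crossings_at_def)
qed

text \<open>
  The component created last meets the two components through its centre and the strict transform.
\<close>

lemma last_triple_point_eq:
  assumes len: "resolution_length \<phi> = Suc N"
    and two: "card (components_at \<phi> N) = 2" and v: "Suc N \<in> components_at \<phi> (Suc N)"
  shows "last_triple_point \<phi> = Suc N"
proof -
  have "{w. dual_adjacent \<phi> (Suc N) w} = components_at \<phi> N"
    using components_bound[of _ \<phi> N]
    by (auto simp: dual_adjacent_def dual_vertices_def components_meet_def len less_Suc_eq_le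
        dest: le_SucI)
  hence "dual_valence \<phi> (Suc N) = 3" using two v by (simp add: dual_valence_def len)
  thus ?thesis unfolding last_triple_point_def dual_vertices_def len
    by (intro Max_eqI) auto
qed

context branch
begin

abbreviation "\<phi> \<equiv> puiseux_param n s"

lemma family_explicit: "fst (family u) = fps_X ^ n"
  "snd (family u) = coeff_map fps_const base + fps_X ^ bg * fps_const (fps_const u + fps_X)"
proof -
  have "recenter u (if P then 1 else 0) = (if P then 1 else 0)" for P
    by (simp add: recenter.hom_0 recenter.hom_1)
  thus "fst (family u) = fps_X ^ n"
    by (intro fps_ext) (simp add: family_def fam1_def fps_X_power_iff recenter.hom_0 recenter.hom_1)
  show "snd (family u) = coeff_map fps_const base + fps_X ^ bg * fps_const (fps_const u + fps_X)"
    by (intro fps_ext)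
      (simp add: family_def fam2_nth recenter_pCons fps_X_power_mult_nth fps_X_power_iff algebra_simps)
qed

lemma restrict_family:
  assumes "W $ 0 = 0"
  shows "restrict2 W (family u) = puiseux_param n (base + fps_X ^ bg * (fps_const u + W))"
  using restrict_const[OF assms, of u] restrict_w[OF assms]
    restrict_add[OF assms, of "fps_const (fps_const u)" "fps_const fps_X"]
  by (simp add: family_explicit puiseux_param_def restrict_add restrict_mult restrict_X_power
      restrict_coeff_const assms)

lemma branch_decomposition: "s = base + fps_X ^ bg * fps_shift bg s"
  by (simp add: fps_shift_cutoff' add.commute[of "fps_cutoff _ _"])

text \<open>The blow-ups are read off from the family at \<open>u = s $ bg\<close>. At every centre
  up to \<open>N\<close> after the origin the first coordinate has order above 1 or the second axis
  is exceptional, which excludes normal crossings. The last direction \<open>c \<noteq> 0\<close>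
  leaves only the new component, and there the first coordinate has order 1.\<close>

theorem resolution_of_branch:
  obtains N \<Psi> where
    "last_triple_point \<phi> = Suc N" "axes \<phi> (Suc N) = (Some (Suc N), None)"
    "\<Psi> 0 = family (s $ bg)" "\<And>k. k \<le> Suc N \<Longrightarrow> admissible (\<Psi> k)"
    "\<And>k. k \<le> N \<Longrightarrow> \<Psi> k = compose2 (blowup_chart (direction_at \<phi> k)) (\<Psi> (Suc k))"
    "unit_leading (fst (\<Psi> (Suc N))) 1"
    "unit_leading (jac2 (fst (\<Psi> (Suc N))) (snd (\<Psi> (Suc N)))) 0"
    "\<And>U. U $ 0 \<noteq> 0 \<Longrightarrow> meets_transversally \<phi> (puiseux_param n (base + fps_X ^ bg * U)) (Suc N)"
proof -
  obtain N dir o1 where R: "o1 N = (1 :: nat)"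
     "\<forall>k<N. o1 (Suc k) > 1 \<or> dir k = None \<or> dir k = Some 0 \<and> o1 (Suc k) = o1 k"
     "\<And>u. u \<noteq> 0 \<Longrightarrow> \<exists>\<Psi> c. \<Psi> 0 = family u \<and> resolved N dir o1 \<Psi> c"
    using resolution by blast
  \<comment> \<open>Splitting \<open>U\<close> into its constant term \<open>u\<close> and the rest
    \<open>W\<close> exhibits the curve as the restriction to \<open>w = W(t)\<close> of the family
    centred at \<open>u\<close>.\<close>
  have curve: "\<exists>\<Psi> c W. \<Psi> 0 = family (U $ 0) \<and> resolved N dir o1 \<Psi> c \<and> W $ 0 = 0 \<and>
      (\<forall>k\<le>Suc N. strict_transform (puiseux_param n (base + fps_X ^ bg * U)) k = restrict2 W (\<Psi> k)) \<and>
      (\<forall>k<N. direction_at (puiseux_param n (base + fps_X ^ bg * U)) k = dir k) \<and>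
      direction_at (puiseux_param n (base + fps_X ^ bg * U)) N = Some c" if "U $ 0 \<noteq> 0" for U
  proof -
    obtain \<Psi> c where P: "\<Psi> 0 = family (U $ 0)" "resolved N dir o1 \<Psi> c" using R(3) \<open>U $ 0 \<noteq> 0\<close> by blast
    define W where "W = U - fps_const (U $ 0)"
    have W: "W $ 0 = 0" by (simp add: W_def)
    have "restrict2 W (\<Psi> 0) = puiseux_param n (base + fps_X ^ bg * U)"
      unfolding P(1) restrict_family[OF W] by (simp add: W_def)
    thus ?thesis using resolved_restrict[OF W P(2)] P W by auto
  qed
  have s_bg: "s $ bg \<noteq> 0" using s_cb gen_pos by simp
  have shift0: "fps_shift bg s $ 0 = s $ bg" by simp
  with curve[of "fps_shift bg s"] s_bg obtain \<Psi> c W where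
    P: "\<Psi> 0 = family (s $ bg)" "resolved N dir o1 \<Psi> c" "W $ 0 = 0"
      "\<And>k. k \<le> Suc N \<Longrightarrow> strict_transform \<phi> k = restrict2 W (\<Psi> k)"
      "\<And>k. k < N \<Longrightarrow> direction_at \<phi> k = dir k" "direction_at \<phi> N = Some c"
    unfolding branch_decomposition[symmetric] by auto
  note r = P(2)[unfolded resolved_def blowup_run_def]
  have "unit_leading (fst (\<Psi> 0)) (o1 0)" using r by simp
  then obtain p where "leading (fps_X ^ n :: complex fps fps) (o1 0) p" "p dvd 1"
    unfolding P(1) family_explicit unit_leading_def by blast
  moreover from this have "p \<noteq> 0" by auto
  ultimately have h: "(fps_X ^ n :: complex fps fps) $ o1 0 \<noteq> 0" unfolding leading_def by blast
  have o0: "o1 0 = n"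
  proof (rule ccontr)
    assume "o1 0 \<noteq> n"
    thus False using h by (simp add: fps_X_power_iff)
  qed
  have N: "N > 0" using o0 R(1) n_gt_1 by (cases N) auto
  have ord1: "fst (strict_transform \<phi> k) $ 1 = 0" if "k \<le> N" "o1 k > 1" for k
  proof -
    have "unit_leading (fst (\<Psi> k)) (o1 k)" using r that by simp
    from restrict_unit_leading(1)[OF P(3) this] show ?thesis using P(4)[of k] that by (simp add: leading_def)
  qed
  have dir0: "direction_at \<phi> 0 \<noteq> None"
  proof -
    have "fps_X ^ n dvd s" using n_less s_nz by (simp add: fps_dvd_iff)
    thus ?thesis by (simp add: direction_at_def strict_transform_def tangent_def puiseux_param_def)
  qed
  have ax: "o1 k > 1 \<or> snd (axes \<phi> k) \<noteq> None" if "k \<le> N" for k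
    using that
  proof (induction k)
    case 0
    show ?case using o0 n_gt_1 by simp
  next
    case (Suc k)
    hence "k < N" "direction_at \<phi> k = dir k" using P(5) by simp_all
    with R(2) consider "o1 (Suc k) > 1" | "direction_at \<phi> k = None"
      | "direction_at \<phi> k = Some 0" "o1 (Suc k) = o1 k" by metis
    thus ?case using Suc by cases auto
  qed
  have axN: "axes \<phi> (Suc N) = (Some (Suc N), None)" using P(6) r by simp
  have notnc: "\<not> normal_crossings_at \<phi> k" if "k < Suc N" for k
  proof (cases "k = 0")
    case True
    \<comment> \<open>At the origin there are no components yet; normal crossings fail because the
      branch is singular.\<close>
    have "s $ 1 = 0" using n_less n_gt_1 by (intro nth_less_subdegree_zero) simp
    thus ?thesis using True n_gt_1
      by (simp add: normal_crossings_at_def strict_transform_def puiseux_param_def fps_X_power_iff)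
  next
    case False
    then obtain v where "fst (axes \<phi> k) = Some v" using first_axis[OF dir0, of k] by auto
    thus ?thesis using not_normal_crossings ax[of k] ord1[of k] that by (meson less_Suc_eq_le)
  qed
  have tr: "fst (restrict2 W' (\<Psi>' (Suc N))) $ 1 \<noteq> 0"
    if "resolved N dir o1 \<Psi>' c'" "W' $ 0 = 0" for W' \<Psi>' c'
  proof -
    have "unit_leading (fst (\<Psi>' (Suc N))) 1" using that(1) R(1) unfolding resolved_def by auto
    from restrict_unit_leading[OF that(2) this] show ?thesis by (simp add: leading_def)
  qed
  have nc: "normal_crossings_at \<phi> (Suc N)"
    using tr[OF P(2,3)] P(4)[of "Suc N"] axN
    by (simp add: normal_crossings_at_def components_at_def transversal_at_def del: axes.simps)
  have len: "resolution_length \<phi> = Suc N"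
    unfolding resolution_length_def by (rule Least_equality) (use nc notnc not_less in blast)+
  obtain v w where "fst (axes \<phi> N) = Some v" "snd (axes \<phi> N) = Some w"
    using first_axis[OF dir0 N] ax[of N] R(1) by auto
  from components_two(2)[OF this] have ltp: "last_triple_point \<phi> = Suc N"
    using axN by (intro last_triple_point_eq len) (simp_all add: components_at_def del: axes.simps)
  have adm: "admissible (\<Psi> k)" if kN: "k \<le> Suc N" for k
  proof -
    consider "k < N" | "k = N" | "k = Suc N" using kN by linarith
    thus ?thesis
    proof cases
      case 1
      hence "bstep fps_const (dir k) (\<Psi> k) (\<Psi> (Suc k))" using r by simp
      thus ?thesis by (auto simp: bstep_def admissible_def unit_leading_def leading_def)
    next
      case 2
      have "unit_leading (fst (\<Psi> N)) 1" "unit_leading (snd (\<Psi> N)) 1" using r R(1) by auto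
      thus ?thesis using 2 by (auto simp: admissible_def unit_leading_def leading_def)
    next
      case 3
      have "unit_leading (fst (\<Psi> (Suc N))) 1" "snd (\<Psi> (Suc N)) $ 0 $ 0 = 0" using r R(1) by auto
      thus ?thesis using 3 by (auto simp: admissible_def unit_leading_def leading_def)
    qed
  qed
  have chart: "\<Psi> k = compose2 (blowup_chart (direction_at \<phi> k)) (\<Psi> (Suc k))" if "k \<le> N" for k
  proof -
    have a: "admissible (\<Psi> (Suc k))" using adm that by simp
    note s2 = subst2_var_x[OF a] subst2_var_y[OF a] subst2_mult[OF a] subst2_add subst2_const[OF a]
    show ?thesis
    proof (cases "k = N")
      case True
      thus ?thesis using r P(6)
        by (auto simp: compose2_def blowup_chart_def s2[unfolded True] prod_eq_iff)
    next
      case False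
      hence "k < N" using that by simp
      hence "bstep fps_const (direction_at \<phi> k) (\<Psi> k) (\<Psi> (Suc k))" using r P(5) by simp
      thus ?thesis
        by (auto simp: bstep_def compose2_def blowup_chart_def s2 prod_eq_iff split: option.splits)
    qed
  qed
  have meets: "meets_transversally \<phi> (puiseux_param n (base + fps_X ^ bg * U)) (Suc N)" if U0: "U $ 0 \<noteq> 0" for U
  proof -
    let ?\<psi> = "puiseux_param n (base + fps_X ^ bg * U)"
    obtain \<Psi>' c' W' where Q: "resolved N dir o1 \<Psi>' c'" "W' $ 0 = 0"
        "\<And>k. k \<le> Suc N \<Longrightarrow> strict_transform ?\<psi> k = restrict2 W' (\<Psi>' k)"
        "\<And>k. k < N \<Longrightarrow> direction_at ?\<psi> k = dir k" "direction_at ?\<psi> N = Some c'"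
      using curve[OF U0] by blast
    \<comment> \<open>The two curves share all directions before the last one; whether the last ones
      agree or not, the count is \<open>Suc N\<close>.\<close>
    have "common_blowups \<phi> ?\<psi> = Suc N"
      unfolding common_blowups_def len
    proof (rule Least_equality)
      fix m assume "m = Suc N \<or> (\<exists>k. m = Suc k \<and> direction_at ?\<psi> k \<noteq> direction_at \<phi> k)"
      thus "Suc N \<le> m" using Q(4) P(5) by (metis Suc_le_mono linorder_not_le order_refl)
    qed simp
    thus ?thesis using tr[OF Q(1,2)] Q(3)[of "Suc N"] Q(5)
      by (simp add: meets_transversally_def transversal_at_def)
  qed
  have "unit_leading (fst (\<Psi> (Suc N))) 1" using r R(1) by auto
  moreover have "unit_leading (jac2 (fst (\<Psi> (Suc N))) (snd (\<Psi> (Suc N)))) 0" using r by blast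
  ultimately show ?thesis using that ltp axN P(1) adm chart meets by blast
qed

end

section \<open>Dicriticalness in the last triple point\<close>

lemma var_x_power_factor:
  assumes "\<And>j i. i < k \<Longrightarrow> f $ j $ i = 0"
  shows "\<exists>f1. f = var_x ^ k * f1 \<and> (\<forall>j. f1 $ j $ 0 = f $ j $ k)"
proof (intro exI[of _ "Abs_fps (\<lambda>j. fps_shift k (f $ j))"] conjI allI)
  have "f $ j = fps_X ^ k * fps_shift k (f $ j)" for j
    using assms by (intro fps_ext) (simp add: fps_X_power_mult_nth)
  thus "f = var_x ^ k * Abs_fps (\<lambda>j. fps_shift k (f $ j))"
    by (intro fps_ext[where 'a = "complex fps"]) (simp add: var_x_def fps_const_power)
qed simp

text \<open>Cramer's rule with an invertible determinant \<open>j\<close>, arranged so that a common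
  factor \<open>x\<close> of the right-hand sides stays visible.\<close>

lemma solve_linear:
  fixes a :: "'a::comm_ring_1"
  assumes "a * j = p * (x * t) - q * (x * u)" "j * i = 1"
  shows "a = x * ((p * t - q * u) * i)"
proof -
  have "a = (a * j) * i" using assms(2) by (simp add: mult.assoc)
  thus ?thesis by (simp add: assms(1) algebra_simps)
qed

lemma dx2_X: "dx2 (fps_X :: complex fps fps) = 0"
  by (intro fps_ext) (simp add: dx2_def fps_X_def)

text \<open>Models the lifted family at the end of the resolution: a formal local isomorphism that
  takes \<open>t = 0\<close> to the component \<open>x = 0\<close>, since its first entry is
  \<open>t\<close> times a unit.\<close>

locale final_chart =
  fixes V Q :: "complex fps fps"
  assumes V_unit: "V $ 0 dvd 1" and Q0: "Q $ 0 $ 0 = 0" and J: "unit_leading (jac2 (fps_X * V) Q) 0"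
begin

abbreviation "P \<equiv> fps_X * V"

abbreviation "S f \<equiv> subst2 f (P, Q)"

lemma V_nz: "V $ 0 \<noteq> 0" using V_unit by auto

lemma admPQ: "admissible (P, Q)"
  using Q0 by (simp add: admissible_def)

lemma dxP_0: "dx2 P $ 0 = 0"
  by (simp add: dx2_mult dx2_X)

lemma dtP_0: "fps_deriv P $ 0 = V $ 0"
  by simp

lemma dxQ_unit: "dx2 Q $ 0 dvd 1"
proof -
  obtain r where "leading (jac2 P Q) 0 r" "r dvd 1" using J by (auto simp: unit_leading_def)
  hence "V $ 0 * dx2 Q $ 0 dvd 1" by (simp add: leading_def jac2_def dxP_0 dtP_0)
  thus ?thesis by (rule dvd_mult_right)
qed

lemma Q0_1: "Q $ 0 $ 1 \<noteq> 0"
  using dxQ_unit by (simp add: dx2_def fps_unit_iff)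

text \<open>On \<open>t = 0\<close> the substitution is composition with \<open>Q(0,w)\<close>,
  which is nonzero without constant term, so it is injective there.\<close>

lemma S_nth_0_eq_0_iff: "S g $ 0 = 0 \<longleftrightarrow> (\<forall>j. g $ j $ 0 = 0)"
proof -
  have "S g $ 0 = Abs_fps (\<lambda>j. g $ j $ 0) oo (Q $ 0)"
    using subst2_nth_0[OF admPQ] by simp
  moreover have "Q $ 0 \<noteq> 0" using Q0_1 by auto
  ultimately have "S g $ 0 = 0 \<longleftrightarrow> Abs_fps (\<lambda>j. g $ j $ 0) = 0"
    using Q0 by (simp add: fps_compose_eq_0_iff)
  thus ?thesis by (simp add: fps_eq_iff[of "Abs_fps _"])
qed

text \<open>Divisibility by the exceptional equation passes back through the isomorphism without its
  inverse: one factor \<open>x\<close> at a time, the next coefficient of \<open>f\<close> vanishes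
  because its image vanishes on \<open>t = 0\<close>.\<close>

lemma S_divides:
  assumes "S f = fps_X ^ m * g"
  shows "\<exists>f1. f = var_x ^ m * f1 \<and> V ^ m * S f1 = g"
proof -
  have key: "S f = fps_X ^ k * (V ^ k * S f1)" if "f = var_x ^ k * f1" for k f1
    by (simp add: that subst2_mult[OF admPQ] subst2_power[OF admPQ] subst2_var_x[OF admPQ] power_mult_distrib mult.assoc)
  have low: "f $ j $ i = 0" if "i < m" for i j
    using that
  proof (induction i arbitrary: j rule: less_induct)
    case (less k)
    then obtain f1 where f1: "f = var_x ^ k * f1" "\<And>j. f1 $ j $ 0 = f $ j $ k"
      using var_x_power_factor[of k f] by auto
    have "fps_X ^ k * (V ^ k * S f1) = fps_X ^ k * (fps_X ^ (m - k) * g)"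
      using key[OF f1(1)] assms less.prems by (simp flip: power_add mult.assoc)
    moreover have "(fps_X :: complex fps fps) ^ k \<noteq> 0" by simp
    ultimately have "V ^ k * S f1 = fps_X ^ (m - k) * g" using mult_left_cancel by blast
    hence "(V ^ k * S f1) $ 0 = (fps_X ^ (m - k) * g) $ 0" by (simp only:)
    hence "(V $ 0) ^ k * S f1 $ 0 = 0" using less.prems by (simp add: fps_power_zeroth)
    hence "S f1 $ 0 = 0" using V_nz by simp
    hence "f1 $ j $ 0 = 0" using S_nth_0_eq_0_iff by blast
    thus ?case by (simp only: f1(2))
  qed
  then obtain f1 where f1: "f = var_x ^ m * f1" using var_x_power_factor[of m f] by blast
  have "fps_X ^ m * (V ^ m * S f1) = fps_X ^ m * g" using key[OF f1] assms by (simp only:)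
  moreover have "(fps_X :: complex fps fps) ^ m \<noteq> 0" by simp
  ultimately have "V ^ m * S f1 = g" using mult_left_cancel by blast
  thus ?thesis using f1 by blast
qed

text \<open>The first entry of the pull-back is the dw-part. On \<open>t = 0\<close> the derivative
  of \<open>P\<close> by \<open>w\<close> vanishes, so after division by \<open>t^m\<close> this
  part is \<open>B1(0,Q)\<close> times a unit. Conversely, the invertible Jacobian allows both
  coefficients of \<open>\<eta>\<close> to be recovered by Cramer's rule.\<close>

lemma transversal_iff:
  "transversal_to_x_axis_0 \<eta> \<longleftrightarrow> (\<exists>m T1 T2. fst (pullback_form (P, Q) \<eta>) = fps_X ^ m * T1 \<and>
     snd (pullback_form (P, Q) \<eta>) = fps_X ^ m * T2 \<and> T1 $ 0 \<noteq> 0)" (is "?L \<longleftrightarrow> ?R")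
proof
  assume ?L
  then obtain m A1 B1 where AB: "fst \<eta> = var_x ^ m * A1" "snd \<eta> = var_x ^ m * B1" "\<exists>j. B1 $ j $ 0 \<noteq> 0"
    unfolding transversal_to_x_axis_0_def by blast
  have S: "S (var_x ^ m * f) = fps_X ^ m * (V ^ m * S f)" for f
    by (simp add: subst2_mult[OF admPQ] subst2_power[OF admPQ] subst2_var_x[OF admPQ] power_mult_distrib mult.assoc)
  have "fst (pullback_form (P, Q) \<eta>) = fps_X ^ m * (V ^ m * (S A1 * dx2 P + S B1 * dx2 Q))"
    "snd (pullback_form (P, Q) \<eta>) = fps_X ^ m * (V ^ m * (S A1 * dy2 P + S B1 * dy2 Q))"
    by (simp_all only: pullback_form_def AB S fst_conv snd_conv) (simp_all add: algebra_simps)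
  moreover have "(V ^ m * (S A1 * dx2 P + S B1 * dx2 Q)) $ 0 \<noteq> 0"
  proof -
    have "S B1 $ 0 \<noteq> 0" using AB(3) S_nth_0_eq_0_iff by blast
    moreover have "dx2 Q $ 0 \<noteq> 0" using dxQ_unit by auto
    ultimately show ?thesis using V_nz by (simp add: dxP_0 fps_power_zeroth)
  qed
  ultimately show ?R by blast
next
  assume ?R
  then obtain m T1 T2 where T: "S (fst \<eta>) * dx2 P + S (snd \<eta>) * dx2 Q = fps_X ^ m * T1"
     "S (fst \<eta>) * fps_deriv P + S (snd \<eta>) * fps_deriv Q = fps_X ^ m * T2" "T1 $ 0 \<noteq> 0"
    by (auto simp: pullback_form_def dy2_def)
  obtain r where r: "leading (jac2 P Q) 0 r" "r dvd 1" using J by (auto simp: unit_leading_def)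
  then obtain y where y: "r * y = 1" by (metis dvd_def)
  define I where "I = fps_right_inverse (jac2 P Q) y"
  have I: "jac2 P Q * I = 1" unfolding I_def
    by (rule fps_right_inverse) (use r y in \<open>simp add: leading_def\<close>)
  have "S (snd \<eta>) * jac2 P Q = fps_deriv P * (fps_X ^ m * T1) - dx2 P * (fps_X ^ m * T2)"
    unfolding T(1,2)[symmetric] jac2_def by (simp add: algebra_simps)
  from S_divides[OF solve_linear[OF this I]] obtain B1 where
    B1: "snd \<eta> = var_x ^ m * B1" "V ^ m * S B1 = (fps_deriv P * T1 - dx2 P * T2) * I" by blast
  have "S (fst \<eta>) * jac2 P Q = dx2 Q * (fps_X ^ m * T2) - fps_deriv Q * (fps_X ^ m * T1)"
    unfolding T(1,2)[symmetric] jac2_def by (simp add: algebra_simps)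
  from S_divides[OF solve_linear[OF this I]] obtain A1 where A1: "fst \<eta> = var_x ^ m * A1" by blast
  have I0: "I $ 0 \<noteq> 0" using arg_cong[OF I, of "\<lambda>f. f $ 0"] by auto
  have "(V ^ m * S B1) $ 0 = V $ 0 * T1 $ 0 * I $ 0"
    unfolding B1(2) by (simp add: dxP_0 dtP_0 del: fps_deriv_nth)
  hence "(V ^ m * S B1) $ 0 \<noteq> 0" using I0 T(3) V_nz by simp
  hence "S B1 $ 0 \<noteq> 0" by auto
  hence "\<exists>j. B1 $ j $ 0 \<noteq> 0" using S_nth_0_eq_0_iff by blast
  thus ?L unfolding transversal_to_x_axis_0_def using A1 B1(1) by blast
qed

end

lemma admissible_blowup_chart: "admissible (blowup_chart d)"
  by (cases d) (simp_all add: admissible_def blowup_chart_def var_x_def var_y_def)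

context branch
begin

text \<open>The charts and the lift compose to the family, so by contravariance the pull-back of the
  total transform under the lift is the pull-back of the form along the family, where transversality
  is decided.\<close>

theorem dicritical_iff:
  "dicritical_in \<phi> \<omega> (last_triple_point \<phi>) \<longleftrightarrow>
     (\<exists>m T1 T2. fst (pullback_form (family (s $ bg)) (fps_of_poly (fst \<omega>), fps_of_poly (snd \<omega>))) = fps_X ^ m * T1 \<and>
        snd (pullback_form (family (s $ bg)) (fps_of_poly (fst \<omega>), fps_of_poly (snd \<omega>))) = fps_X ^ m * T2 \<and>
        T1 $ 0 \<noteq> 0)"
proof -
  obtain N \<Psi> where R: "last_triple_point \<phi> = Suc N" "axes \<phi> (Suc N) = (Some (Suc N), None)"
    "\<Psi> 0 = family (s $ bg)" "\<And>k. k \<le> Suc N \<Longrightarrow> admissible (\<Psi> k)"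
    "\<And>k. k \<le> N \<Longrightarrow> \<Psi> k = compose2 (blowup_chart (direction_at \<phi> k)) (\<Psi> (Suc k))"
    "unit_leading (fst (\<Psi> (Suc N))) 1"
    "unit_leading (jac2 (fst (\<Psi> (Suc N))) (snd (\<Psi> (Suc N)))) 0"
    using resolution_of_branch by metis
  let ?\<omega> = "(fps_of_poly (fst \<omega>), fps_of_poly (snd \<omega>))"
  have "k \<le> Suc N \<Longrightarrow> pullback_form (\<Psi> k) (total_transform \<phi> ?\<omega> k) = pullback_form (\<Psi> 0) ?\<omega>" for k
  proof (induction k)
    case (Suc k)
    have "pullback_form (\<Psi> (Suc k)) (total_transform \<phi> ?\<omega> (Suc k)) =
        pullback_form (compose2 (blowup_chart (direction_at \<phi> k)) (\<Psi> (Suc k))) (total_transform \<phi> ?\<omega> k)"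
      using pullback_pullback[OF admissible_blowup_chart R(4)[OF Suc.prems]] by simp
    also have "\<dots> = pullback_form (\<Psi> k) (total_transform \<phi> ?\<omega> k)" using R(5)[of k] Suc.prems by simp
    finally show ?case using Suc by simp
  qed simp
  hence eq: "pullback_form (fst (\<Psi> (Suc N)), snd (\<Psi> (Suc N))) (total_transform \<phi> ?\<omega> (Suc N)) =
      pullback_form (family (s $ bg)) ?\<omega>"
    using R(3) by (simp del: total_transform.simps)
  obtain V where V: "fst (\<Psi> (Suc N)) = fps_X * V" "V $ 0 dvd 1"
    using R(6) unfolding unit_leading_def leading_iff by auto
  interpret final_chart V "snd (\<Psi> (Suc N))"
    using R(4)[of "Suc N"] R(7) V by unfold_locales (auto simp: admissible_def)
  have "dicritical_in \<phi> \<omega> (last_triple_point \<phi>) \<longleftrightarrow>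
      transversal_to_x_axis_0 (total_transform \<phi> ?\<omega> (Suc N))"
    unfolding dicritical_in_def Let_def R(1,2) by simp
  thus ?thesis unfolding transversal_iff eq[unfolded V] .
qed

end

section \<open>Convergence of the series involved\<close>

lemma convergent_add: "f \<in> convergent_series \<Longrightarrow> g \<in> convergent_series \<Longrightarrow> f + g \<in> convergent_series"
  and convergent_diff: "f \<in> convergent_series \<Longrightarrow> g \<in> convergent_series \<Longrightarrow> f - g \<in> convergent_series"
  and convergent_mult: "f \<in> convergent_series \<Longrightarrow> g \<in> convergent_series \<Longrightarrow> f * g \<in> convergent_series"
  using fps_conv_radius_add[of f g] fps_conv_radius_diff[of f g] fps_conv_radius_mult[of f g]
  by (auto simp: convergent_series_def min_def split: if_splits)

lemma convergent_of_poly: "fps_of_poly p \<in> convergent_series"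
  by (simp add: convergent_series_def)

lemma convergent_const: "fps_const c \<in> convergent_series"
  and convergent_0: "0 \<in> convergent_series"
  and convergent_X_power: "fps_X ^ k \<in> convergent_series"
  by (simp_all add: convergent_series_def)

lemma convergent_cutoff: "fps_cutoff k f \<in> convergent_series"
proof -
  have "fps_cutoff k f = fps_of_poly (Poly (map (fps_nth f) [0..<k]))"
    by (intro fps_ext) (simp add: nth_default_def)
  thus ?thesis by (simp add: convergent_of_poly)
qed

lemma convergent_shift: "f \<in> convergent_series \<Longrightarrow> fps_shift k f \<in> convergent_series"
  by (simp add: convergent_series_def)

lemma convergent_deriv: "f \<in> convergent_series \<Longrightarrow> fps_deriv f \<in> convergent_series"
  using fps_conv_radius_deriv[of f] by (simp add: convergent_series_def)

lemma convergent_sum: "(\<And>x. x \<in> A \<Longrightarrow> f x \<in> convergent_series) \<Longrightarrow> sum f A \<in> convergent_series"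
  by (induction A rule: infinite_finite_induct) (auto intro: convergent_add convergent_0)

lemma convergent_compose_X_power:
  assumes "n > 0" "a \<in> convergent_series"
  shows "a oo fps_X ^ n \<in> convergent_series"
proof -
  obtain \<rho> C where *: "\<rho> > 0" "\<And>K. trunc_norm K \<rho> a \<le> C"
    using assms by (auto simp: convergent_series_iff)
  \<comment> \<open>The radius is at most 1, so that
    \<open>r ^ n \<le> r \<le> \<rho>\<close>.\<close>
  define r where "r = min \<rho> 1"
  have r: "r > 0" "r \<le> 1" "r \<le> \<rho>" using * by (simp_all add: r_def)
  have "r ^ n \<le> r" using r assms(1) power_decreasing[of 1 n r] by simp
  have "trunc_norm K r (a oo fps_X ^ n) \<le> C" for K
  proof -
    have "trunc_norm K r (a oo fps_X ^ n) = (\<Sum>k\<in>{k. k < K \<and> n dvd k}. norm (a $ (k div n)) * r ^ k)"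
      unfolding trunc_norm_def fps_nth_compose_X_power by (intro sum.mono_neutral_cong_right) auto
    also have "\<dots> = (\<Sum>j\<in>{j. n * j < K}. norm (a $ j) * (r ^ n) ^ j)"
      using assms(1) by (intro sum.reindex_bij_witness[of _ "\<lambda>j. n * j" "\<lambda>k. k div n"])
        (auto simp: power_mult)
    also have "\<dots> \<le> (\<Sum>j<K. norm (a $ j) * (r ^ n) ^ j)"
      using r assms(1) by (intro sum_mono2) (auto elim: le_less_trans[rotated])
    also have "\<dots> \<le> trunc_norm K \<rho> a"
      using trunc_norm_mono_radius[of "r ^ n" \<rho> K a] r \<open>r ^ n \<le> r\<close> by (simp add: trunc_norm_def)
    finally show ?thesis using *(2)[of K] by simp
  qed
  thus ?thesis using r by (auto simp: convergent_series_iff)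
qed

lemma convergent_polysI: "(\<And>j. coeff G j \<in> convergent_series) \<Longrightarrow> G \<in> convergent_polys"
  and convergent_polysD: "G \<in> convergent_polys \<Longrightarrow> coeff G j \<in> convergent_series"
  by (simp_all add: convergent_polys_def)

lemma convergent_polys_add: "f \<in> convergent_polys \<Longrightarrow> g \<in> convergent_polys \<Longrightarrow> f + g \<in> convergent_polys"
  and convergent_polys_diff: "f \<in> convergent_polys \<Longrightarrow> g \<in> convergent_polys \<Longrightarrow> f - g \<in> convergent_polys"
  and convergent_polys_mult: "f \<in> convergent_polys \<Longrightarrow> g \<in> convergent_polys \<Longrightarrow> f * g \<in> convergent_polys"
  by (auto intro!: convergent_polysI convergent_add convergent_diff convergent_mult convergent_sum
      simp: coeff_mult dest: convergent_polysD)

lemma convergent_polys_0: "0 \<in> convergent_polys"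
  by (simp add: convergent_polys_def convergent_0)

lemma convergent_polys_of_nat: "of_nat k \<in> convergent_polys"
  unfolding of_nat_poly convergent_poly_pCons fps_of_nat[symmetric]
  by (simp add: convergent_polys_0 convergent_const)

lemma convergent_polys_pderiv: "G \<in> convergent_polys \<Longrightarrow> pderiv G \<in> convergent_polys"
  by (intro convergent_polysI) (auto simp: coeff_pderiv fps_of_nat[symmetric] simp del: of_nat_Suc
      intro!: convergent_mult convergent_const dest: convergent_polysD)

lemma convergent_polys_dx: "G \<in> convergent_polys \<Longrightarrow> dx_poly G \<in> convergent_polys"
  by (intro convergent_polysI) (auto simp: dx_poly_def coeff_map_poly intro!: convergent_deriv dest: convergent_polysD)

lemma convergent_polys_subst_u:
  assumes n: "n > 0" and S: "S \<in> convergent_series"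
  shows "G \<in> convergent_polys \<Longrightarrow> subst_u n S b G \<in> convergent_polys"
proof (induction G)
  case (pCons a G)
  thus ?case unfolding subst_u_pCons[OF n]
    by (intro convergent_polys_add convergent_polys_mult)
      (auto simp: convergent_poly_pCons convergent_polys_0 S convergent_X_power n intro!: convergent_compose_X_power)
qed (simp add: n convergent_polys_0)

lemma convergent_omega:
  assumes "\<And>G. G \<in> convergent_polys \<Longrightarrow> D G \<in> convergent_polys"
    "K \<in> convergent_polys" "L \<in> convergent_polys" "H1 \<in> convergent_polys" "H2 \<in> convergent_polys"
  shows "omega_coeff D p q K L H1 H2 \<in> convergent_polys"
  unfolding omega_coeff_def using assms
  by (intro convergent_polys_add convergent_polys_diff convergent_polys_mult convergent_polys_of_nat) auto

lemma poly_nth_0: "poly A U $ 0 = poly (map_poly (\<lambda>f. f $ 0) A) (U $ 0)" for A :: "complex fps poly"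
  by (induction A) (simp_all add: map_poly_pCons)

lemma leading_by_t_divide:
  assumes "leading (by_t A) m p"
  shows "A = smult (fps_X ^ m) (map_poly (fps_shift m) A)"
    and "map_poly (\<lambda>f. f $ 0) (map_poly (fps_shift m) A) = p"
proof -
  have low: "coeff A l $ i = 0" if "i < m" for l i
    using assms that by (simp add: leading_def flip: by_t_nth)
  show "A = smult (fps_X ^ m) (map_poly (fps_shift m) A)"
    by (intro poly_eqI fps_ext) (simp add: coeff_map_poly fps_X_power_mult_nth low)
  show "map_poly (\<lambda>f. f $ 0) (map_poly (fps_shift m) A) = p"
    using assms by (intro poly_eqI) (simp add: coeff_map_poly leading_def flip: by_t_nth)
qed

lemma leading_poly_curve:
  assumes "leading (by_t A) m p"
  shows "leading (poly A U) m (poly p (U $ 0))"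
  unfolding leading_iff
  using leading_by_t_divide[OF assms] poly_nth_0[of "map_poly (fps_shift m) A" U]
  by (metis poly_smult)

section \<open>The pull-back of the form along the family\<close>

lemma dx_poly_add: "dx_poly (A + B) = dx_poly A + dx_poly B"
  by (intro poly_eqI) (simp add: dx_poly_def coeff_map_poly)

lemma by_t_inject: "by_t A = by_t B \<longleftrightarrow> A = B"
  using by_t_eq_0_iff[of "A - B"] by (simp add: by_t_diff)

lemma dx_poly_mult: "dx_poly (A * B) = dx_poly A * B + A * dx_poly B"
  unfolding by_t_inject[symmetric] by (simp add: by_t_dx by_t_mult by_t_add add.commute)

lemma dx_poly_pCons: "dx_poly (pCons a A) = pCons (fps_deriv a) (dx_poly A)"
  by (simp add: dx_poly_def map_poly_pCons)

lemma dx_poly_0 [simp]: "dx_poly 0 = 0"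
  by (simp add: dx_poly_def)

context
  fixes n :: nat and S :: "complex fps" and b :: nat
  assumes n: "n > 0"
begin

lemma pderiv_subst_u: "pderiv (subst_u n S b G) = subst_u n S b (pderiv G) * [:fps_X ^ b:]"
proof -
  have "pderiv (map_poly (\<lambda>a. a oo fps_X ^ n) G) = map_poly (\<lambda>a. a oo fps_X ^ n) (pderiv G)"
  proof (intro poly_eqI)
    have "(of_nat k * a) oo fps_X ^ n = of_nat k * (a oo fps_X ^ n)" for k and a :: "complex fps"
      by (simp add: fps_compose_mult_distrib[OF Xn_0[OF n]] flip: fps_of_nat)
    thus "coeff (pderiv (map_poly (\<lambda>a. a oo fps_X ^ n) G)) l =
        coeff (map_poly (\<lambda>a. a oo fps_X ^ n) (pderiv G)) l" for l
      by (simp add: coeff_pderiv coeff_map_poly del: of_nat_Suc)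
  qed
  thus ?thesis by (simp add: subst_u_def pderiv_pcompose pderiv_pCons)
qed

lemma dx_subst_u: "dx_poly (subst_u n S b G) =
    subst_u n S b (dx_poly G) * [:fps_deriv (fps_X ^ n):] +
    subst_u n S b (pderiv G) * dx_poly [:S, fps_X ^ b:]"
proof (induction G)
  case 0
  show ?case by (simp add: n)
next
  case (pCons a G)
  have "dx_poly [:a oo fps_X ^ n:] = [:fps_deriv a oo fps_X ^ n:] * [:fps_deriv (fps_X ^ n):]"
    using fps_compose_deriv[OF Xn_0[OF n], of a] by (simp add: dx_poly_pCons)
  moreover have "subst_u n S b (pCons 0 (pderiv G)) = [:S, fps_X ^ b:] * subst_u n S b (pderiv G)"
    by (simp add: subst_u_pCons n)
  ultimately show ?case unfolding subst_u_pCons[OF n] dx_poly_add dx_poly_mult pCons.IH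
      pderiv_pCons subst_u_add[OF n] dx_poly_pCons[of a G]
    by (simp only: ring_distribs mult_ac add_ac)
qed

end

text \<open>The derivatives of a pull-back are the same linear combinations of
  \<open>h (dx_poly G)\<close> and \<open>h (pderiv G)\<close> for every \<open>G\<close>, and
  \<open>omega_coeff\<close> is linear in the derivation. So the dt- and du-parts are again given by
  \<open>omega_coeff\<close>, applied to the pulled back functions.\<close>

lemma omega_subst_u:
  fixes S :: "complex fps" and b n p q :: nat and K L H1 H2 :: "complex fps poly"
  assumes n: "n > 0"
  defines "h \<equiv> subst_u n S b"
  defines "A \<equiv> omega_coeff dx_poly p q K L H1 H2" and "B \<equiv> omega_coeff pderiv p q K L H1 H2"
  shows "omega_coeff dx_poly p q (h K) (h L) (h H1) (h H2) =
      h A * [:fps_deriv (fps_X ^ n):] + h B * dx_poly [:S, fps_X ^ b:]"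
    and "omega_coeff pderiv p q (h K) (h L) (h H1) (h H2) = h B * [:fps_X ^ b:]"
proof -
  have nat: "h (of_nat k) = of_nat k" for k
    by (induction k) (simp_all add: h_def subst_u_add n subst_u_1)
  have minus: "h (x - y) = h x - h y" for x y
    using subst_u_add[OF n, of S b "x - y" y] by (simp add: h_def)
  have hom: "h (omega_coeff D p q K L H1 H2) =
      h H1 * (of_nat p * h K * h (D L) - of_nat q * h L * h (D K)) + h (D H2)" for D
    unfolding omega_coeff_def by (simp add: h_def subst_u_add subst_u_mult n minus[unfolded h_def] nat[unfolded h_def])
  have dxh: "dx_poly (h G) = h (dx_poly G) * [:fps_deriv (fps_X ^ n):] + h (pderiv G) * dx_poly [:S, fps_X ^ b:]"
    and puh: "pderiv (h G) = h (pderiv G) * [:fps_X ^ b:]" for G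
    unfolding h_def by (rule dx_subst_u[OF n], rule pderiv_subst_u[OF n])
  have alg: "h1 * (p' * k * (l1 * x + l2 * y) - q' * l * (k1 * x + k2 * y)) + (m1 * x + m2 * y) =
      (h1 * (p' * k * l1 - q' * l * k1) + m1) * x + (h1 * (p' * k * l2 - q' * l * k2) + m2) * y"
    for h1 p' k l1 x l2 y q' l k1 k2 m1 m2 :: "complex fps poly"
    by (simp add: algebra_simps)
  have alg': "h1 * (p' * k * (l2 * y) - q' * l * (k2 * y)) + m2 * y =
      (h1 * (p' * k * l2 - q' * l * k2) + m2) * y"
    for h1 p' k l2 y q' l k2 m2 :: "complex fps poly"
    by (simp add: algebra_simps)
  show "omega_coeff dx_poly p q (h K) (h L) (h H1) (h H2) =
      h A * [:fps_deriv (fps_X ^ n):] + h B * dx_poly [:S, fps_X ^ b:]"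
    unfolding A_def B_def hom unfolding omega_coeff_def dxh alg ..
  show "omega_coeff pderiv p q (h K) (h L) (h H1) (h H2) = h B * [:fps_X ^ b:]"
    unfolding B_def hom unfolding omega_coeff_def puh alg' ..
qed

lemma leading_zero_step: "leading f m 0 \<Longrightarrow> leading f (Suc m) (f $ Suc m)"
  by (auto simp: leading_def less_Suc_eq)

lemma dx2_recenter: "dx2 (coeff_map (recenter u) f) = coeff_map (recenter u) (pd_u f)"
  by (intro fps_ext) (simp add: dx2_def recenter_def pderiv_pcompose pderiv_pCons flip: fps_of_poly_pderiv)

lemma dy2_recenter: "dy2 (coeff_map (recenter u) f) = coeff_map (recenter u) (fps_deriv f)"
proof (rule fps_ext)
  fix i
  have "recenter u (of_nat k) = of_nat k" for k
    by (induction k) (simp_all add: recenter.hom_0 recenter.hom_1 recenter.hom_add)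
  thus "dy2 (coeff_map (recenter u) f) $ i = coeff_map (recenter u) (fps_deriv f) $ i"
    by (simp add: dy2_def recenter.hom_mult del: of_nat_Suc)
qed

context branch
begin

abbreviation "E u A \<equiv> coeff_map (recenter u) (by_t A)"

lemma family_eq: "family u = (E u [:fps_X ^ n:], E u [:base, fps_X ^ bg:])"
  by (simp add: family_def fam1_eq fam2_def)

lemma E_mult: "E u (A * B) = E u A * E u B" and E_add: "E u (A + B) = E u A + E u B"
  by (simp_all add: by_t_mult by_t_add recenter.coeff_map_mult recenter.coeff_map_add)

lemma base_0: "base $ 0 = 0"
proof -
  have "0 < subdegree s" using n_less by linarith
  hence "s $ 0 = 0" by (rule nth_less_subdegree_zero)
  thus ?thesis by simp
qed

lemma bg_pos: "bg > 0" using cb_pos by simp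

lemma admissible_family: "admissible (family u)"
  using base_0 bg_pos n_pos
  by (simp add: admissible_def family_explicit)

lemma subst2_const_family: "subst2 (fps_const a) (family u) = E u [:a oo fps_X ^ n:]"
proof (intro fps_ext)
  fix i j
  have "subst2 (fps_const a) (family u) $ j $ i =
      (\<Sum>p\<le>i + j. \<Sum>q\<le>i + j. if q = 0 then a $ p * ((fps_X ^ n) ^ p :: complex fps fps) $ j $ i else 0)"
    unfolding subst2_nth family_explicit(1)
  proof (intro sum.cong refl)
    fix p q
    show "fps_const a $ q $ p * ((fps_X ^ n) ^ p * snd (family u) ^ q) $ j $ i =
        (if q = 0 then a $ p * ((fps_X ^ n) ^ p :: complex fps fps) $ j $ i else 0)"
      by (cases "q = 0") (simp_all only: fps_nth_fps_const power_0 mult_1_right if_True if_False fps_zero_nth mult_zero_left refl)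
  qed
  also have "\<dots> = (\<Sum>p\<le>i + j. a $ p * ((fps_X ^ n) ^ p :: complex fps fps) $ j $ i)"
    by (intro sum.cong refl) simp
  also have "\<dots> = (\<Sum>p\<le>i + j. if p = j div n \<and> n dvd j \<and> i = 0 then a $ p else 0)"
  proof (intro sum.cong refl)
    fix p
    have "(fps_X ^ n) ^ p = (fps_X ^ (n * p) :: complex fps fps)" by (simp only: power_mult)
    hence "((fps_X ^ n) ^ p :: complex fps fps) $ j $ i = (if j = n * p \<and> i = 0 then 1 else 0)"
      by (simp only: fps_X_power_nth) simp
    moreover have "j = n * p \<longleftrightarrow> p = j div n \<and> n dvd j" using n_pos by auto
    ultimately show "a $ p * ((fps_X ^ n) ^ p :: complex fps fps) $ j $ i =
        (if p = j div n \<and> n dvd j \<and> i = 0 then a $ p else 0)" by simp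
  qed
  also have "\<dots> = (if n dvd j \<and> i = 0 then a $ (j div n) else 0)"
  proof -
    have "j div n \<le> i + j" by (meson div_le_dividend trans_le_add2)
    thus ?thesis
    proof (cases "n dvd j \<and> i = 0")
      case False
      have "(\<Sum>p\<le>i + j. if p = j div n \<and> n dvd j \<and> i = 0 then a $ p else 0) = 0"
        by (intro sum.neutral ballI) (use False in auto)
      thus ?thesis using False by auto
    qed simp
  qed
  also have "\<dots> = E u [:a oo fps_X ^ n:] $ j $ i"
    by (simp only: coeff_map_nth by_t_const_nth recenter_const fps_nth_compose_X_power fps_nth_fps_const)
      auto
  finally show "subst2 (fps_const a) (family u) $ j $ i = E u [:a oo fps_X ^ n:] $ j $ i" .
qed

text \<open>Joins the two descriptions of the family: substitution into two-variable series, and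
  polynomials in \<open>u\<close> over \<open>\<complex>[[t]]\<close> expanded at
  \<open>u\<close>.\<close>

lemma subst2_family: "subst2 (fps_of_poly G) (family u) = E u (hat G)"
proof (induction G)
  case (pCons a G)
  have "fps_of_poly (pCons a G) = fps_const a + var_y * fps_of_poly G"
    by (simp add: fps_of_poly_pCons var_y_def mult.commute)
  hence "subst2 (fps_of_poly (pCons a G)) (family u) = E u [:a oo fps_X ^ n:] + snd (family u) * E u (hat G)"
    by (simp only: subst2_add subst2_mult[OF admissible_family] subst2_var_y[OF admissible_family]
        subst2_const_family pCons.IH)
  thus ?case by (simp only: subst_u_pCons[OF n_pos] E_mult E_add family_eq snd_conv)
qed (simp add: n_pos recenter.hom_0 fps_eq_iff)

lemma pullback_family:
  "pullback_form (family u) (fps_of_poly A, fps_of_poly B) =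
     (E u (hat B * [:fps_X ^ bg:]), E u (hat A * [:fps_deriv (fps_X ^ n):] + hat B * dx_poly [:base, fps_X ^ bg:]))"
proof -
  have "pderiv [:fps_X ^ n :: complex fps:] = 0" "pderiv [:base, fps_X ^ bg:] = [:fps_X ^ bg:]"
    by (simp_all add: pderiv_pCons)
  moreover have "dx_poly [:fps_X ^ n:] = [:fps_deriv (fps_X ^ n):]"
    by (simp add: dx_poly_pCons)
  moreover have "E u 0 = 0" by (intro fps_ext) (simp add: recenter.hom_0)
  ultimately show ?thesis
    unfolding pullback_form_def fst_conv snd_conv subst2_family
    unfolding family_eq fst_conv snd_conv dx2_recenter dy2_recenter by_t_pderiv[symmetric] by_t_dx[symmetric]
    by (simp only: E_mult E_add mult_zero_right add_0)
qed

text \<open>The given branch is the curve \<open>u = fps_shift bg s\<close> in the family. Its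
  constant term \<open>s $ bg\<close> is not zero, so the factor \<open>u^k\<close> of the leading
  coefficient survives.\<close>

lemma intersection_hat:
  "leading (by_t (hat H)) m (monom \<kappa> k) \<Longrightarrow> \<kappa> \<noteq> 0 \<Longrightarrow> intersection_mult \<phi> H = enat m"
  "intersection_mult \<phi> 0 = \<infinity>"
proof -
  have ev: "eval_param H \<phi> = poly (hat H) (fps_shift bg s)" for H
    using subst_u_eval[OF n_pos, of base bg H "fps_shift bg s"] branch_decomposition by simp
  show "intersection_mult \<phi> 0 = \<infinity>" by (simp add: intersection_mult_def eval_param_def)
  assume l: "leading (by_t (hat H)) m (monom \<kappa> k)" and \<kappa>: "\<kappa> \<noteq> 0"
  have c: "fps_shift bg s $ 0 \<noteq> 0" using s_cb gen_pos by simp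
  from leading_poly_curve[OF l, of "fps_shift bg s"]
  have le: "leading (poly (hat H) (fps_shift bg s)) m (\<kappa> * (fps_shift bg s $ 0) ^ k)"
    by (simp add: poly_monom)
  have nz: "\<kappa> * (fps_shift bg s $ 0) ^ k \<noteq> 0" using \<kappa> c by simp
  show "intersection_mult \<phi> H = enat m"
    using leading_nz[OF le nz] leading_subdegree[OF le nz] by (simp add: intersection_mult_def ev)
qed

section \<open>Leading terms of the pulled back form\<close>

definition "omega_t i H1 H2 = omega_coeff dx_poly (val i) (val gen) (hat (Fs i)) (hat (Fs gen)) (hat H1) (hat H2)"
definition "omega_u i H1 H2 = omega_coeff pderiv (val i) (val gen) (hat (Fs i)) (hat (Fs gen)) (hat H1) (hat H2)"

lemma dicritical_omega_iff:
  "dicritical_in \<phi> (omega_form n s Fs i H1 H2) (last_triple_point \<phi>) \<longleftrightarrow>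
     (\<exists>m T1 T2. E (s $ bg) (omega_u i H1 H2) = fps_X ^ m * T1 \<and>
        E (s $ bg) (omega_t i H1 H2) = fps_X ^ m * T2 \<and> T1 $ 0 \<noteq> 0)"
  unfolding dicritical_iff omega_form_def Let_def fst_conv snd_conv pullback_family
    omega_t_def omega_u_def omega_subst_u[OF n_pos] ..

text \<open>With leading terms \<open>b t^(val i)\<close> and \<open>a u t^(val gen)\<close> of the
  semiroots, the dt-part of the bracket cancels in order \<open>val i + val gen - 1\<close>, and its
  du-part has the leading coefficient \<open>val i * b * a\<close>. For the dt-part a lower bound of
  the order suffices, so \<open>x\<close> may be zero.\<close>

lemma leading_omega_main:
  assumes i: "i < gen" and h1: "leading (by_t (hat H1)) m1 (monom \<kappa> k)" "\<kappa> \<noteq> 0"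
  defines "m0 \<equiv> m1 + val i + val gen"
  shows "\<exists>x. leading (by_t (omega_t i H1 0)) m0 x"
    and "\<exists>\<kappa>'. \<kappa>' \<noteq> 0 \<and> leading (by_t (omega_u i H1 0)) m0 (monom \<kappa>' k)"
proof -
  let ?f = "by_t (hat (Fs i))" and ?g = "by_t (hat (Fs gen))" and ?h = "by_t (hat H1)"
  obtain b where b: "b \<noteq> 0" "leading ?f (val i) [:b:]"
  proof (cases "i = 0")
    case True
    thus ?thesis using that[of 1] leading_hat_Fs_0 by simp
  next
    case False
    thus ?thesis using that leading_hat_Fs[of i] i by auto
  qed
  obtain a where a: "a \<noteq> 0" "leading ?g (val gen) [:0, a:]"
    using leading_hat_Fs[of gen] gen_pos by auto
  have vi: "val i > 0" and vg: "val gen > 0" using val_pos i by auto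
  have eqs: "by_t (omega_t i H1 0) = ?h * (of_nat (val i) * ?f * fps_deriv ?g - of_nat (val gen) * ?g * fps_deriv ?f)"
      "by_t (omega_u i H1 0) = ?h * (of_nat (val i) * ?f * pd_u ?g - of_nat (val gen) * ?g * pd_u ?f)"
    unfolding omega_t_def omega_u_def omega_coeff_def
    by (simp_all add: by_t_mult by_t_add by_t_diff by_t_of_nat n_pos flip: by_t_dx by_t_pderiv)
  let ?p1 = "of_nat (val i) * [:b:] * (of_nat (val gen) * [:0, a:])"
  let ?p2 = "of_nat (val gen) * [:0, a:] * (of_nat (val i) * [:b:])"
  have "leading (of_nat (val i) * ?f * fps_deriv ?g) (0 + val i + (val gen - 1)) ?p1"
    by (intro leading_mult leading_of_nat b leading_deriv' a vg)
  moreover have "leading (of_nat (val gen) * ?g * fps_deriv ?f) (0 + val gen + (val i - 1)) ?p2"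
    by (intro leading_mult leading_of_nat a leading_deriv' b vi)
  moreover have "0 + val i + (val gen - 1) = val i + val gen - 1" "0 + val gen + (val i - 1) = val i + val gen - 1"
    using vi vg by simp_all
  moreover have "?p1 - ?p2 = 0" by (simp add: mult_ac)
  ultimately have "leading (of_nat (val i) * ?f * fps_deriv ?g - of_nat (val gen) * ?g * fps_deriv ?f)
      (val i + val gen - 1) 0"
    using leading_diff by metis
  from leading_zero_step[OF this] obtain x where
    "leading (of_nat (val i) * ?f * fps_deriv ?g - of_nat (val gen) * ?g * fps_deriv ?f) (val i + val gen) x"
    using vi by auto
  from leading_mult[OF h1(1) this] show "\<exists>x. leading (by_t (omega_t i H1 0)) m0 x"
    unfolding eqs m0_def by (auto simp: add.assoc)
  have "leading (of_nat (val i) * ?f * pd_u ?g) (0 + val i + val gen) (of_nat (val i) * [:b:] * pderiv [:0, a:])"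
    by (intro leading_mult leading_of_nat b leading_pd_u a)
  moreover have "leading (of_nat (val gen) * ?g * pd_u ?f) (0 + val gen + val i) (of_nat (val gen) * [:0, a:] * pderiv [:b:])"
    by (intro leading_mult leading_of_nat b leading_pd_u a)
  moreover have "of_nat (val i) * [:b:] * pderiv [:0, a:] - of_nat (val gen) * [:0, a:] * pderiv [:b:] =
      [:of_nat (val i) * b * a:]"
    by (simp add: of_nat_poly pderiv_pCons)
  moreover have "0 + val gen + val i = 0 + val i + val gen" by simp
  ultimately have "leading (of_nat (val i) * ?f * pd_u ?g - of_nat (val gen) * ?g * pd_u ?f)
      (0 + val i + val gen) [:of_nat (val i) * b * a:]"
    using leading_diff by metis
  from leading_mult[OF h1(1) this]
  have "leading (by_t (omega_u i H1 0)) m0 (monom (of_nat (val i) * b * a * \<kappa>) k)"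
    unfolding eqs m0_def by (simp add: add.assoc smult_monom mult.commute)
  moreover have "of_nat (val i) * b * a * \<kappa> \<noteq> 0" using a b h1 vi by simp
  ultimately show "\<exists>\<kappa>'. \<kappa>' \<noteq> 0 \<and> leading (by_t (omega_u i H1 0)) m0 (monom \<kappa>' k)" by blast
qed

lemma omega_split:
  "by_t (omega_t i H1 H2) = by_t (omega_t i H1 0) + fps_deriv (by_t (hat H2))"
  "by_t (omega_u i H1 H2) = by_t (omega_u i H1 0) + pd_u (by_t (hat H2))"
  unfolding omega_t_def omega_u_def omega_coeff_def
  by (simp_all add: by_t_add n_pos flip: by_t_dx by_t_pderiv)

text \<open>In this range \<open>dH2\<close> leaves the leading term of the du-part alone; its
  dt-part may reach the same order, which does no harm.\<close>

lemma leading_omega_dicritical: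
  assumes i: "i < gen" and h1: "leading (by_t (hat H1)) m1 (monom \<kappa> k)" "\<kappa> \<noteq> 0"
    and h2: "\<And>j. j \<le> m1 + val i + val gen \<Longrightarrow> by_t (hat H2) $ j = 0"
  shows "\<exists>m x \<kappa>'. \<kappa>' \<noteq> 0 \<and> leading (by_t (omega_t i H1 H2)) m x \<and>
     leading (by_t (omega_u i H1 H2)) m (monom \<kappa>' k)"
proof -
  let ?m = "m1 + val i + val gen"
  obtain x \<kappa>' where x: "leading (by_t (omega_t i H1 0)) ?m x" "\<kappa>' \<noteq> 0"
      "leading (by_t (omega_u i H1 0)) ?m (monom \<kappa>' k)"
    using leading_omega_main[OF i h1] by blast
  have d: "leading (fps_deriv (by_t (hat H2))) ?m (fps_deriv (by_t (hat H2)) $ ?m)"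
    by (rule leadingI) (simp_all add: h2)
  have "leading (pd_u (by_t (hat H2))) ?m 0" by (rule leadingI) (simp_all add: h2)
  from leading_add[OF x(3) this] have "leading (by_t (omega_u i H1 H2)) ?m (monom \<kappa>' k)"
    unfolding omega_split[of i H1 H2] by simp
  moreover have "leading (by_t (omega_t i H1 H2)) ?m (x + fps_deriv (by_t (hat H2)) $ ?m)"
    unfolding omega_split[of i H1 H2] by (rule leading_add[OF x(1) d])
  ultimately show ?thesis using x(2) by blast
qed

lemma dicriticalI:
  assumes "leading (by_t (omega_t i H1 H2)) m x" "leading (by_t (omega_u i H1 H2)) m (monom \<kappa>' k)" "\<kappa>' \<noteq> 0"
  shows "dicritical_in \<phi> (omega_form n s Fs i H1 H2) (last_triple_point \<phi>)"
proof -
  from recenter.leading_coeff_map[OF assms(1)] recenter.leading_coeff_map[OF assms(2)]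
  obtain T1 T2 where "E (s $ bg) (omega_u i H1 H2) = fps_X ^ m * T1" "T1 $ 0 = recenter (s $ bg) (monom \<kappa>' k)"
    "E (s $ bg) (omega_t i H1 H2) = fps_X ^ m * T2"
    unfolding leading_iff by metis
  moreover have "recenter (s $ bg) (monom \<kappa>' k) \<noteq> 0" using assms(3) by (simp add: recenter_eq_0_iff)
  ultimately show ?thesis unfolding dicritical_omega_iff by metis
qed

text \<open>The derivative by \<open>t\<close> lowers the order of \<open>H2\<close> by one, the
  derivative by \<open>u\<close> does not. So the dt-part has order exactly \<open>m2 - 1\<close>
  and the du-part at least \<open>m2\<close>: after division by any common power of \<open>t\<close>
  the du-part vanishes on \<open>t = 0\<close>.\<close>

lemma not_dicritical:
  assumes i: "i < gen" and h1: "leading (by_t (hat H1)) m1 (monom \<kappa> k)" "\<kappa> \<noteq> 0"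
    and h2: "leading (by_t (hat H2)) m2 (monom \<kappa>2 k2)" "\<kappa>2 \<noteq> 0" "m2 > 0" "m2 \<le> m1 + val i + val gen"
  shows "\<not> dicritical_in \<phi> (omega_form n s Fs i H1 H2) (last_triple_point \<phi>)"
proof
  let ?m = "m1 + val i + val gen" and ?c = "s $ bg"
  obtain x \<kappa>' where x: "leading (by_t (omega_t i H1 0)) ?m x"
      "leading (by_t (omega_u i H1 0)) ?m (monom \<kappa>' k)"
    using leading_omega_main[OF i h1] by blast
  have "leading (by_t (omega_t i H1 0)) (m2 - 1) 0" using leading_lower[OF x(1)] h2 by simp
  from leading_add[OF this leading_deriv'[OF h2(1,3)]]
  have t: "leading (by_t (omega_t i H1 H2)) (m2 - 1) (of_nat m2 * monom \<kappa>2 k2)"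
    unfolding omega_split[of i H1 H2] by simp
  have u: "by_t (omega_u i H1 H2) $ j = 0" if "j < m2" for j
    using leading_nth_less[OF x(2), of j] leading_nth_less[OF leading_pd_u[OF h2(1)], of j] that h2(4)
    unfolding omega_split[of i H1 H2] by simp
  assume "dicritical_in \<phi> (omega_form n s Fs i H1 H2) (last_triple_point \<phi>)"
  then obtain m T1 T2 where T: "E ?c (omega_u i H1 H2) = fps_X ^ m * T1"
      "E ?c (omega_t i H1 H2) = fps_X ^ m * T2" "T1 $ 0 \<noteq> 0"
    unfolding dicritical_omega_iff by blast
  have "recenter ?c (by_t (omega_u i H1 H2) $ m) = T1 $ 0"
    using arg_cong[OF T(1), of "\<lambda>f. f $ m"] by (simp add: fps_X_power_mult_nth)
  hence "m2 \<le> m" using u[of m] T(3) recenter_eq_0_iff by (metis not_le)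
  have "recenter ?c (by_t (omega_t i H1 H2) $ (m2 - 1)) = 0"
    using arg_cong[OF T(2), of "\<lambda>f. f $ (m2 - 1)"] \<open>m2 \<le> m\<close> h2(3) by (simp add: fps_X_power_mult_nth)
  hence "of_nat m2 * monom \<kappa>2 k2 = 0" using t by (simp add: recenter_eq_0_iff leading_def)
  thus False using h2 by simp
qed

section \<open>The separatrices\<close>

lemma separatrix_along_curve:
  "eval_param (fst (omega_form n s Fs i H1 H2)) (puiseux_param n (base + fps_X ^ bg * U)) *
      fps_deriv (fst (puiseux_param n (base + fps_X ^ bg * U))) +
   eval_param (snd (omega_form n s Fs i H1 H2)) (puiseux_param n (base + fps_X ^ bg * U)) *
      fps_deriv (snd (puiseux_param n (base + fps_X ^ bg * U))) =
   poly (omega_t i H1 H2) U + poly (omega_u i H1 H2) U * fps_deriv U"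
proof -
  have Y: "fps_deriv (base + fps_X ^ bg * U) = poly (dx_poly [:base, fps_X ^ bg:]) U + fps_X ^ bg * fps_deriv U"
    by (simp add: dx_poly_pCons algebra_simps)
  show ?thesis
    unfolding omega_form_def Let_def fst_conv snd_conv subst_u_eval[OF n_pos, symmetric]
      omega_t_def omega_u_def omega_subst_u[OF n_pos]
    unfolding puiseux_param_def fst_conv snd_conv Y
    by (simp add: algebra_simps)
qed

lemma separatrix_family_eq:
  assumes "r 0 u = u"
  shows "separatrix_family n s (\<lambda>j. r (j - bg)) u = puiseux_param n (base + fps_X ^ bg * Abs_fps (\<lambda>j. r j u))"
proof -
  \<comment> \<open>The explicit family starts at \<open>cb 1\<close>; nothing is lost, since
    \<open>s\<close> has no terms of smaller order.\<close>
  have low: "s $ j = 0" if "j < cb 1" for j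
    using that unfolding cb_1 by (rule nth_less_subdegree_zero)
  have "(if cb 1 \<le> j \<and> j < bg then s $ j else if j = bg then u else if bg < j then r (j - bg) u else 0) =
      (base + fps_X ^ bg * Abs_fps (\<lambda>j. r j u)) $ j" for j
    using assms low[of j] by (auto simp: fps_X_power_mult_nth not_le)
  thus ?thesis unfolding separatrix_family_def puiseux_param_def Let_def
    by (simp add: fps_eq_iff)
qed

lemma separatrices:
  assumes l: "leading (by_t (omega_t i H1 H2)) m x" "leading (by_t (omega_u i H1 H2)) m (monom \<kappa> k)" "\<kappa> \<noteq> 0"
    and conv: "Fs i \<in> convergent_polys" "Fs gen \<in> convergent_polys" "H1 \<in> convergent_polys" "H2 \<in> convergent_polys"
  shows "\<exists>r. (\<forall>j > bg. rational_defined_on (- {0}) (r j)) \<and>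
     (\<forall>u. u \<noteq> 0 \<longrightarrow> separatrix (omega_form n s Fs i H1 H2) (separatrix_family n s r u) \<and>
        meets_transversally \<phi> (separatrix_family n s r u) (last_triple_point \<phi>))"
proof -
  define A where "A = map_poly (fps_shift m) (omega_t i H1 H2)"
  define B where "B = map_poly (fps_shift m) (omega_u i H1 H2)"
  have AB: "omega_t i H1 H2 = smult (fps_X ^ m) A" "omega_u i H1 H2 = smult (fps_X ^ m) B"
    "map_poly (\<lambda>f. f $ 0) B = monom \<kappa> k"
    unfolding A_def B_def using leading_by_t_divide[OF l(1)] leading_by_t_divide[OF l(2)] by auto
  have hatc: "hat G \<in> convergent_polys" if "G \<in> convergent_polys" for G
    by (rule convergent_polys_subst_u[OF n_pos convergent_cutoff that])
  have "omega_t i H1 H2 \<in> convergent_polys" "omega_u i H1 H2 \<in> convergent_polys"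
    unfolding omega_t_def omega_u_def
    by (intro convergent_omega hatc conv convergent_polys_dx convergent_polys_pderiv; assumption)+
  hence cAB: "A \<in> convergent_polys" "B \<in> convergent_polys"
    unfolding A_def B_def convergent_polys_def by (auto simp: coeff_map_poly intro: convergent_shift)
  \<comment> \<open>On \<open>t = 0\<close> the coefficient \<open>B\<close> is the monomial
    \<open>\<kappa> u^k\<close>, so its inverse has no pole outside 0.\<close>
  define b where "b = (\<lambda>u. 1 / (\<kappa> * u ^ k))"
  have b_rat: "rational_defined_on (- {0}) b"
    unfolding rational_defined_on_def b_def
    by (intro exI[of _ 1] exI[of _ "monom \<kappa> k"]) (use l in \<open>simp add: poly_monom\<close>)
  have B0: "poly B U $ 0 = \<kappa> * (U $ 0) ^ k" for U
    by (simp add: poly_nth_0 AB poly_monom)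
  have b_inv: "poly B (fps_const u) $ 0 * b u = 1" if "u \<noteq> 0" for u
    using that l by (simp add: B0 b_def)
  obtain r where r: "\<And>j. rational_defined_on (- {0}) (r j)" "\<And>u. r 0 u = u"
    "\<And>u. u \<noteq> 0 \<Longrightarrow> poly A (Abs_fps (\<lambda>j. r j u)) +
        poly B (Abs_fps (\<lambda>j. r j u)) * fps_deriv (Abs_fps (\<lambda>j. r j u)) = 0"
    using ode_formal_solution[OF b_rat b_inv, of A] by blast
  obtain N where N: "last_triple_point \<phi> = Suc N"
    "\<And>U. U $ 0 \<noteq> 0 \<Longrightarrow> meets_transversally \<phi> (puiseux_param n (base + fps_X ^ bg * U)) (Suc N)"
    using resolution_of_branch by metis
  \<comment> \<open>The solution is indexed from 0 and the family from \<open>bg\<close>; the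
    coefficient of order \<open>bg\<close> is the initial value \<open>u\<close>.\<close>
  show ?thesis
  proof (intro exI[of _ "\<lambda>j. r (j - bg)"] conjI allI impI)
    fix u :: complex assume u: "u \<noteq> 0"
    define U where "U = Abs_fps (\<lambda>j. r j u)"
    have U0: "U $ 0 = u" by (simp add: U_def r)
    have ode: "poly A U + poly B U * fps_deriv U = 0" using r(3)[OF u] by (simp add: U_def)
    have fam: "separatrix_family n s (\<lambda>j. r (j - bg)) u = puiseux_param n (base + fps_X ^ bg * U)"
      unfolding U_def by (rule separatrix_family_eq[of r u, OF r(2)])
    have "poly B U $ 0 \<noteq> 0" using u l by (simp add: B0 U0)
    from ode_solution_convergent[OF cAB this ode] have "U \<in> convergent_series" .
    hence "branch_param (puiseux_param n (base + fps_X ^ bg * U))"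
      using n_pos base_0 bg_pos
      by (simp add: branch_param_def puiseux_param_def convergent_X_power convergent_add convergent_mult convergent_cutoff)
    moreover have "poly (omega_t i H1 H2) U + poly (omega_u i H1 H2) U * fps_deriv U =
        fps_X ^ m * (poly A U + poly B U * fps_deriv U)"
      by (simp add: AB algebra_simps)
    ultimately show "separatrix (omega_form n s Fs i H1 H2) (separatrix_family n s (\<lambda>j. r (j - bg)) u)"
      unfolding separatrix_def fam separatrix_along_curve by (simp add: ode)
    show "meets_transversally \<phi> (separatrix_family n s (\<lambda>j. r (j - bg)) u) (last_triple_point \<phi>)"
      unfolding fam N(1) by (rule N(2)) (simp add: U0 u)
  qed (rule r(1))
qed

end

theorem theorem3p7:
  fixes F :: "complex fps poly" and n :: nat and s :: "complex fps"
    and Fs :: "nat \<Rightarrow> complex fps poly" and H1 H2 :: "complex fps poly" and i :: nat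
  assumes "normalized_branch F n s"
    and "canonical_semiroots F n s Fs"
    and "i < genus n s"
    and "H1 \<in> convergent_polys" and "degree H1 < degree F" and "H1 \<noteq> 0"
    and "H2 \<in> convergent_polys" and "degree H2 < degree F" and "fps_of_poly H2 \<in> max_ideal2"
    and "singular_foliation (omega_form n s Fs i H1 H2)"
  shows "(dicritical_in (puiseux_param n s) (omega_form n s Fs i H1 H2)
            (last_triple_point (puiseux_param n s)) \<longleftrightarrow>
          intersection_mult (puiseux_param n s) H1 + enat (semigroup_gen n s i)
            + enat (semigroup_gen n s (genus n s))
          < intersection_mult (puiseux_param n s) H2) \<and>
         (dicritical_in (puiseux_param n s) (omega_form n s Fs i H1 H2)
            (last_triple_point (puiseux_param n s)) \<longrightarrow>
          (\<exists>r :: nat \<Rightarrow> complex \<Rightarrow> complex.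
             (\<forall>j > char_exp n s (genus n s). rational_defined_on (- {0}) (r j)) \<and>
             (\<forall>u. u \<noteq> 0 \<longrightarrow>
                separatrix (omega_form n s Fs i H1 H2) (separatrix_family n s r u) \<and>
                meets_transversally (puiseux_param n s) (separatrix_family n s r u)
                  (last_triple_point (puiseux_param n s)))))"
proof -
  interpret branch n s Fs
  proof unfold_locales
    show "n > 1" "n < subdegree s" "\<not> n dvd subdegree s" "Gcd (insert n {k. s $ k \<noteq> 0}) = 1"
      using assms(1) unfolding normalized_branch_def by blast+
    show "Fs 0 = [:fps_X:]" using assms(2) unfolding canonical_semiroots_def by blast
    show "is_min_poly n (map_poly fps_to_fls (Fs j)) (fps_to_fls (fps_cutoff (char_exp n s j) s))"
      if "0 < j" "j \<le> genus n s" for j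
      using assms(2) that unfolding canonical_semiroots_def by simp
  qed
  have deg: "degree F = n" using assms(1) by (simp add: normalized_branch_def)
  have convF: "Fs j \<in> convergent_polys" if "j \<le> gen" for j
  proof (cases "j = 0")
    case True
    have "[:fps_X:] \<in> convergent_polys"
      using convergent_X_power[of 1] by (simp add: convergent_poly_pCons convergent_polys_0)
    thus ?thesis using True by (simp add: Fs_0)
  next
    case False
    thus ?thesis using assms(2) that by (simp add: canonical_semiroots_def)
  qed
  obtain m1 k \<kappa> where h1: "\<kappa> \<noteq> 0" "leading (by_t (hat H1)) m1 (monom \<kappa> k)"
    using leading_hat[OF assms(6)] assms(5) deg by auto
  have I1: "intersection_mult \<phi> H1 = enat m1" by (rule intersection_hat(1)[OF h1(2,1)])
  let ?m = "m1 + val i + val gen"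
  \<comment> \<open>Covers \<open>H2 = 0\<close>, where the multiplicity is infinite, together with
    a nonzero \<open>H2\<close> of large order.\<close>
  have goal1: "?thesis" if h2: "\<And>j. j \<le> ?m \<Longrightarrow> by_t (hat H2) $ j = 0"
    and I2: "enat ?m < intersection_mult \<phi> H2"
  proof -
    obtain m x \<kappa>' where l: "\<kappa>' \<noteq> 0" "leading (by_t (omega_t i H1 H2)) m x"
        "leading (by_t (omega_u i H1 H2)) m (monom \<kappa>' k)"
      using leading_omega_dicritical[OF assms(3) h1(2,1) h2] by blast
    have "dicritical_in \<phi> (omega_form n s Fs i H1 H2) (last_triple_point \<phi>)"
      by (rule dicriticalI[OF l(2,3,1)])
    moreover have "intersection_mult \<phi> H1 + enat (val i) + enat (val gen) < intersection_mult \<phi> H2"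
      using I1 I2 by simp
    ultimately show ?thesis
      using separatrices[OF l(2,3,1) convF convF assms(4,7)] assms(3) by simp
  qed
  show ?thesis
  proof (cases "H2 = 0")
    case True
    show ?thesis by (rule goal1) (simp_all add: True n_pos intersection_hat(2))
  next
    case False
    obtain m2 k2 \<kappa>2 where h2: "\<kappa>2 \<noteq> 0" "leading (by_t (hat H2)) m2 (monom \<kappa>2 k2)"
      using leading_hat[OF False] assms(8) deg by auto
    have I2: "intersection_mult \<phi> H2 = enat m2" by (rule intersection_hat(1)[OF h2(2,1)])
    show ?thesis
    proof (cases "?m < m2")
      case True
      show ?thesis
      proof (rule goal1)
        show "by_t (hat H2) $ j = 0" if "j \<le> ?m" for j
          using leading_nth_less[OF h2(2), of j] that True by simp
      qed (simp add: I2 True)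
    next
      case le: False
      \<comment> \<open>A term of order 0 would disappear under the derivative by \<open>t\<close>;
        \<open>H2\<close> has none because it vanishes at the origin.\<close>
      have "m2 \<noteq> 0"
      proof
        assume "m2 = 0"
        hence "by_t (hat H2) $ 0 \<noteq> 0" using h2 by (simp add: leading_def)
        moreover have "coeff H2 0 $ 0 = 0"
          using assms(9) by (auto simp: max_ideal2_def var_x_def var_y_def simp flip: fps_of_poly_nth)
        moreover have "by_t (hat H2) $ 0 = [:coeff H2 0 $ 0:]"
        proof (cases H2)
          case (pCons a G)
          have "fam2 $ 0 = 0" using base_0 bg_pos by (simp add: fam2_nth)
          thus ?thesis unfolding pCons(1) by_t_hat_pCons by (simp add: by_t_const_nth)
        qed
        ultimately show False by simp
      qed
      hence "\<not> dicritical_in \<phi> (omega_form n s Fs i H1 H2) (last_triple_point \<phi>)"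
        using not_dicritical[OF assms(3) h1(2,1) h2(2,1)] le by simp
      moreover have "\<not> intersection_mult \<phi> H1 + enat (val i) + enat (val gen) < intersection_mult \<phi> H2"
        using le by (simp add: I1 I2)
      ultimately show ?thesis by blast
    qed
  qed
qed

end
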